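(* Let $W\in Gr(\mathbb H)$ be such that the $\Gamma_1$-orbit of $[L_W]$ is a torus $\mathbb C/\Lambda$, and let $\mu\in\mathrm{Hom}(\Lambda,S^1)$ be the corresponding monodromy of $L_W$, i.e. $L_W(z+\lambda)=\mu(\lambda)^{-1}L_W(z)\mu(\lambda)$ for $\lambda\in\Lambda$. Let $V\subset W$ be an $\mathbb H$-subspace of $\mathbb H$-codimension $n+1$ such that (i) $\psi_W(z)\notin V$ for every $z\in\mathbb C$, and (ii) for every $\lambda\in\Lambda$, $\psi_W(z+\lambda)-\mu(\lambda)^{-1}\psi_W(z)\in V$ for all $z\in\mathbb C$. Then the map $$f:\mathbb C/\Lambda\to\mathbb P(W/V)\simeq\mathbb{HP}^n,\qquad z+\Lambda\mapsto[\psi_W(z)+V],$$ (where the brackets denote the left $\mathbb H$-line spanned in $W/V$) is a quaternionic holomorphic curve.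
   Context: Grassmannian. $\mathbb H$ = quaternions, $\mathbb C=\mathrm{span}_{\mathbb R}(1,i)$. $H=L^2(S^1,\mathbb H)$ with left Fourier series $f=\sum q_m\zeta^m$, $q_m\in\mathbb H$, a complex Hilbert space via left multiplication by $i$ and $\langle f,g\rangle=\int_{S^1}(f\bar g)_{\mathbb C}$, $(a+bj)_{\mathbb C}=a$. $H_\pm$: functions with only non-negative/negative powers of $\zeta$. $Gr(\mathbb H)$: closed left $\mathbb H$-subspaces $W\subset H$ with $\mathrm{pr}_+:W\to H_+$ Fredholm of index zero and $\mathrm{pr}_-:W\to H_-$ Hilbert–Schmidt. $\Gamma$ = real analytic maps $S^1\to\mathbb C^\times$ of winding number $0$, acting by $\gamma\circ W=W\gamma$; $\Gamma_-$: those extending holomorphically without zeros to $|\zeta|>1$ including $\infty$, real positive at $\infty$; $\Gamma_0=\{e^{it_0}:t_0\in\mathbb R\}$; $\Gamma_1=\{e^{z\zeta}:z=x+iy\in\mathbb C\}\simeq\mathbb C$. Baker function. $\psi_W(z)$ is the unique element of $W$ of the form $\psi_W(z)=(1+\sum_{k\ge1}a_k(z)\zeta^{-k})e^{z\zeta}$, $a_k(z)\in\mathbb H$ (it exists for almost all $z$; here it is used for all $z\in\mathbb C$). $L_W(z)=K_W\,i\partial_y\,K_W^{-1}$ with $K_W=1+\sum_{k>0}a_k(i\partial_y^{-1})^k$. It satisfies $\left(\partial/\partial\bar z+U_W\right)\psi_W=0$ with $U_W=-\tfrac12(a_1+ia_1i)$. $\mathcal M=Gr(\mathbb H)/\Gamma_-$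 is identified with $\{L_W\}$ via $\Gamma_-\circ W\mapsto L_W$; $\Gamma_1$ and $\Gamma_0$ act by $\gamma\circ L_W=L_{W\gamma}$; $[L_W]\in\mathcal M/\Gamma_0$ is the $\Gamma_0$-orbit of $L_W$. Quaternionic holomorphic curve. A map $f$ from a Riemann surface $M$ (complex structure $J_M$) to $\mathbb P(\mathcal V)$, the space of left $\mathbb H$-lines in an $(n+1)$-dimensional left $\mathbb H$-space $\mathcal V$, corresponds to the line subbundle $L\subset M\times\mathcal V$, $L_p=f(p)$. Its differential is represented by $\delta f\in\Omega^1_M(\mathrm{Hom}(L,(M\times\mathcal V)/L))$, $\delta f(\psi)=d\psi\bmod L$ for sections $\psi$ of $L$. Write $*\omega=\omega\circ J_M$. $f$ is a quaternionic holomorphic curve if there is $J\in\mathrm{End}_{\mathbb H}(L)$ with $J^2=-I$ and $*\delta f=\delta f\circ J$.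
   Formalization: The H-subspace V is assumed closed in W; for a non-closed V of finite codimension the map f can be prescribed arbitrarily on a fundamental domain, since the Baker functions are linearly independent, so it need not even be continuous. *)

theory Defs
  imports "HOL-Analysis.Analysis"
begin

section \<open>Quaternions\<close>

text \<open>\<open>Quat a b\<close> is the quaternion \<open>a + b j\<close>, where \<open>j c = cnj c j\<close> for complex \<open>c\<close>.\<close>

datatype quat = Quat (qfst: complex) (qsnd: complex)

lemma quat_eq_iff: "p = q \<longleftrightarrow> qfst p = qfst q \<and> qsnd p = qsnd q"
  using quat.expand by blast

instantiation quat :: real_algebra_1
begin

definition "0 = Quat 0 0"
definition "1 = Quat 1 0"
definition "p + q = Quat (qfst p + qfst q) (qsnd p + qsnd q)"
definition "- p = Quat (- qfst p) (- qsnd p)"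
definition "p - q = Quat (qfst p - qfst q) (qsnd p - qsnd q)"
definition "p * q = Quat (qfst p * qfst q - qsnd p * cnj (qsnd q))
                         (qfst p * qsnd q + qsnd p * cnj (qfst q))"
definition "r *\<^sub>R p = Quat (r *\<^sub>R qfst p) (r *\<^sub>R qsnd p)"

lemmas quat_defs = zero_quat_def one_quat_def plus_quat_def uminus_quat_def minus_quat_def
  times_quat_def scaleR_quat_def

instance
  by standard (simp_all add: quat_eq_iff quat_defs algebra_simps)

end

instantiation quat :: real_normed_div_algebra
begin

definition "norm p = sqrt ((cmod (qfst p))\<^sup>2 + (cmod (qsnd p))\<^sup>2)"
definition "inverse p = (1 / (norm (p::quat))\<^sup>2) *\<^sub>R Quat (cnj (qfst p)) (- qsnd p)"
definition "p div q = p * inverse (q::quat)"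
definition "sgn p = p /\<^sub>R norm (p::quat)"
definition "dist p q = norm (p - q :: quat)"
definition [code del]:
  "(uniformity :: (quat \<times> quat) filter) = (INF e\<in>{0 <..}. principal {(x, y). dist x y < e})"
definition [code del]:
  "open (U :: quat set) \<longleftrightarrow> (\<forall>x\<in>U. eventually (\<lambda>(x', y). x' = x \<longrightarrow> y \<in> U) uniformity)"

lemma norm_quat_sq: "(norm (p::quat))\<^sup>2 = (cmod (qfst p))\<^sup>2 + (cmod (qsnd p))\<^sup>2"
  by (simp add: norm_quat_def)

lemma quat_mult_conj:
  "p * Quat (cnj (qfst p)) (- qsnd p) = (norm p)\<^sup>2 *\<^sub>R (1::quat)"
  "Quat (cnj (qfst p)) (- qsnd p) * p = (norm p)\<^sup>2 *\<^sub>R (1::quat)"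
  unfolding norm_quat_sq quat_eq_iff quat_defs quat.sel complex_eq_iff cmod_power2
  by (simp_all add: power2_eq_square algebra_simps)

lemma norm_quat_0: "norm (p::quat) = 0 \<longleftrightarrow> p = 0"
  by (simp add: norm_quat_def quat_eq_iff zero_quat_def add_nonneg_eq_0_iff)

lemma norm_quat_pair: "norm (p::quat) = norm (qfst p, qsnd p)"
  by (simp add: norm_quat_def norm_Pair)

instance
proof
  fix p q :: quat and x :: real
  show "p \<noteq> 0 \<Longrightarrow> inverse p * p = 1" "p \<noteq> 0 \<Longrightarrow> p * inverse p = 1"
    by (simp_all add: inverse_quat_def quat_mult_conj norm_quat_0)
  show "inverse (0::quat) = 0"
    by (simp add: inverse_quat_def quat_eq_iff quat_defs)
  show "p div q = p * inverse q" by (rule divide_quat_def)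
  show "norm p = 0 \<longleftrightarrow> p = 0" by (rule norm_quat_0)
  have "norm (p + q) = norm ((qfst p, qsnd p) + (qfst q, qsnd q))"
    by (simp add: norm_quat_pair plus_quat_def)
  also have "\<dots> \<le> norm p + norm q"
    unfolding norm_quat_pair by (rule norm_triangle_ineq)
  finally show "norm (p + q) \<le> norm p + norm q" .
  have "norm (x *\<^sub>R p) = norm (x *\<^sub>R (qfst p, qsnd p))"
    by (simp add: norm_quat_pair scaleR_quat_def)
  then show "norm (x *\<^sub>R p) = \<bar>x\<bar> * norm p"
    by (simp only: norm_scaleR norm_quat_pair)
  have "(norm (p * q))\<^sup>2 = (norm p * norm q)\<^sup>2"
    unfolding norm_quat_sq power_mult_distrib times_quat_def quat.sel cmod_power2
    by (simp add: power2_eq_square) algebra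
  then show "norm (p * q) = norm p * norm q"
    by (rule power2_eq_imp_eq) (simp_all add: norm_quat_def)
qed (rule sgn_quat_def dist_quat_def open_quat_def uniformity_quat_def)+

end

instantiation quat :: real_inner
begin

definition "inner p q = inner (qfst p) (qfst q) + inner (qsnd p) (qsnd q)"

instance
proof
  fix p q r :: quat and x :: real
  show "inner p q = inner q p" by (simp add: inner_quat_def inner_commute)
  show "inner (p + q) r = inner p r + inner q r"
    by (simp add: inner_quat_def quat_defs inner_add_left)
  show "inner (x *\<^sub>R p) q = x * inner p q"
    by (simp add: inner_quat_def quat_defs distrib_left)
  show "0 \<le> inner p p" by (simp add: inner_quat_def)
  show "norm p = sqrt (inner p p)"
    by (simp add: inner_quat_def norm_quat_def power2_norm_eq_inner)
  then show "inner p p = 0 \<longleftrightarrow> p = 0"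
    using norm_eq_zero[of p] by (metis \<open>0 \<le> inner p p\<close> real_sqrt_eq_zero_cancel_iff)
qed

end

instantiation quat :: euclidean_space
begin

definition "Basis = {Quat 1 0, Quat \<i> 0, Quat 0 1, Quat 0 \<i>}"

instance
proof
  fix u v p :: quat
  show "u \<in> Basis \<Longrightarrow> v \<in> Basis \<Longrightarrow> inner u v = (if u = v then 1 else 0)"
    unfolding Basis_quat_def by (elim insertE emptyE; simp add: inner_quat_def)
  have "(\<forall>u\<in>Basis. inner p u = 0) \<longleftrightarrow>
      Re (qfst p) = 0 \<and> Im (qfst p) = 0 \<and> Re (qsnd p) = 0 \<and> Im (qsnd p) = 0"
    by (simp add: Basis_quat_def inner_quat_def inner_complex_def)
  also have "\<dots> \<longleftrightarrow> p = 0"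
    by (simp add: quat_eq_iff zero_quat_def complex_eq_iff)
  finally show "(\<forall>u\<in>Basis. inner p u = 0) \<longleftrightarrow> p = 0" .
qed (simp_all add: Basis_quat_def)

end

definition qcnj :: "quat \<Rightarrow> quat"
  where "qcnj p = Quat (cnj (qfst p)) (- qsnd p)"

definition of_cpx :: "complex \<Rightarrow> quat"
  where "of_cpx c = Quat c 0"


section \<open>The Hilbert space of square integrable quaternion valued functions on the circle\<close>

text \<open>Arc length on the unit circle of the complex plane, normalised to total mass 1, so that the
  \<open>\<zeta>\<^sup>m\<close> are orthonormal. It is a measure on the whole plane, concentrated on the circle.\<close>

definition circle_measure :: "complex measure"
  where "circle_measure = distr (uniform_measure lborel {0..2 * pi}) borel cis"

definition sq_int :: "(complex \<Rightarrow> quat) \<Rightarrow> bool"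
  where "sq_int f \<longleftrightarrow>
    f \<in> borel_measurable circle_measure \<and> integrable circle_measure (\<lambda>\<zeta>. (norm (f \<zeta>))\<^sup>2)"

definition l2_eq :: "(complex \<Rightarrow> quat) \<Rightarrow> (complex \<Rightarrow> quat) \<Rightarrow> bool"
  where "l2_eq f g \<longleftrightarrow> sq_int f \<and> sq_int g \<and> (AE \<zeta> in circle_measure. f \<zeta> = g \<zeta>)"

lemma sq_int_0: "sq_int (\<lambda>_. 0)"
  by (simp add: sq_int_def)

lemma sq_int_add:
  assumes "sq_int f" "sq_int g"
  shows "sq_int (\<lambda>\<zeta>. f \<zeta> + g \<zeta>)"
proof -
  have [measurable]: "f \<in> borel_measurable circle_measure" "g \<in> borel_measurable circle_measure"
    using assms by (auto simp: sq_int_def)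
  have "(norm (a + b))\<^sup>2 \<le> 2 * (norm a)\<^sup>2 + 2 * (norm b)\<^sup>2" for a b :: quat
  proof -
    have "(norm (a + b))\<^sup>2 \<le> (norm a + norm b)\<^sup>2"
      by (intro power_mono norm_triangle_ineq) auto
    also have "\<dots> \<le> 2 * (norm a)\<^sup>2 + 2 * (norm b)\<^sup>2"
      using sum_squares_bound[of "norm a" "norm b"] by (simp add: power2_sum)
    finally show ?thesis .
  qed
  moreover have "integrable circle_measure (\<lambda>\<zeta>. 2 * (norm (f \<zeta>))\<^sup>2 + 2 * (norm (g \<zeta>))\<^sup>2)"
    using assms by (auto simp: sq_int_def)
  ultimately have "integrable circle_measure (\<lambda>\<zeta>. (norm (f \<zeta> + g \<zeta>))\<^sup>2)"
    by (intro Bochner_Integration.integrable_bound[of _ _ "\<lambda>\<zeta>. (norm (f \<zeta> + g \<zeta>))\<^sup>2"]) auto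
  then show ?thesis by (simp add: sq_int_def)
qed

lemma sq_int_mult_left:
  assumes "sq_int f"
  shows "sq_int (\<lambda>\<zeta>. q * f \<zeta>)"
proof -
  have [measurable]: "f \<in> borel_measurable circle_measure"
    using assms by (auto simp: sq_int_def)
  have "(\<lambda>x. q * x) \<in> borel_measurable borel"
    by (intro borel_measurable_continuous_onI continuous_intros)
  then have "(\<lambda>\<zeta>. q * f \<zeta>) \<in> borel_measurable circle_measure"
    by measurable
  then show ?thesis
    using assms by (simp add: sq_int_def norm_mult power_mult_distrib)
qed

lemma sq_int_scaleR: "sq_int f \<Longrightarrow> sq_int (\<lambda>\<zeta>. r *\<^sub>R f \<zeta>)"
  using sq_int_mult_left[of f "of_real r"] by (simp add: scaleR_conv_of_real)

lemma sq_int_uminus: "sq_int f \<Longrightarrow> sq_int (\<lambda>\<zeta>. - f \<zeta>)"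
  using sq_int_scaleR[of f "- 1"] by simp

lemma sq_int_diff: "sq_int f \<Longrightarrow> sq_int g \<Longrightarrow> sq_int (\<lambda>\<zeta>. f \<zeta> - g \<zeta>)"
  using sq_int_add[of f "\<lambda>\<zeta>. - g \<zeta>"] sq_int_uminus[of g] by simp

lemma sq_int_inner:
  assumes "sq_int f" "sq_int g"
  shows "integrable circle_measure (\<lambda>\<zeta>. inner (f \<zeta>) (g \<zeta>))"
proof (rule Bochner_Integration.integrable_bound)
  have [measurable]: "f \<in> borel_measurable circle_measure" "g \<in> borel_measurable circle_measure"
    using assms by (auto simp: sq_int_def)
  show "(\<lambda>\<zeta>. inner (f \<zeta>) (g \<zeta>)) \<in> borel_measurable circle_measure"
    by measurable
  show "integrable circle_measure (\<lambda>\<zeta>. (norm (f \<zeta>))\<^sup>2 + (norm (g \<zeta>))\<^sup>2)"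
    using assms by (auto simp: sq_int_def)
  have "\<bar>inner a b\<bar> \<le> (norm a)\<^sup>2 + (norm b)\<^sup>2" for a b :: quat
  proof -
    have "\<bar>inner a b\<bar> \<le> norm a * norm b" by (rule Cauchy_Schwarz_ineq2)
    also have "\<dots> \<le> (norm a)\<^sup>2 + (norm b)\<^sup>2"
      using sum_squares_bound[of "norm a" "norm b"] mult_nonneg_nonneg[of "norm a" "norm b"]
        norm_ge_zero[of a] norm_ge_zero[of b] by linarith
    finally show ?thesis .
  qed
  then show "AE \<zeta> in circle_measure.
      norm (inner (f \<zeta>) (g \<zeta>)) \<le> norm ((norm (f \<zeta>))\<^sup>2 + (norm (g \<zeta>))\<^sup>2)"
    by simp
qed

lemma l2_eq_refl: "sq_int f \<Longrightarrow> l2_eq f f"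
  by (simp add: l2_eq_def)

lemma l2_eq_part_equivp: "part_equivp l2_eq"
proof (rule part_equivpI)
  show "\<exists>f. l2_eq f f" using sq_int_0 l2_eq_refl by blast
  show "symp l2_eq" by (rule sympI) (auto simp: l2_eq_def eq_commute)
  show "transp l2_eq" by (rule transpI) (auto simp: l2_eq_def)
qed

quotient_type L2H = "complex \<Rightarrow> quat" / partial: l2_eq
  by (rule l2_eq_part_equivp)

instantiation L2H :: real_vector
begin

lift_definition zero_L2H :: L2H is "\<lambda>_. 0"
  by (intro l2_eq_refl sq_int_0)

lift_definition plus_L2H :: "L2H \<Rightarrow> L2H \<Rightarrow> L2H" is "\<lambda>f g \<zeta>. f \<zeta> + g \<zeta>"
  unfolding l2_eq_def by (auto intro: sq_int_add)

lift_definition uminus_L2H :: "L2H \<Rightarrow> L2H" is "\<lambda>f \<zeta>. - f \<zeta>"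
  unfolding l2_eq_def by (auto intro: sq_int_uminus)

lift_definition minus_L2H :: "L2H \<Rightarrow> L2H \<Rightarrow> L2H" is "\<lambda>f g \<zeta>. f \<zeta> - g \<zeta>"
  unfolding l2_eq_def by (auto intro: sq_int_diff)

lift_definition scaleR_L2H :: "real \<Rightarrow> L2H \<Rightarrow> L2H" is "\<lambda>r f \<zeta>. r *\<^sub>R f \<zeta>"
  unfolding l2_eq_def by (auto intro: sq_int_scaleR)

instance
proof
  fix f g h :: L2H and x y :: real
  show "f + g + h = f + (g + h)" "f + g = g + f" "0 + f = f" "- f + f = 0" "f - g = f + - g"
    "x *\<^sub>R (f + g) = x *\<^sub>R f + x *\<^sub>R g" "(x + y) *\<^sub>R f = x *\<^sub>R f + y *\<^sub>R f"
    "x *\<^sub>R y *\<^sub>R f = (x * y) *\<^sub>R f" "1 *\<^sub>R f = f"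
    by (transfer, auto simp: l2_eq_def algebra_simps
        intro!: sq_int_add sq_int_diff sq_int_uminus sq_int_scaleR sq_int_0)+
qed

end

instantiation L2H :: real_inner
begin

lift_definition inner_L2H :: "L2H \<Rightarrow> L2H \<Rightarrow> real"
  is "\<lambda>f g. \<integral>\<zeta>. inner (f \<zeta>) (g \<zeta>) \<partial>circle_measure"
proof -
  fix f f' g g' assume *: "l2_eq f f'" "l2_eq g g'"
  show "(\<integral>\<zeta>. inner (f \<zeta>) (g \<zeta>) \<partial>circle_measure) = (\<integral>\<zeta>. inner (f' \<zeta>) (g' \<zeta>) \<partial>circle_measure)"
    using * by (intro integral_cong_AE)
      (auto simp: l2_eq_def dest: sq_int_inner borel_measurable_integrable)
qed

definition "norm f = sqrt (inner f (f::L2H))"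
definition "sgn f = f /\<^sub>R norm (f::L2H)"
definition "dist f g = norm (f - g :: L2H)"
definition [code del]:
  "(uniformity :: (L2H \<times> L2H) filter) = (INF e\<in>{0 <..}. principal {(x, y). dist x y < e})"
definition [code del]:
  "open (U :: L2H set) \<longleftrightarrow> (\<forall>x\<in>U. eventually (\<lambda>(x', y). x' = x \<longrightarrow> y \<in> U) uniformity)"

instance
proof
  fix f g h :: L2H and x :: real
  show "inner f g = inner g f"
    by transfer (simp add: inner_commute)
  show "inner (f + g) h = inner f h + inner g h"
    by transfer (simp add: inner_add_left l2_eq_def sq_int_inner)
  show "inner (x *\<^sub>R f) g = x * inner f g"
    by transfer (simp add: l2_eq_def sq_int_inner)
  show "0 \<le> inner f f"
    by transfer simp
  show "inner f f = 0 \<longleftrightarrow> f = 0"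
  proof transfer
    fix f assume "l2_eq f f"
    then have f: "sq_int f" by (simp add: l2_eq_def)
    have "(\<integral>\<zeta>. inner (f \<zeta>) (f \<zeta>) \<partial>circle_measure) = 0
        \<longleftrightarrow> (AE \<zeta> in circle_measure. inner (f \<zeta>) (f \<zeta>) = 0)"
      by (intro integral_nonneg_eq_0_iff_AE sq_int_inner f) auto
    then show "(\<integral>\<zeta>. inner (f \<zeta>) (f \<zeta>) \<partial>circle_measure) = 0 \<longleftrightarrow> l2_eq f (\<lambda>_. 0)"
      using f by (simp add: l2_eq_def sq_int_0)
  qed
qed (rule norm_L2H_def sgn_L2H_def dist_L2H_def open_L2H_def uniformity_L2H_def)+

end

lift_definition qscale :: "quat \<Rightarrow> L2H \<Rightarrow> L2H"  (infixr "*\<^sub>Q" 75) is "\<lambda>q f \<zeta>. q * f \<zeta>"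
  unfolding l2_eq_def by (auto intro: sq_int_mult_left)

text \<open>The complex valued inner product \<open>\<integral> (f \<bar>g)\<^sub>\<complex>\<close>; its real part is the inner product of the
  type class.\<close>

definition cinner :: "L2H \<Rightarrow> L2H \<Rightarrow> complex"
  where "cinner f g = (\<integral>\<zeta>. qfst (rep_L2H f \<zeta> * qcnj (rep_L2H g \<zeta>)) \<partial>circle_measure)"

text \<open>Right multiplication by a complex valued function \<open>\<gamma>\<close> on the circle; only meaningful if the
  product is again square integrable, for instance for continuous \<open>\<gamma>\<close>.\<close>

definition rmult :: "L2H \<Rightarrow> (complex \<Rightarrow> complex) \<Rightarrow> L2H"
  where "rmult f \<gamma> = abs_L2H (\<lambda>\<zeta>. rep_L2H f \<zeta> * of_cpx (\<gamma> \<zeta>))"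

text \<open>The function \<open>q \<zeta>\<^sup>m\<close>.\<close>

definition qmonom :: "quat \<Rightarrow> int \<Rightarrow> L2H"
  where "qmonom q m = abs_L2H (\<lambda>\<zeta>. q * of_cpx (\<zeta> powi m))"

text \<open>The coefficient \<open>q\<^sub>m\<close> of the left Fourier series \<open>\<Sum> q\<^sub>m \<zeta>\<^sup>m\<close>.\<close>

definition fourier :: "L2H \<Rightarrow> int \<Rightarrow> quat"
  where "fourier f m = (\<integral>\<zeta>. rep_L2H f \<zeta> * of_cpx (\<zeta> powi (- m)) \<partial>circle_measure)"



section \<open>The Grassmannian\<close>

definition H_plus :: "L2H set"
  where "H_plus = {f. \<forall>m<0. fourier f m = 0}"

definition H_minus :: "L2H set"
  where "H_minus = {f. \<forall>m\<ge>0. fourier f m = 0}"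

definition pr_plus :: "L2H \<Rightarrow> L2H"
  where "pr_plus f = (THE g. g \<in> H_plus \<and> f - g \<in> H_minus)"

definition pr_minus :: "L2H \<Rightarrow> L2H"
  where "pr_minus f = (THE g. g \<in> H_minus \<and> f - g \<in> H_plus)"

definition left_subspace :: "L2H set \<Rightarrow> bool"
  where "left_subspace W \<longleftrightarrow>
    0 \<in> W \<and> (\<forall>f\<in>W. \<forall>g\<in>W. f + g \<in> W) \<and> (\<forall>q. \<forall>f\<in>W. q *\<^sub>Q f \<in> W)"

text \<open>\<open>W / V\<close> has dimension \<open>n\<close> as a left vector space over the division subring \<open>K\<close> of the
  quaternions: some \<open>b\<^sub>0, \<dots>, b\<^sub>n\<^sub>-\<^sub>1\<close> in \<open>W\<close> form a basis modulo \<open>V\<close>.\<close>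

definition quot_dim :: "quat set \<Rightarrow> L2H set \<Rightarrow> L2H set \<Rightarrow> nat \<Rightarrow> bool"
  where "quot_dim K W V n \<longleftrightarrow> (\<exists>b. (\<forall>i<n. b i \<in> W) \<and>
    (\<forall>w\<in>W. \<exists>!c. c \<in> {..<n} \<rightarrow>\<^sub>E K \<and> w - (\<Sum>i<n. c i *\<^sub>Q b i) \<in> V))"

text \<open>Kernel and cokernel of \<open>T : W \<rightarrow> X\<close> have the same finite complex dimension. For bounded
  operators between Hilbert spaces a finite dimensional cokernel forces the range to be closed.\<close>

definition fredholm_index_zero :: "(L2H \<Rightarrow> L2H) \<Rightarrow> L2H set \<Rightarrow> L2H set \<Rightarrow> bool"
  where "fredholm_index_zero T W X \<longleftrightarrow>
    (\<exists>d. quot_dim (range of_cpx) {w \<in> W. T w = 0} {0} d \<and> quot_dim (range of_cpx) X (T ` W) d)"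

text \<open>Orthonormal bases of \<open>W\<close> as a complex Hilbert space, that is maximal orthonormal subsets.\<close>

definition hilbert_basis :: "L2H set \<Rightarrow> L2H set \<Rightarrow> bool"
  where "hilbert_basis W E \<longleftrightarrow> E \<subseteq> W \<and>
    (\<forall>e\<in>E. \<forall>e'\<in>E. cinner e e' = (if e = e' then 1 else 0)) \<and>
    (\<forall>w\<in>W. (\<forall>e\<in>E. cinner w e = 0) \<longrightarrow> w = 0)"

definition hilbert_schmidt :: "(L2H \<Rightarrow> L2H) \<Rightarrow> L2H set \<Rightarrow> bool"
  where "hilbert_schmidt T W \<longleftrightarrow>
    (\<exists>E. hilbert_basis W E \<and> (\<lambda>e. (norm (T e))\<^sup>2) summable_on E)"

definition Gr :: "L2H set set"
  where "Gr = {W. left_subspace W \<and> closed W \<and>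
    fredholm_index_zero pr_plus W H_plus \<and> hilbert_schmidt pr_minus W}"


section \<open>The Baker function\<close>

text \<open>\<open>\<psi> = (1 + \<Sum>\<^sub>k\<^sub>\<ge>\<^sub>1 a\<^sub>k \<zeta>\<^sup>-\<^sup>k) exp (z \<zeta>)\<close>, the series converging in \<open>L\<^sup>2\<close>; the leading
  coefficient 1 is included as \<open>a\<^sub>0\<close>.\<close>

definition baker_form :: "complex \<Rightarrow> (nat \<Rightarrow> quat) \<Rightarrow> L2H \<Rightarrow> bool"
  where "baker_form z a \<psi> \<longleftrightarrow> a 0 = 1 \<and>
    (\<exists>g. (\<lambda>k. qmonom (a k) (- int k)) sums g \<and> \<psi> = rmult g (\<lambda>\<zeta>. exp (z * \<zeta>)))"

definition baker_exists :: "L2H set \<Rightarrow> complex \<Rightarrow> bool"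
  where "baker_exists W z \<longleftrightarrow> (\<exists>!\<psi>. \<psi> \<in> W \<and> (\<exists>a. baker_form z a \<psi>))"

definition baker :: "L2H set \<Rightarrow> complex \<Rightarrow> L2H"
  where "baker W z = (THE \<psi>. \<psi> \<in> W \<and> (\<exists>a. baker_form z a \<psi>))"

definition baker_coeff :: "L2H set \<Rightarrow> complex \<Rightarrow> nat \<Rightarrow> quat"
  where "baker_coeff W z = (THE a. baker_form z a (baker W z))"


section \<open>Formal pseudodifferential operators in \<open>\<partial>\<^sub>y\<close>\<close>

text \<open>\<open>A :: psdo\<close> stands for \<open>\<Sum>\<^sub>m A m \<partial>\<^sub>y\<^sup>m\<close>, where only finitely many \<open>m > 0\<close> occur and the
  coefficients act by left multiplication. The product follows from
  \<open>\<partial>\<^sub>y\<^sup>m b = \<Sum>\<^sub>k\<^sub>\<ge>\<^sub>0 (m gchoose k) (\<partial>\<^sub>y\<^sup>k b) \<partial>\<^sub>y\<^sup>m\<^sup>-\<^sup>k\<close>; the sum below is finite as both orders are bounded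
  above.\<close>

type_synonym psdo = "int \<Rightarrow> complex \<Rightarrow> quat"

definition dy :: "(complex \<Rightarrow> quat) \<Rightarrow> complex \<Rightarrow> quat"
  where "dy g z = vector_derivative (\<lambda>t. g (z + of_real t * \<i>)) (at 0)"

definition psdo_mult :: "psdo \<Rightarrow> psdo \<Rightarrow> psdo"
  where "psdo_mult A B r z =
    (\<Sum>(m, n) | A m \<noteq> (\<lambda>_. 0) \<and> B n \<noteq> (\<lambda>_. 0) \<and> r \<le> m + n.
      (real_of_int m gchoose nat (m + n - r)) *\<^sub>R (A m z * (dy ^^ nat (m + n - r)) (B n) z))"

definition psdo_one :: psdo
  where "psdo_one m z = (if m = 0 then 1 else 0)"

definition psdo_inverse :: "psdo \<Rightarrow> psdo"
  where "psdo_inverse A = (THE B. (\<forall>m>0. B m = (\<lambda>_. 0)) \<and>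
    psdo_mult A B = psdo_one \<and> psdo_mult B A = psdo_one)"

text \<open>\<open>i \<partial>\<^sub>y\<close>, with \<open>i\<close> acting by left multiplication.\<close>

definition psdo_idy :: psdo
  where "psdo_idy m z = (if m = 1 then of_cpx \<i> else 0)"

text \<open>\<open>K\<^sub>W = 1 + \<Sum>\<^sub>k\<^sub>>\<^sub>0 a\<^sub>k (i \<partial>\<^sub>y\<^sup>-\<^sup>1)\<^sup>k\<close>, where \<open>(i \<partial>\<^sub>y\<^sup>-\<^sup>1)\<^sup>k = i\<^sup>k \<partial>\<^sub>y\<^sup>-\<^sup>k\<close>.\<close>

definition K_op :: "L2H set \<Rightarrow> psdo"
  where "K_op W m z =
    (if m \<le> 0 then baker_coeff W z (nat (- m)) * of_cpx (\<i> ^ nat (- m)) else 0)"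

definition L_op :: "L2H set \<Rightarrow> psdo"
  where "L_op W = psdo_mult (psdo_mult (K_op W) psdo_idy) (psdo_inverse (K_op W))"


section \<open>Group actions and periods\<close>

definition Gamma0 :: "(complex \<Rightarrow> complex) set"
  where "Gamma0 = {\<lambda>_. cis t | t. True}"

definition gamma1 :: "complex \<Rightarrow> complex \<Rightarrow> complex"
  where "gamma1 z = (\<lambda>\<zeta>. exp (z * \<zeta>))"

definition act :: "(complex \<Rightarrow> complex) \<Rightarrow> L2H set \<Rightarrow> L2H set"
  where "act \<gamma> W = (\<lambda>f. rmult f \<gamma>) ` W"

text \<open>\<open>[L\<^sub>W]\<close>, the orbit of \<open>L\<^sub>W\<close> under \<open>\<gamma> \<circ> L\<^sub>W = L\<^sub>W\<^sub>\<gamma>\<close> for \<open>\<gamma>\<close> in \<open>\<Gamma>\<^sub>0\<close>.\<close>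

definition L_class :: "L2H set \<Rightarrow> psdo set"
  where "L_class W = {L_op (act \<gamma> W) | \<gamma>. \<gamma> \<in> Gamma0}"

definition is_lattice :: "complex set \<Rightarrow> bool"
  where "is_lattice \<Lambda> \<longleftrightarrow> (\<exists>\<omega>\<^sub>1 \<omega>\<^sub>2. Im (cnj \<omega>\<^sub>1 * \<omega>\<^sub>2) \<noteq> 0 \<and>
    \<Lambda> = {of_int k * \<omega>\<^sub>1 + of_int l * \<omega>\<^sub>2 | k l. True})"

text \<open>The orbit map \<open>z \<mapsto> exp (z \<zeta>) \<circ> [L\<^sub>W]\<close> induces a bijection from \<open>\<complex> / \<Lambda>\<close> onto the
  \<open>\<Gamma>\<^sub>1\<close>-orbit of \<open>[L\<^sub>W]\<close>, and \<open>\<Lambda>\<close> has rank two.\<close>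

definition torus_orbit :: "L2H set \<Rightarrow> complex set \<Rightarrow> bool"
  where "torus_orbit W \<Lambda> \<longleftrightarrow> is_lattice \<Lambda> \<and>
    (\<forall>z w. L_class (act (gamma1 z) W) = L_class (act (gamma1 w) W) \<longleftrightarrow> z - w \<in> \<Lambda>)"


section \<open>Quotients and projective spaces\<close>

definition coset :: "'a::plus set \<Rightarrow> 'a \<Rightarrow> 'a set"
  where "coset V w = (\<lambda>v. w + v) ` V"

definition quot :: "L2H set \<Rightarrow> L2H set \<Rightarrow> L2H set set"
  where "quot W V = coset V ` W"

text \<open>\<open>[w + V]\<close>, the left line in \<open>W / V\<close> spanned by the class of \<open>w\<close>.\<close>

definition quot_line :: "L2H set \<Rightarrow> L2H \<Rightarrow> L2H set set"
  where "quot_line V w = range (\<lambda>q. coset V (q *\<^sub>Q w))"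

definition proj_quot :: "L2H set \<Rightarrow> L2H set \<Rightarrow> L2H set set set"
  where "proj_quot W V = quot_line V ` (W - V)"

text \<open>Left linear isomorphisms from \<open>W / V\<close> to a coordinate space; \<open>*s\<close> is multiplication of the
  entries by scalars from the left.\<close>

definition quot_iso :: "L2H set \<Rightarrow> L2H set \<Rightarrow> (L2H set \<Rightarrow> quat ^ 'n) \<Rightarrow> bool"
  where "quot_iso W V \<phi> \<longleftrightarrow> bij_betw \<phi> (quot W V) UNIV \<and>
    (\<forall>w\<in>W. \<forall>w'\<in>W. \<phi> (coset V (w + w')) = \<phi> (coset V w) + \<phi> (coset V w')) \<and>
    (\<forall>q. \<forall>w\<in>W. \<phi> (coset V (q *\<^sub>Q w)) = q *s \<phi> (coset V w))"

definition HP :: "(quat ^ 'n) set set"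
  where "HP = {range (\<lambda>q. q *s v) | v. v \<noteq> 0}"


section \<open>Quaternionic holomorphic curves on a torus\<close>

primrec Ck_on :: "nat \<Rightarrow> complex set \<Rightarrow> (complex \<Rightarrow> 'a::real_normed_vector) \<Rightarrow> bool"
  where
    "Ck_on 0 U g = continuous_on U g"
  | "Ck_on (Suc k) U g = ((\<forall>z\<in>U. g differentiable at z) \<and>
      Ck_on k U (\<lambda>z. frechet_derivative g (at z) 1) \<and>
      Ck_on k U (\<lambda>z. frechet_derivative g (at z) \<i>))"

text \<open>Points of the torus \<open>\<complex> / \<Lambda>\<close> are cosets \<open>coset \<Lambda> z\<close>, and the projection from \<open>\<complex>\<close> provides
  its charts. Local sections of the line bundle of \<open>f\<close> are written in these charts.\<close>

definition torus :: "complex set \<Rightarrow> complex set set"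
  where "torus \<Lambda> = range (coset \<Lambda>)"

definition smooth_section ::
  "complex set \<Rightarrow> (complex set \<Rightarrow> (quat ^ 'n) set) \<Rightarrow> complex set \<Rightarrow> (complex \<Rightarrow> quat ^ 'n) \<Rightarrow> bool"
  where "smooth_section \<Lambda> f U s \<longleftrightarrow>
    open U \<and> (\<forall>k. Ck_on k U s) \<and> (\<forall>z\<in>U. s z \<in> f (coset \<Lambda> z))"

definition smooth_line_bundle :: "complex set \<Rightarrow> (complex set \<Rightarrow> (quat ^ 'n) set) \<Rightarrow> bool"
  where "smooth_line_bundle \<Lambda> f \<longleftrightarrow> f \<in> torus \<Lambda> \<rightarrow> HP \<and>
    (\<forall>z. \<exists>U s. z \<in> U \<and> smooth_section \<Lambda> f U s \<and> (\<forall>w\<in>U. s w \<noteq> 0))"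

text \<open>Smooth fields \<open>J\<close> of left linear endomorphisms of the lines \<open>f p\<close>.\<close>

definition bundle_endomorphism ::
  "complex set \<Rightarrow> (complex set \<Rightarrow> (quat ^ 'n) set) \<Rightarrow>
    (complex set \<Rightarrow> quat ^ 'n \<Rightarrow> quat ^ 'n) \<Rightarrow> bool"
  where "bundle_endomorphism \<Lambda> f J \<longleftrightarrow>
    (\<forall>p\<in>torus \<Lambda>. J p \<in> f p \<rightarrow> f p \<and>
      (\<forall>v\<in>f p. \<forall>w\<in>f p. J p (v + w) = J p v + J p w) \<and>
      (\<forall>q. \<forall>v\<in>f p. J p (q *s v) = q *s J p v)) \<and>
    (\<forall>U s. smooth_section \<Lambda> f U s \<longrightarrow> smooth_section \<Lambda> f U (\<lambda>z. J (coset \<Lambda> z) (s z)))"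

text \<open>\<open>\<delta>f (s)\<close> at the point \<open>z + \<Lambda>\<close>, applied to the tangent vector \<open>X\<close>: the class of \<open>ds (X)\<close>
  modulo the line \<open>f (z + \<Lambda>)\<close>.\<close>

definition delta ::
  "complex set \<Rightarrow> (complex set \<Rightarrow> (quat ^ 'n) set) \<Rightarrow> (complex \<Rightarrow> quat ^ 'n) \<Rightarrow>
    complex \<Rightarrow> complex \<Rightarrow> (quat ^ 'n) set"
  where "delta \<Lambda> f s z X = coset (f (coset \<Lambda> z)) (frechet_derivative s (at z) X)"

text \<open>The last condition is \<open>*\<delta>f = \<delta>f \<circ> J\<close>; the complex structure of \<open>\<complex> / \<Lambda>\<close> is multiplication
  of tangent vectors by \<open>\<i>\<close>.\<close>

definition quat_holomorphic_curve :: "complex set \<Rightarrow> (complex set \<Rightarrow> (quat ^ 'n) set) \<Rightarrow> bool"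
  where "quat_holomorphic_curve \<Lambda> f \<longleftrightarrow> smooth_line_bundle \<Lambda> f \<and>
    (\<exists>J. bundle_endomorphism \<Lambda> f J \<and>
      (\<forall>p\<in>torus \<Lambda>. \<forall>v\<in>f p. J p (J p v) = - v) \<and>
      (\<forall>U s. smooth_section \<Lambda> f U s \<longrightarrow> (\<forall>z\<in>U. \<forall>X.
        delta \<Lambda> f s z (\<i> * X) = delta \<Lambda> f (\<lambda>w. J (coset \<Lambda> w) (s w)) z X)))"

end

theory Submission
  imports Defs
begin

text \<open>Put \<open>T\<^sub>z w = pr\<^sub>+ (w exp (- z \<zeta>))\<close>. Uniqueness of the Baker function makes \<open>T\<^sub>z\<close> injective on \<open>W\<close>, and
  it is even bounded below there: multiplication by \<open>exp (- z \<zeta>)\<close> preserves \<open>H\<^sub>+\<close>, so \<open>pr\<^sub>- (w exp (- z \<zeta>))\<close>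
  depends only on \<open>pr\<^sub>- w\<close>, and \<open>pr\<^sub>-\<close> is Hilbert--Schmidt, hence compact, on \<open>W\<close>. As \<open>T\<^sub>z\<close> is smooth in the
  operator norm, the equation \<open>T\<^sub>z \<psi>(z) = 1\<close> forces \<open>\<psi>\<close> to be smooth, without any index argument.
  Differentiating it and comparing Fourier coefficients gives \<open>\<psi>\<^sub>x + \<i> \<psi>\<^sub>y = (a\<^sub>1 + \<i> a\<^sub>1 \<i>) \<psi>\<close>. Hence modulo the
  line spanned by \<open>\<psi>\<close> the derivative satisfies \<open>\<psi>\<^sub>y = \<i> \<psi>\<^sub>x\<close>, and \<open>J (q \<psi>) = q \<i> \<psi>\<close> is the required complex
  structure; it descends to the torus because the monodromy \<open>\<mu>\<close> is complex valued.\<close>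

section \<open>The Hilbert space of the circle\<close>

text \<open>Solvability of \<open>baker_op z (baker W z) = qmonom 1 0\<close> is part of the
  hypotheses, so a lower bound for \<open>baker_op z\<close> on W is enough to carry smoothness. It
  makes the difference quotients of the Baker function Cauchy as soon as their images under the
  fixed operator \<open>baker_op z\<close> converge, and the closed subspace W contains their
  limits. \<open>pr_plus\<close> and \<open>pr_minus\<close> are definite descriptions. They acquire
  a meaning only when square summable families of coefficients are realised by elements, which rests
  on completeness of the space, and when an element is known to be determined by its coefficients.
  Completeness also turns totally bounded images into relatively compact ones. The last obstacle is
  the target: \<open>quot_iso\<close> describes a purely algebraic left linear isomorphism. Its
  continuity has to be extracted from the closedness of V and the finite dimension of the quotient
  before smoothness passes to coordinates.\<close>

lemma sets_circle_measure [measurable_cong, simp]: "sets circle_measure = sets borel"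
  by (simp add: circle_measure_def)

lemma space_circle_measure [simp]: "space circle_measure = UNIV"
  by (simp add: circle_measure_def)

lemma cis_borel_measurable [measurable]: "cis \<in> borel_measurable borel"
  by (intro borel_measurable_continuous_onI continuous_intros)

lemma emeasure_circle_measure: "emeasure circle_measure UNIV = 1"
  unfolding circle_measure_def
  by (subst emeasure_distr) (auto simp: divide_ennreal)

interpretation circle: finite_measure circle_measure
  by (rule finite_measureI) (simp add: emeasure_circle_measure)

lemma measure_circle_measure: "measure circle_measure UNIV = 1"
  by (simp add: measure_def emeasure_circle_measure)

lemma AE_circle_norm: "AE \<zeta> in circle_measure. norm \<zeta> = 1"
  unfolding circle_measure_def by (subst AE_distr_iff) auto

text \<open>For m nonzero the primitive exp(imt)/(im) takes the same value at 0 and 2 pi. Writing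
  the uniform measure as a density makes the fundamental theorem of calculus applicable.\<close>

lemma integral_circle_powi:
  "(\<integral>\<zeta>. \<zeta> powi m \<partial>circle_measure) = (if m = 0 then 1 else 0)"
proof (cases "m = 0")
  case True
  then show ?thesis by (simp add: measure_circle_measure)
next
  case False
  have [measurable]: "(\<lambda>\<zeta>::complex. \<zeta> powi m) \<in> borel_measurable borel"
    unfolding power_int_def by measurable
  have "(\<integral>\<zeta>. \<zeta> powi m \<partial>circle_measure) = (\<integral>t. cis t powi m \<partial>uniform_measure lborel {0..2 * pi})"
    unfolding circle_measure_def by (subst integral_distr) auto
  also have "\<dots> = (\<integral>t. cis t powi m \<partial>density lborel (\<lambda>t. ennreal (indicator {0..2 * pi} t / (2 * pi))))"
  proof -
    have "uniform_measure lborel {0..2 * pi}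
        = density lborel (\<lambda>t. ennreal (indicator {0..2 * pi} t / (2 * pi)))"
      unfolding uniform_measure_def
      by (intro arg_cong2[where f = density] ext refl)
        (use divide_ennreal[of 1 "2 * pi"] in \<open>auto simp: indicator_def\<close>)
    then show ?thesis by (rule arg_cong)
  qed
  also have "\<dots> = (\<integral>t. (indicator {0..2 * pi} t / (2 * pi)) *\<^sub>R cis t powi m \<partial>lborel)"
    by (rule integral_density) auto
  also have "\<dots> = (\<integral>t. (1 / (2 * pi)) *\<^sub>R (indicator {0..2 * pi} t *\<^sub>R cis (of_int m * t)) \<partial>lborel)"
    by (simp only: cis_power_int scaleR_scaleR times_divide_eq_left mult_1_left)
  also have "\<dots> = (1 / (2 * pi)) *\<^sub>R (\<integral>t. indicator {0..2 * pi} t *\<^sub>R cis (of_int m * t) \<partial>lborel)"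
    by (rule integral_scaleR_right)
  also have "(\<integral>t. indicator {0..2 * pi} t *\<^sub>R cis (of_int m * t) \<partial>lborel)
      = cis (of_int m * (2 * pi)) / (of_int m * \<i>) - cis (of_int m * 0) / (of_int m * \<i>)"
  proof (rule integral_FTC_Icc)
    show "((\<lambda>t. cis (of_int m * t) / (of_int m * \<i>)) has_vector_derivative cis (of_int m * t))
        (at t within {0..2 * pi})" for t
    proof -
      have "((\<lambda>w. exp (of_int m * \<i> * w) / (of_int m * \<i>)) has_field_derivative exp (of_int m * \<i> * of_real t))
          (at (of_real t))"
        using False by (auto intro!: derivative_eq_intros)
      from has_vector_derivative_real_field[OF this] show ?thesis
        by (simp add: cis_conv_exp mult_ac)
    qed
    show "continuous_on {0..2 * pi} (\<lambda>t. cis (of_int m * t))"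
      by (intro continuous_intros)
  qed simp
  also have "\<dots> = 0"
    using cis_multiple_2pi[of "of_int m"] by (simp add: mult.commute mult.left_commute)
  finally show ?thesis using False by simp
qed

section \<open>Representatives of classes, almost everywhere\<close>

lemma sq_int_rep: "sq_int (rep_L2H f)"
  using Quotient3_rep_reflp[OF Quotient3_L2H, of f] by (simp add: l2_eq_def)

lemma abs_rep_L2H [simp]: "abs_L2H (rep_L2H f) = f"
  by (rule Quotient3_abs_rep[OF Quotient3_L2H])

lemma abs_L2H_eq_iff:
  "sq_int f \<Longrightarrow> sq_int g \<Longrightarrow> abs_L2H f = abs_L2H g \<longleftrightarrow> (AE \<zeta> in circle_measure. f \<zeta> = g \<zeta>)"
  using Quotient3_rel[OF Quotient3_L2H, of f g] by (auto simp: l2_eq_def)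

lemma L2H_eq_iff: "f = g \<longleftrightarrow> (AE \<zeta> in circle_measure. rep_L2H f \<zeta> = rep_L2H g \<zeta>)"
  using abs_L2H_eq_iff[OF sq_int_rep sq_int_rep, of f g] by simp

lemma rep_abs_L2H: "sq_int f \<Longrightarrow> AE \<zeta> in circle_measure. rep_L2H (abs_L2H f) \<zeta> = f \<zeta>"
  using abs_L2H_eq_iff[of "rep_L2H (abs_L2H f)" f] by (simp add: sq_int_rep)

lemma rep_measurable [measurable]: "rep_L2H f \<in> borel_measurable circle_measure"
  using sq_int_rep[of f] by (simp add: sq_int_def)

lemma plus_L2H_abs: "f + g = abs_L2H (\<lambda>\<zeta>. rep_L2H f \<zeta> + rep_L2H g \<zeta>)"
  by (metis abs_rep_L2H l2_eq_refl plus_L2H.abs_eq sq_int_rep)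

lemma minus_L2H_abs: "f - g = abs_L2H (\<lambda>\<zeta>. rep_L2H f \<zeta> - rep_L2H g \<zeta>)"
  by (metis abs_rep_L2H l2_eq_refl minus_L2H.abs_eq sq_int_rep)

lemma scaleR_L2H_abs: "r *\<^sub>R f = abs_L2H (\<lambda>\<zeta>. r *\<^sub>R rep_L2H f \<zeta>)"
  by (metis abs_rep_L2H l2_eq_refl scaleR_L2H.abs_eq sq_int_rep)

lemma qscale_abs: "q *\<^sub>Q f = abs_L2H (\<lambda>\<zeta>. q * rep_L2H f \<zeta>)"
  by (metis abs_rep_L2H l2_eq_refl qscale.abs_eq sq_int_rep)

lemma rep_plus: "AE \<zeta> in circle_measure. rep_L2H (f + g) \<zeta> = rep_L2H f \<zeta> + rep_L2H g \<zeta>"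
  unfolding plus_L2H_abs[of f g] by (intro rep_abs_L2H sq_int_add sq_int_rep)

lemma rep_minus: "AE \<zeta> in circle_measure. rep_L2H (f - g) \<zeta> = rep_L2H f \<zeta> - rep_L2H g \<zeta>"
  unfolding minus_L2H_abs[of f g] by (intro rep_abs_L2H sq_int_diff sq_int_rep)

lemma rep_scaleR: "AE \<zeta> in circle_measure. rep_L2H (r *\<^sub>R f) \<zeta> = r *\<^sub>R rep_L2H f \<zeta>"
  unfolding scaleR_L2H_abs[of r f] by (intro rep_abs_L2H sq_int_scaleR sq_int_rep)

lemma rep_qscale: "AE \<zeta> in circle_measure. rep_L2H (q *\<^sub>Q f) \<zeta> = q * rep_L2H f \<zeta>"
  unfolding qscale_abs[of q f] by (intro rep_abs_L2H sq_int_mult_left sq_int_rep)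

lemma inner_L2H_rep: "inner f g = (\<integral>\<zeta>. inner (rep_L2H f \<zeta>) (rep_L2H g \<zeta>) \<partial>circle_measure)"
  by (metis abs_rep_L2H inner_L2H.abs_eq l2_eq_refl sq_int_rep)

lemma norm_L2H_rep: "(norm f)\<^sup>2 = (\<integral>\<zeta>. (norm (rep_L2H f \<zeta>))\<^sup>2 \<partial>circle_measure)"
  unfolding power2_norm_eq_inner inner_L2H_rep by simp

lemma nn_integral_rep:
  "(\<integral>\<^sup>+\<zeta>. ennreal ((norm (rep_L2H f \<zeta>))\<^sup>2) \<partial>circle_measure) = ennreal ((norm f)\<^sup>2)"
  unfolding norm_L2H_rep using sq_int_rep[of f]
  by (intro nn_integral_eq_integral) (auto simp: sq_int_def)

text \<open>Riesz--Fischer: a sequence with \<open>\<parallel>X (n + 1) - X n\<parallel> \<le> 2\<^sup>-\<^sup>n\<close> converges almost everywhere, and by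
  Fatou's lemma also in \<open>L\<^sup>2\<close>.\<close>

lemma L2H_fast_Cauchy_AE:
  fixes X :: "nat \<Rightarrow> L2H"
  assumes X: "\<And>n. norm (X (Suc n) - X n) \<le> (1/2) ^ n"
  shows "AE \<zeta> in circle_measure. convergent (\<lambda>n. rep_L2H (X n) \<zeta>)"
proof -
  define d where "d n = (\<lambda>\<zeta>. norm (rep_L2H (X (Suc n)) \<zeta> - rep_L2H (X n) \<zeta>))" for n
  have [measurable]: "d n \<in> borel_measurable circle_measure" for n
    unfolding d_def by measurable
  have L1: "(\<integral>\<^sup>+\<zeta>. ennreal (d n \<zeta>) \<partial>circle_measure) \<le> ennreal (2 * (1/2) ^ n)" for n
  proof -
    \<comment> \<open>The weight \<open>2 ^ n\<close> balances the two terms: it converts the bound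
      4^-n on the squared norm of an increment into a bound of order 2^-n on its integral, the total
      mass being 1.\<close>
    have "a \<le> 2 ^ n * a\<^sup>2 + (1/2) ^ n" for a :: real
    proof (cases "a \<le> (1/2) ^ n")
      case False
      then have "1 \<le> 2 ^ n * a" by (simp add: field_simps power_divide)
      moreover have "0 < a" using False zero_less_power[of "1/2::real" n] by linarith
      ultimately have "a \<le> 2 ^ n * a * a" by (simp add: mult_le_cancel_right1)
      then show ?thesis by (simp add: power2_eq_square mult.assoc add_increasing2)
    qed (simp add: add_increasing)
    then have "(\<integral>\<^sup>+\<zeta>. ennreal (d n \<zeta>) \<partial>circle_measure)
        \<le> (\<integral>\<^sup>+\<zeta>. ennreal (2 ^ n) * ennreal ((d n \<zeta>)\<^sup>2) + ennreal ((1/2) ^ n) \<partial>circle_measure)"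
      by (intro nn_integral_mono) (simp add: ennreal_mult[symmetric] ennreal_plus[symmetric] del: ennreal_plus)
    also have "\<dots> = ennreal (2 ^ n) * (\<integral>\<^sup>+\<zeta>. ennreal ((d n \<zeta>)\<^sup>2) \<partial>circle_measure) + ennreal ((1/2) ^ n)"
      by (simp add: nn_integral_add nn_integral_cmult emeasure_circle_measure)
    also have "(\<integral>\<^sup>+\<zeta>. ennreal ((d n \<zeta>)\<^sup>2) \<partial>circle_measure)
        = (\<integral>\<^sup>+\<zeta>. ennreal ((norm (rep_L2H (X (Suc n) - X n) \<zeta>))\<^sup>2) \<partial>circle_measure)"
      using rep_minus[of "X (Suc n)" "X n"] by (intro nn_integral_cong_AE) (auto simp: d_def)
    also have "\<dots> = ennreal ((norm (X (Suc n) - X n))\<^sup>2)" by (rule nn_integral_rep)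
    also have "ennreal (2 ^ n) * \<dots> + ennreal ((1/2) ^ n)
        = ennreal (2 ^ n * (norm (X (Suc n) - X n))\<^sup>2 + (1/2) ^ n)"
      by (simp add: ennreal_mult[symmetric] ennreal_plus[symmetric] del: ennreal_plus)
    also have "\<dots> \<le> ennreal (2 * (1/2) ^ n)"
    proof (rule ennreal_leI)
      have "2 ^ n * (norm (X (Suc n) - X n))\<^sup>2 \<le> 2 ^ n * ((1/2) ^ n)\<^sup>2"
        by (intro mult_left_mono power_mono X) auto
      also have "\<dots> = (1/2) ^ n" by (simp add: power2_eq_square power_divide)
      finally show "2 ^ n * (norm (X (Suc n) - X n))\<^sup>2 + (1/2) ^ n \<le> 2 * (1/2) ^ n" by simp
    qed
    finally show ?thesis .
  qed
  have "(\<integral>\<^sup>+\<zeta>. (\<Sum>n. ennreal (d n \<zeta>)) \<partial>circle_measure) = (\<Sum>n. \<integral>\<^sup>+\<zeta>. ennreal (d n \<zeta>) \<partial>circle_measure)"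
    by (rule nn_integral_suminf) simp
  also have "\<dots> \<le> (\<Sum>n. ennreal (2 * (1/2) ^ n))"
    by (intro suminf_le L1) auto
  also have "\<dots> = ennreal (\<Sum>n. 2 * (1/2) ^ n)"
    by (intro suminf_ennreal2 summable_mult summable_geometric) auto
  also have "\<dots> < \<infinity>" by simp
  \<comment> \<open>The increments have a finite total integral, so their series converges
    absolutely almost everywhere; telescoping gives convergence of the sequence itself.\<close>
  finally have "AE \<zeta> in circle_measure. (\<Sum>n. ennreal (d n \<zeta>)) \<noteq> \<infinity>"
    by (intro nn_integral_noteq_infinite) auto
  then show ?thesis
  proof (rule AE_mp, intro AE_I2 impI)
    fix \<zeta> assume "(\<Sum>n. ennreal (d n \<zeta>)) \<noteq> \<infinity>"
    then have "summable (\<lambda>n. d n \<zeta>)"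
      by (intro summable_suminf_not_top) (auto simp: d_def)
    then have "summable (\<lambda>n. rep_L2H (X (Suc n)) \<zeta> - rep_L2H (X n) \<zeta>)"
      unfolding d_def by (rule summable_norm_cancel)
    then have "convergent (\<lambda>n. \<Sum>i<n. rep_L2H (X (Suc i)) \<zeta> - rep_L2H (X i) \<zeta>)"
      by (simp add: summable_iff_convergent)
    then have "convergent (\<lambda>n. rep_L2H (X n) \<zeta> - rep_L2H (X 0) \<zeta>)"
      by (simp add: sum_lessThan_telescope[of "\<lambda>n. rep_L2H (X n) \<zeta>"])
    then show "convergent (\<lambda>n. rep_L2H (X n) \<zeta>)"
      using convergent_add[OF _ convergent_const[of "rep_L2H (X 0) \<zeta>"]] by force
  qed
qed

lemma L2H_fast_Cauchy_convergent:
  fixes X :: "nat \<Rightarrow> L2H"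
  assumes X: "\<And>n. norm (X (Suc n) - X n) \<le> (1/2) ^ n" and C: "Cauchy X"
  shows "convergent X"
proof -
  \<comment> \<open>Where the sequence diverges \<open>lim\<close> has an unspecified value;
    measurability holds all the same, and such points form a null set.\<close>
  define F where "F \<zeta> = lim (\<lambda>n. rep_L2H (X n) \<zeta>)" for \<zeta>
  have F_meas [measurable]: "F \<in> borel_measurable circle_measure"
    unfolding F_def by (rule borel_measurable_lim_metric) simp
  have AE: "AE \<zeta> in circle_measure. (\<lambda>n. rep_L2H (X n) \<zeta>) \<longlonglongrightarrow> F \<zeta>"
    using L2H_fast_Cauchy_AE[OF X] by (auto simp: F_def convergent_LIMSEQ_iff)
  \<comment> \<open>Fatou's lemma in n, with m fixed, transfers a Cauchy estimate to the pointwise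
    limit. It serves twice: for square integrability of F and for convergence to F.\<close>
  have fatou: "(\<integral>\<^sup>+\<zeta>. ennreal ((norm (rep_L2H (X m) \<zeta> - F \<zeta>))\<^sup>2) \<partial>circle_measure) \<le> ennreal (e\<^sup>2)"
    if m: "\<And>n. n \<ge> m \<Longrightarrow> norm (X m - X n) \<le> e" for m e
  proof -
    have "(\<integral>\<^sup>+\<zeta>. ennreal ((norm (rep_L2H (X m) \<zeta> - F \<zeta>))\<^sup>2) \<partial>circle_measure)
        = (\<integral>\<^sup>+\<zeta>. liminf (\<lambda>n. ennreal ((norm (rep_L2H (X m) \<zeta> - rep_L2H (X n) \<zeta>))\<^sup>2)) \<partial>circle_measure)"
    proof (rule nn_integral_cong_AE, use AE in eventually_elim)
      case (elim \<zeta>)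
      have "(\<lambda>n. ennreal ((norm (rep_L2H (X m) \<zeta> - rep_L2H (X n) \<zeta>))\<^sup>2)) \<longlonglongrightarrow>
          ennreal ((norm (rep_L2H (X m) \<zeta> - F \<zeta>))\<^sup>2)"
        by (intro tendsto_ennrealI tendsto_intros elim)
      then show ?case by (metis lim_imp_Liminf trivial_limit_sequentially)
    qed
    also have "\<dots> \<le> liminf (\<lambda>n. \<integral>\<^sup>+\<zeta>. ennreal ((norm (rep_L2H (X m) \<zeta> - rep_L2H (X n) \<zeta>))\<^sup>2) \<partial>circle_measure)"
      by (rule nn_integral_liminf) simp
    also have "\<dots> = liminf (\<lambda>n. ennreal ((norm (X m - X n))\<^sup>2))"
    proof -
      have "(\<integral>\<^sup>+\<zeta>. ennreal ((norm (rep_L2H (X m) \<zeta> - rep_L2H (X n) \<zeta>))\<^sup>2) \<partial>circle_measure)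
          = ennreal ((norm (X m - X n))\<^sup>2)" for n
        unfolding nn_integral_rep[symmetric] using rep_minus[of "X m" "X n"]
        by (intro nn_integral_cong_AE) auto
      then show ?thesis by simp
    qed
    also have "\<dots> \<le> liminf (\<lambda>n. ennreal (e\<^sup>2))"
      by (intro Liminf_mono eventually_sequentiallyI[of m] ennreal_leI power_mono m) auto
    also have "\<dots> = ennreal (e\<^sup>2)" by (simp add: Liminf_const)
    finally show ?thesis .
  qed
  have bd: "\<exists>m0. \<forall>m\<ge>m0. \<forall>n\<ge>m. norm (X m - X n) \<le> e" if "e > 0" for e
    using CauchyD[OF C that] by (meson le_trans less_imp_le)
  have sq: "sq_int (\<lambda>\<zeta>. rep_L2H (X m) \<zeta> - F \<zeta>)" if "\<And>n. n \<ge> m \<Longrightarrow> norm (X m - X n) \<le> e" for m e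
    using fatou[OF that] unfolding sq_int_def
    by (auto intro!: integrableI_bounded simp: le_less_trans)
  obtain m1 where m1: "\<And>n. n \<ge> m1 \<Longrightarrow> norm (X m1 - X n) \<le> 1"
    using bd[of 1] by auto
  \<comment> \<open>F is the difference of \<open>X m1\<close> and \<open>X m1\<close> - F, and the
    Fatou bound makes the latter square integrable.\<close>
  have F: "sq_int F"
    using sq_int_diff[OF sq_int_rep[of "X m1"] sq[OF m1]] by simp
  have "X \<longlonglongrightarrow> abs_L2H F"
  proof (rule LIMSEQ_I)
    fix r :: real assume "r > 0"
    then obtain m0 where m0: "\<And>m n. m \<ge> m0 \<Longrightarrow> n \<ge> m \<Longrightarrow> norm (X m - X n) \<le> r / 2"
      using bd[of "r/2"] by auto
    have "norm (X m - abs_L2H F) < r" if "m \<ge> m0" for m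
    proof -
      have "ennreal ((norm (X m - abs_L2H F))\<^sup>2)
          = (\<integral>\<^sup>+\<zeta>. ennreal ((norm (rep_L2H (X m) \<zeta> - F \<zeta>))\<^sup>2) \<partial>circle_measure)"
        unfolding nn_integral_rep[symmetric] using rep_minus[of "X m" "abs_L2H F"] rep_abs_L2H[OF F]
        by (intro nn_integral_cong_AE) auto
      also have "\<dots> \<le> ennreal ((r / 2)\<^sup>2)" by (rule fatou) (use m0 that in auto)
      finally have "(norm (X m - abs_L2H F))\<^sup>2 \<le> (r / 2)\<^sup>2" by (simp add: ennreal_le_iff)
      then have "norm (X m - abs_L2H F) \<le> r / 2"
        by (rule power2_le_imp_le) (use \<open>r > 0\<close> in auto)
      then show ?thesis using \<open>r > 0\<close> by simp
    qed
    then show "\<exists>no. \<forall>n\<ge>no. norm (X n - abs_L2H F) < r" by blast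
  qed
  then show ?thesis by (rule convergentI)
qed

text \<open>A Cauchy sequence converges once a subsequence does, and it always has a subsequence
  whose increments are below 2^-n.\<close>

instance L2H :: banach
proof
  fix X :: "nat \<Rightarrow> L2H"
  assume C: "Cauchy X"
  obtain r :: "nat \<Rightarrow> nat" where r: "strict_mono r" "\<And>n. norm (X (r (Suc n)) - X (r n)) < (1/2) ^ n"
  proof -
    have "\<exists>M. \<forall>m\<ge>M. \<forall>n\<ge>M. norm (X m - X n) < (1/2) ^ k" for k
      by (rule CauchyD[OF C]) simp
    then obtain M where M: "\<And>k m n. m \<ge> M k \<Longrightarrow> n \<ge> M k \<Longrightarrow> norm (X m - X n) < (1/2) ^ k"
      by metis
    \<comment> \<open>Summing all earlier thresholds and adding n makes r strictly increasing and at
      least \<open>M n\<close> at the same time.\<close>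
    define r where "r n = (\<Sum>k\<le>n. M k) + n" for n
    have r: "strict_mono r" by (simp add: strict_mono_Suc_iff r_def)
    have "M n \<le> r n" for n
      unfolding r_def by (cases n) auto
    then have "norm (X (r (Suc n)) - X (r n)) < (1/2) ^ n" for n
      using M[of n "r (Suc n)" "r n"] strict_monoD[OF r, of n "Suc n"] by (meson le_trans less_imp_le lessI)
    with r show ?thesis by (rule that)
  qed
  have "convergent (X \<circ> r)"
    using r(2) by (intro L2H_fast_Cauchy_convergent Cauchy_subseq_Cauchy[OF C r(1)])
      (auto simp: less_imp_le)
  then obtain l where "(X \<circ> r) \<longlonglongrightarrow> l" by (auto simp: convergent_def)
  then have "X \<longlonglongrightarrow> l"
    by (rule Cauchy_converges_subseq[OF C r(1)])
  then show "convergent X" by (rule convergentI)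
qed

section \<open>The complex numbers inside the quaternions\<close>

lemma of_cpx_simps [simp]:
  "of_cpx 0 = 0" "of_cpx 1 = 1" "norm (of_cpx c) = cmod c"
  by (simp_all add: of_cpx_def quat_defs norm_quat_def)

lemma of_cpx_add: "of_cpx (c + d) = of_cpx c + of_cpx d"
  and of_cpx_mult: "of_cpx (c * d) = of_cpx c * of_cpx d"
  and of_cpx_minus: "of_cpx (- c) = - of_cpx c"
  and of_cpx_of_real: "of_cpx (of_real r) = of_real r"
  and of_cpx_scaleR: "of_cpx (r *\<^sub>R c) = r *\<^sub>R of_cpx c"
  by (simp_all add: of_cpx_def quat_defs of_real_def complex_of_real_def[symmetric] complex_eq_iff)

lemma mult_of_cpx_of_real: "q * of_cpx (of_real r) = r *\<^sub>R q"
  by (simp only: of_cpx_of_real) (simp add: of_real_def)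

lemma bounded_linear_of_cpx: "bounded_linear of_cpx"
  by (rule bounded_linear_intro[where K = 1]) (simp_all add: of_cpx_add of_cpx_scaleR)

lemma of_cpx_measurable [measurable]: "of_cpx \<in> borel_measurable borel"
  by (intro borel_measurable_continuous_onI linear_continuous_on bounded_linear_of_cpx)

lemma quat_mult_measurable [measurable]:
  fixes f g :: "'a \<Rightarrow> quat"
  assumes [measurable]: "f \<in> borel_measurable M" "g \<in> borel_measurable M"
  shows "(\<lambda>x. f x * g x) \<in> borel_measurable M"
  by (rule borel_measurable_continuous_Pair[where H = "\<lambda>x y. x * y"]) (auto intro!: continuous_intros)

section \<open>Multiplication operators\<close>

text \<open>The bound is asked only on the circle, because the multipliers exp(z \<zeta>) are
  unbounded on the plane; measurability is asked on the plane, where \<open>circle_measure\<close>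
  is defined.\<close>

definition circle_bounded :: "(complex \<Rightarrow> complex) \<Rightarrow> bool"
  where "circle_bounded \<gamma> \<longleftrightarrow> \<gamma> \<in> borel_measurable borel \<and> (\<exists>B. \<forall>\<zeta>. norm \<zeta> = 1 \<longrightarrow> cmod (\<gamma> \<zeta>) \<le> B)"

lemma circle_bounded_continuous:
  assumes "continuous_on UNIV \<gamma>"
  shows "circle_bounded \<gamma>"
proof -
  have "bounded (\<gamma> ` sphere 0 1)"
    using assms by (intro compact_imp_bounded compact_continuous_image continuous_on_subset[OF assms]) auto
  then show ?thesis
    using assms by (force simp: circle_bounded_def bounded_iff borel_measurable_continuous_onI)
qed

lemma powi_measurable [measurable]: "(\<lambda>\<zeta>::complex. \<zeta> powi m) \<in> borel_measurable borel"
  unfolding power_int_def by measurable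

lemma circle_bounded_powi: "circle_bounded (\<lambda>\<zeta>. \<zeta> powi m)"
  unfolding circle_bounded_def by (auto simp: norm_power_int intro!: exI[of _ 1])

lemma circle_bounded_mult:
  assumes "circle_bounded \<gamma>" "circle_bounded \<delta>"
  shows "circle_bounded (\<lambda>\<zeta>. \<gamma> \<zeta> * \<delta> \<zeta>)"
proof -
  obtain B C where "\<forall>\<zeta>. norm \<zeta> = 1 \<longrightarrow> cmod (\<gamma> \<zeta>) \<le> B" "\<forall>\<zeta>. norm \<zeta> = 1 \<longrightarrow> cmod (\<delta> \<zeta>) \<le> C"
    using assms by (auto simp: circle_bounded_def)
  then have "\<forall>\<zeta>. norm \<zeta> = 1 \<longrightarrow> cmod (\<gamma> \<zeta> * \<delta> \<zeta>) \<le> B * C"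
    by (auto simp: norm_mult intro!: mult_mono intro: order_trans[OF norm_ge_zero])
  then show ?thesis
    using assms by (auto simp: circle_bounded_def)
qed

lemma sq_int_rmult:
  assumes f: "sq_int f" and \<gamma>: "circle_bounded \<gamma>"
  shows "sq_int (\<lambda>\<zeta>. f \<zeta> * of_cpx (\<gamma> \<zeta>))"
proof -
  have [measurable]: "f \<in> borel_measurable circle_measure" "\<gamma> \<in> borel_measurable borel"
    using assms by (auto simp: sq_int_def circle_bounded_def)
  obtain B where B: "\<And>\<zeta>. norm \<zeta> = 1 \<Longrightarrow> cmod (\<gamma> \<zeta>) \<le> B"
    using \<gamma> by (auto simp: circle_bounded_def)
  have "integrable circle_measure (\<lambda>\<zeta>. (norm (f \<zeta> * of_cpx (\<gamma> \<zeta>)))\<^sup>2)"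
  proof (rule Bochner_Integration.integrable_bound)
    show "integrable circle_measure (\<lambda>\<zeta>. B\<^sup>2 * (norm (f \<zeta>))\<^sup>2)"
      using f by (auto simp: sq_int_def)
    show "AE \<zeta> in circle_measure. norm ((norm (f \<zeta> * of_cpx (\<gamma> \<zeta>)))\<^sup>2) \<le> norm (B\<^sup>2 * (norm (f \<zeta>))\<^sup>2)"
      using AE_circle_norm
    proof eventually_elim
      case (elim \<zeta>)
      show ?case
        using B[OF elim] by (simp add: norm_mult power_mult_distrib mult.commute[of "B\<^sup>2"] mult_left_mono power_mono)
    qed
  qed measurable
  then show ?thesis by (simp add: sq_int_def)
qed

lemma rep_rmult:
  "circle_bounded \<gamma> \<Longrightarrow> AE \<zeta> in circle_measure. rep_L2H (rmult f \<gamma>) \<zeta> = rep_L2H f \<zeta> * of_cpx (\<gamma> \<zeta>)"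
  unfolding rmult_def by (intro rep_abs_L2H sq_int_rmult sq_int_rep)

lemma rmult_add: "circle_bounded \<gamma> \<Longrightarrow> rmult (f + g) \<gamma> = rmult f \<gamma> + rmult g \<gamma>"
  unfolding L2H_eq_iff
  using rep_rmult[of \<gamma> f] rep_rmult[of \<gamma> g] rep_rmult[of \<gamma> "f + g"] rep_plus[of f g]
    rep_plus[of "rmult f \<gamma>" "rmult g \<gamma>"]
  by (auto simp: algebra_simps)

lemma rmult_qscale: "circle_bounded \<gamma> \<Longrightarrow> rmult (q *\<^sub>Q f) \<gamma> = q *\<^sub>Q rmult f \<gamma>"
  unfolding L2H_eq_iff
  using rep_rmult[of \<gamma> f] rep_rmult[of \<gamma> "q *\<^sub>Q f"] rep_qscale[of q f] rep_qscale[of q "rmult f \<gamma>"]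
  by (auto simp: mult.assoc)

lemma rmult_scaleR: "circle_bounded \<gamma> \<Longrightarrow> rmult (r *\<^sub>R f) \<gamma> = r *\<^sub>R rmult f \<gamma>"
  unfolding L2H_eq_iff
  using rep_rmult[of \<gamma> f] rep_rmult[of \<gamma> "r *\<^sub>R f"] rep_scaleR[of r f] rep_scaleR[of r "rmult f \<gamma>"]
  by auto

lemma rmult_rmult:
  "circle_bounded \<gamma> \<Longrightarrow> circle_bounded \<delta> \<Longrightarrow> rmult (rmult f \<gamma>) \<delta> = rmult f (\<lambda>\<zeta>. \<gamma> \<zeta> * \<delta> \<zeta>)"
  unfolding L2H_eq_iff
  using rep_rmult[of \<gamma> f] rep_rmult[of \<delta> "rmult f \<gamma>"] rep_rmult[of "\<lambda>\<zeta>. \<gamma> \<zeta> * \<delta> \<zeta>" f]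
  by (auto simp: mult.assoc of_cpx_mult circle_bounded_mult)

lemma rmult_plus:
  "circle_bounded \<gamma> \<Longrightarrow> circle_bounded \<delta> \<Longrightarrow> circle_bounded (\<lambda>\<zeta>. \<gamma> \<zeta> + \<delta> \<zeta>) \<Longrightarrow>
    rmult f (\<lambda>\<zeta>. \<gamma> \<zeta> + \<delta> \<zeta>) = rmult f \<gamma> + rmult f \<delta>"
  unfolding L2H_eq_iff
  using rep_rmult[of \<gamma> f] rep_rmult[of \<delta> f] rep_rmult[of "\<lambda>\<zeta>. \<gamma> \<zeta> + \<delta> \<zeta>" f]
    rep_plus[of "rmult f \<gamma>" "rmult f \<delta>"]
  by (auto simp: algebra_simps of_cpx_add)

lemma rmult_one [simp]: "rmult f (\<lambda>_. 1) = f"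
  unfolding L2H_eq_iff
  using rep_rmult[of "\<lambda>_. 1" f] by (auto simp: circle_bounded_continuous)

text \<open>The measure is concentrated on the circle. This allows a real linear function to be
  exchanged for the trigonometric polynomial it equals there.\<close>

lemma rmult_cong:
  assumes "circle_bounded \<gamma>" "circle_bounded \<delta>" "\<And>\<zeta>. norm \<zeta> = 1 \<Longrightarrow> \<gamma> \<zeta> = \<delta> \<zeta>"
  shows "rmult f \<gamma> = rmult f \<delta>"
  unfolding L2H_eq_iff
  using rep_rmult[OF assms(1), of f] rep_rmult[OF assms(2), of f] AE_circle_norm
  by eventually_elim (simp add: assms(3))

lemma norm_rmult_le:
  assumes \<gamma>: "circle_bounded \<gamma>" and B: "\<And>\<zeta>. norm \<zeta> = 1 \<Longrightarrow> cmod (\<gamma> \<zeta>) \<le> B"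
  shows "norm (rmult f \<gamma>) \<le> B * norm f"
proof -
  have "0 \<le> B" using order_trans[OF norm_ge_zero B[of 1]] by simp
  have "(norm (rmult f \<gamma>))\<^sup>2 \<le> (\<integral>\<zeta>. B\<^sup>2 * (norm (rep_L2H f \<zeta>))\<^sup>2 \<partial>circle_measure)"
    unfolding norm_L2H_rep
  proof (rule integral_mono_AE)
    show "AE \<zeta> in circle_measure. (norm (rep_L2H (rmult f \<gamma>) \<zeta>))\<^sup>2 \<le> B\<^sup>2 * (norm (rep_L2H f \<zeta>))\<^sup>2"
      using rep_rmult[OF \<gamma>, of f] AE_circle_norm
      by eventually_elim
        (auto simp: norm_mult power_mult_distrib mult.commute[of "B\<^sup>2"] intro!: mult_left_mono power_mono B)
  qed (use sq_int_rep in \<open>auto simp: sq_int_def\<close>)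
  also have "\<dots> = (B * norm f)\<^sup>2" by (simp add: norm_L2H_rep power_mult_distrib)
  finally show ?thesis by (rule power2_le_imp_le) (simp add: \<open>0 \<le> B\<close>)
qed

lemma bounded_linear_rmult:
  assumes "circle_bounded \<gamma>"
  shows "bounded_linear (\<lambda>f. rmult f \<gamma>)"
proof -
  obtain B where B: "\<And>\<zeta>. norm \<zeta> = 1 \<Longrightarrow> cmod (\<gamma> \<zeta>) \<le> B"
    using assms by (auto simp: circle_bounded_def)
  show ?thesis
    by (rule bounded_linear_intro[where K = B])
      (use norm_rmult_le[OF assms B] in \<open>auto simp: assms rmult_add rmult_scaleR mult.commute\<close>)
qed

section \<open>Left multiplication by quaternions\<close>

lemma qscale_add_right: "q *\<^sub>Q (f + g) = q *\<^sub>Q f + q *\<^sub>Q g"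
  unfolding L2H_eq_iff using rep_qscale[of q f] rep_qscale[of q g] rep_qscale[of q "f + g"]
    rep_plus[of f g] rep_plus[of "q *\<^sub>Q f" "q *\<^sub>Q g"] by (auto simp: algebra_simps)

lemma qscale_add_left: "(p + q) *\<^sub>Q f = p *\<^sub>Q f + q *\<^sub>Q f"
  unfolding L2H_eq_iff using rep_qscale[of q f] rep_qscale[of p f] rep_qscale[of "p + q" f]
    rep_plus[of "p *\<^sub>Q f" "q *\<^sub>Q f"] by (auto simp: algebra_simps)

lemma qscale_qscale: "p *\<^sub>Q q *\<^sub>Q f = (p * q) *\<^sub>Q f"
  unfolding L2H_eq_iff using rep_qscale[of q f] rep_qscale[of p "q *\<^sub>Q f"] rep_qscale[of "p * q" f]
  by (auto simp: mult.assoc)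

lemma qscale_of_real: "of_real r *\<^sub>Q f = r *\<^sub>R f"
  unfolding L2H_eq_iff using rep_qscale[of "of_real r" f] rep_scaleR[of r f]
  by (auto simp: scaleR_conv_of_real)

lemma qscale_one [simp]: "1 *\<^sub>Q f = f"
  using qscale_of_real[of 1 f] by simp

lemma qscale_minus_one: "(- 1) *\<^sub>Q f = - f"
  using qscale_of_real[of "- 1" f] by simp

lemma norm_qscale: "norm (q *\<^sub>Q f) = norm q * norm f"
proof -
  have "(norm (q *\<^sub>Q f))\<^sup>2 = (\<integral>\<zeta>. (norm q)\<^sup>2 * (norm (rep_L2H f \<zeta>))\<^sup>2 \<partial>circle_measure)"
    unfolding norm_L2H_rep using rep_qscale[of q f]
    by (intro integral_cong_AE) (auto simp: norm_mult power_mult_distrib)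
  also have "\<dots> = (norm q * norm f)\<^sup>2"
    by (simp add: norm_L2H_rep power_mult_distrib)
  finally show ?thesis by (rule power2_eq_imp_eq) auto
qed

lemma bounded_bilinear_qscale: "bounded_bilinear (*\<^sub>Q)"
proof
  show "(r *\<^sub>R q) *\<^sub>Q f = r *\<^sub>R (q *\<^sub>Q f)" for r q f
    by (simp add: qscale_of_real[symmetric] qscale_qscale scaleR_conv_of_real)
  show "q *\<^sub>Q (r *\<^sub>R f) = r *\<^sub>R (q *\<^sub>Q f)" for r q f
    unfolding qscale_of_real[symmetric] qscale_qscale by (metis of_real_def mult_scaleR_left mult_scaleR_right mult_1 mult_1_right)
  show "\<exists>K. \<forall>a b. norm (a *\<^sub>Q b) \<le> norm a * norm b * K"
    by (rule exI[of _ 1]) (simp add: norm_qscale)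
qed (rule qscale_add_left qscale_add_right)+

section \<open>Fourier coefficients\<close>

lemma sq_int_qmonom: "sq_int (\<lambda>\<zeta>. q * of_cpx (\<zeta> powi m))"
  by (rule sq_int_rmult[OF _ circle_bounded_powi]) (simp add: sq_int_def)

lemma rep_qmonom: "AE \<zeta> in circle_measure. rep_L2H (qmonom q m) \<zeta> = q * of_cpx (\<zeta> powi m)"
  unfolding qmonom_def by (intro rep_abs_L2H sq_int_qmonom)

lemma sq_int_integrable: "sq_int f \<Longrightarrow> integrable circle_measure f"
proof (rule Bochner_Integration.integrable_bound)
  assume f: "sq_int f"
  then show "f \<in> borel_measurable circle_measure" by (simp add: sq_int_def)
  show "integrable circle_measure (\<lambda>\<zeta>. 1 + (norm (f \<zeta>))\<^sup>2)"
    using f by (simp add: sq_int_def)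
  have "x \<le> 1 + x\<^sup>2" for x :: real
    using sum_squares_bound[of 1 x] by (cases "x \<le> 0") (auto intro: order_trans[OF _ add_nonneg_nonneg])
  then show "AE \<zeta> in circle_measure. norm (f \<zeta>) \<le> norm (1 + (norm (f \<zeta>))\<^sup>2)"
    by (simp add: abs_of_nonneg)
qed

lemma fourier_integrable: "integrable circle_measure (\<lambda>\<zeta>. rep_L2H f \<zeta> * of_cpx (\<zeta> powi m))"
  by (intro sq_int_integrable sq_int_rmult sq_int_rep circle_bounded_powi)

lemma fourier_add: "fourier (f + g) m = fourier f m + fourier g m"
  unfolding fourier_def Bochner_Integration.integral_add[OF fourier_integrable fourier_integrable, symmetric]
  by (intro integral_cong_AE) (use rep_plus[of f g] in \<open>auto simp: algebra_simps\<close>)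

lemma fourier_qscale: "fourier (q *\<^sub>Q f) m = q * fourier f m"
proof -
  have "q * fourier f m = (\<integral>\<zeta>. q * (rep_L2H f \<zeta> * of_cpx (\<zeta> powi - m)) \<partial>circle_measure)"
    unfolding fourier_def
    by (intro integral_bounded_linear[symmetric] bounded_linear_mult_right fourier_integrable)
  also have "\<dots> = fourier (q *\<^sub>Q f) m"
    unfolding fourier_def
    by (intro integral_cong_AE) (use rep_qscale[of q f] in \<open>auto simp: mult.assoc\<close>)
  finally show ?thesis by simp
qed

lemma fourier_scaleR: "fourier (r *\<^sub>R f) m = r *\<^sub>R fourier f m"
  using fourier_qscale[of "of_real r" f m] by (simp add: qscale_of_real scaleR_conv_of_real)

text \<open>The constant passes the factor \<zeta>^-m because both are complex; a quaternion on the
  right would not commute with it.\<close>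

lemma fourier_rmult_const: "fourier (rmult f (\<lambda>_. c)) m = fourier f m * of_cpx c"
proof -
  have "fourier f m * of_cpx c = (\<integral>\<zeta>. rep_L2H f \<zeta> * of_cpx (\<zeta> powi - m) * of_cpx c \<partial>circle_measure)"
    unfolding fourier_def
    by (intro integral_bounded_linear[symmetric] bounded_linear_mult_left fourier_integrable)
  also have "\<dots> = fourier (rmult f (\<lambda>_. c)) m"
    unfolding fourier_def
    by (intro integral_cong_AE)
      (use rep_rmult[of "\<lambda>_. c" f] in \<open>auto simp: mult.assoc of_cpx_mult[symmetric] mult.commute circle_bounded_continuous\<close>)
  finally show ?thesis by simp
qed

lemma fourier_rmult_powi: "fourier (rmult f (\<lambda>\<zeta>. \<zeta> powi k)) m = fourier f (m - k)"
  unfolding fourier_def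
proof (intro integral_cong_AE)
  show "AE \<zeta> in circle_measure. rep_L2H (rmult f (\<lambda>\<zeta>. \<zeta> powi k)) \<zeta> * of_cpx (\<zeta> powi - m)
      = rep_L2H f \<zeta> * of_cpx (\<zeta> powi - (m - k))"
    using rep_rmult[OF circle_bounded_powi, of f k] AE_circle_norm
  proof eventually_elim
    case (elim \<zeta>)
    then have "\<zeta> \<noteq> 0" by auto
    then have "\<zeta> powi - (m - k) = \<zeta> powi k * \<zeta> powi - m"
      by (simp add: power_int_add[symmetric])
    then show ?case using elim by (simp add: of_cpx_mult mult.assoc)
  qed
qed measurable

text \<open>Pairing with c \<zeta>^m over the reals sees the component along c of the m-th
  coefficient. This is the source of every orthogonality relation between monomials.\<close>

lemma inner_qmonom: "inner f (qmonom c m) = inner (fourier f m) c"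
proof -
  have "inner (fourier f m) c = (\<integral>\<zeta>. inner (rep_L2H f \<zeta> * of_cpx (\<zeta> powi - m)) c \<partial>circle_measure)"
    unfolding fourier_def
    by (intro integral_bounded_linear[symmetric] bounded_linear_inner_left fourier_integrable)
  also have "\<dots> = inner f (qmonom c m)"
    unfolding inner_L2H_rep
  proof (intro integral_cong_AE)
    show "AE \<zeta> in circle_measure. inner (rep_L2H f \<zeta> * of_cpx (\<zeta> powi - m)) c
      = inner (rep_L2H f \<zeta>) (rep_L2H (qmonom c m) \<zeta>)"
      using rep_qmonom[of c m] AE_circle_norm
    proof eventually_elim
      case (elim \<zeta>)
      \<comment> \<open>Right multiplication by a complex number has right multiplication by its
        conjugate as adjoint, and on the circle the conjugate of a power is its inverse.\<close>
      have "inner (p * of_cpx (cnj u)) c = inner p (c * of_cpx u)" for p u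
        by (simp add: inner_quat_def times_quat_def of_cpx_def inner_complex_def algebra_simps)
      note this[of "rep_L2H f \<zeta>" "\<zeta> powi m"]
      moreover have "\<zeta> powi - m = cnj (\<zeta> powi m)"
        using elim(2) complex_norm_square[of "\<zeta> powi m"]
        by (auto simp: power_int_minus norm_power_int intro!: inverse_unique)
      ultimately show ?case using elim by (simp del: complex_cnj_power_int)
    qed
  qed measurable
  finally show ?thesis ..
qed

lemma fourier_qmonom: "fourier (qmonom q k) m = (if k = m then q else 0)"
proof -
  have "fourier (qmonom q k) m = (\<integral>\<zeta>. q * of_cpx (\<zeta> powi (k - m)) \<partial>circle_measure)"
    unfolding fourier_def
  proof (intro integral_cong_AE)
    show "AE \<zeta> in circle_measure. rep_L2H (qmonom q k) \<zeta> * of_cpx (\<zeta> powi - m) = q * of_cpx (\<zeta> powi (k - m))"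
      using rep_qmonom[of q k] AE_circle_norm
    proof eventually_elim
      case (elim \<zeta>)
      then have "\<zeta> \<noteq> 0" by auto
      then show ?case using elim by (simp add: of_cpx_mult[symmetric] mult.assoc power_int_add[symmetric])
    qed
  qed measurable
  also have "\<dots> = q * of_cpx (\<integral>\<zeta>. \<zeta> powi (k - m) \<partial>circle_measure)"
  proof (rule integral_bounded_linear)
    show "bounded_linear (\<lambda>c. q * of_cpx c)"
      by (rule bounded_linear_compose[OF bounded_linear_mult_right bounded_linear_of_cpx])
    show "integrable circle_measure (\<lambda>\<zeta>. \<zeta> powi (k - m))"
      by (rule circle.integrable_const_bound[where B = 1])
        (use AE_circle_norm in \<open>auto simp: norm_power_int\<close>)
  qed
  finally show ?thesis by (simp add: integral_circle_powi)
qed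

lemma norm_qmonom: "norm (qmonom q m) = norm q"
  by (simp add: norm_eq_sqrt_inner inner_qmonom fourier_qmonom)

text \<open>Cauchy-Schwarz against the monomial whose coefficient is the Fourier coefficient
  itself.\<close>

lemma norm_fourier_le: "norm (fourier f m) \<le> norm f"
proof -
  have "(norm (fourier f m))\<^sup>2 = inner f (qmonom (fourier f m) m)"
    by (simp add: inner_qmonom power2_norm_eq_inner)
  also have "\<dots> \<le> norm f * norm (fourier f m)"
    using norm_cauchy_schwarz[of f "qmonom (fourier f m) m"] by (simp add: norm_qmonom)
  finally show ?thesis by (cases "fourier f m = 0") (simp_all add: power2_eq_square mult_le_cancel_right)
qed

lemma bounded_linear_fourier: "bounded_linear (\<lambda>f. fourier f m)"
  by (rule bounded_linear_intro[where K = 1]) (simp_all add: fourier_add fourier_scaleR norm_fourier_le)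

text \<open>For the partial sum g of the Fourier series, the inner product of f with g equals the
  squared norm of g, so Cauchy-Schwarz bounds the norm of g by that of f.\<close>

lemma Bessel_fourier:
  assumes "finite F"
  shows "(\<Sum>m\<in>F. (norm (fourier f m))\<^sup>2) \<le> (norm f)\<^sup>2"
proof -
  define g where "g = (\<Sum>m\<in>F. qmonom (fourier f m) m)"
  have 1: "(norm g)\<^sup>2 = (\<Sum>m\<in>F. (norm (fourier f m))\<^sup>2)"
    unfolding g_def using assms
    by (subst norm_sum_Pythagorean)
      (auto simp: pairwise_def orthogonal_def inner_qmonom fourier_qmonom norm_qmonom)
  have 2: "inner f g = (\<Sum>m\<in>F. (norm (fourier f m))\<^sup>2)"
    by (simp add: g_def inner_sum_right inner_qmonom power2_norm_eq_inner)
  have "(norm g)\<^sup>2 \<le> norm f * norm g"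
    using norm_cauchy_schwarz[of f g] 1 2 by simp
  then have "norm g \<le> norm f"
    by (cases "norm g = 0") (auto simp: power2_eq_square mult_le_cancel_right)
  then show ?thesis unfolding 1[symmetric] by (rule power_mono) simp
qed


text \<open>By Pythagoras the Cauchy criterion for the monomials is that for the squared
  coefficients. The enumeration \<sigma> of exponents lets one lemma serve nonnegative, nonpositive
  and negative powers.\<close>

lemma summable_qmonom:
  fixes \<sigma> :: "nat \<Rightarrow> int"
  assumes \<sigma>: "inj \<sigma>" and c: "summable (\<lambda>k. (norm (c k))\<^sup>2)"
  shows "summable (\<lambda>k. qmonom (c k) (\<sigma> k))"
  unfolding summable_Cauchy
proof (intro allI impI)
  fix e :: real assume "e > 0"
  then obtain N where N: "\<And>m n. m \<ge> N \<Longrightarrow> norm (\<Sum>k=m..<n. (norm (c k))\<^sup>2) < e\<^sup>2"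
    using c unfolding summable_Cauchy by (meson zero_less_power)
  have "norm (\<Sum>k=m..<n. qmonom (c k) (\<sigma> k)) < e" if "m \<ge> N" for m n
  proof -
    have "(norm (\<Sum>k=m..<n. qmonom (c k) (\<sigma> k)))\<^sup>2 = (\<Sum>k=m..<n. (norm (c k))\<^sup>2)"
      by (subst norm_sum_Pythagorean)
        (use \<sigma> in \<open>auto simp: pairwise_def orthogonal_def inner_qmonom fourier_qmonom norm_qmonom inj_eq\<close>)
    also have "\<dots> < e\<^sup>2" using N[OF that, of n] by simp
    finally show ?thesis by (rule power2_less_imp_less) (use \<open>e > 0\<close> in simp)
  qed
  then show "\<exists>N. \<forall>m\<ge>N. \<forall>n. norm (\<Sum>k=m..<n. qmonom (c k) (\<sigma> k)) < e" by blast
qed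

lemma fourier_sums:
  fixes \<sigma> :: "nat \<Rightarrow> int"
  assumes \<sigma>: "inj \<sigma>" and g: "(\<lambda>k. qmonom (c k) (\<sigma> k)) sums g"
  shows "fourier g (\<sigma> k) = c k" and "m \<notin> range \<sigma> \<Longrightarrow> fourier g m = 0"
proof -
  have *: "(\<lambda>k. if \<sigma> k = m then c k else 0) sums fourier g m" for m
    using bounded_linear.sums[OF bounded_linear_fourier g, of m] by (simp add: fourier_qmonom)
  have "(\<lambda>j. if \<sigma> j = \<sigma> k then c j else 0) sums c k"
    using sums_single[of k c] \<sigma> by (simp add: inj_eq eq_commute)
  with *[of "\<sigma> k"] show "fourier g (\<sigma> k) = c k" by (rule sums_unique2)
  assume "m \<notin> range \<sigma>"
  then have "(\<lambda>j. if \<sigma> j = m then c j else 0) = (\<lambda>_. 0)" by (metis rangeI)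
  with *[of m] show "fourier g m = 0" using sums_unique2[OF _ sums_zero] by simp
qed

lemma summable_fourier:
  fixes \<sigma> :: "nat \<Rightarrow> int"
  assumes "inj \<sigma>"
  shows "summable (\<lambda>k. (norm (fourier f (\<sigma> k)))\<^sup>2)"
proof (rule bounded_imp_summable)
  show "(\<Sum>k\<le>n. (norm (fourier f (\<sigma> k)))\<^sup>2) \<le> (norm f)\<^sup>2" for n
    using Bessel_fourier[of "\<sigma> ` {..n}" f] 
      sum.reindex[OF inj_on_subset[OF assms], of "{..n}" "\<lambda>m. (norm (fourier f m))\<^sup>2"]
    by simp
qed simp

section \<open>Uniqueness of Fourier coefficients\<close>

text \<open>The functions preserving the elements with vanishing Fourier coefficients form an algebra
  containing \<open>Re\<close> and \<open>Im\<close>, so the Stone--Weierstrass theorem applies.\<close>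

definition null_preserving :: "(complex \<Rightarrow> complex) \<Rightarrow> bool"
  where "null_preserving \<gamma> \<longleftrightarrow> circle_bounded \<gamma> \<and>
    (\<forall>f. (\<forall>m. fourier f m = 0) \<longrightarrow> (\<forall>m. fourier (rmult f \<gamma>) m = 0))"

text \<open>On the circle a real linear function is a combination of \<zeta> and its inverse, and
  multiplication by these shifts and scales coefficients. Sums and products are then handled by
  induction.\<close>

lemma null_preserving_real_polynomial:
  assumes "real_polynomial_function p"
  shows "null_preserving (\<lambda>\<zeta>. of_real (p \<zeta>))"
  using assms
proof (induction rule: real_polynomial_function.induct)
  case (linear p)
  \<comment> \<open>This is the coefficient for which p(\<zeta>) is twice the real part of a
    \<zeta>.\<close>
  define a where "a = Complex (p 1 / 2) (- p \<i> / 2)"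
  interpret bounded_linear p by fact
  have p: "complex_of_real (p \<zeta>) = a * \<zeta> powi 1 + cnj a * \<zeta> powi - 1" if "norm \<zeta> = 1" for \<zeta>
  proof -
    have "p \<zeta> = p (Re \<zeta> *\<^sub>R 1 + Im \<zeta> *\<^sub>R \<i>)"
      by (rule arg_cong[of _ _ p]) (simp add: complex_eq_iff)
    then have "p \<zeta> = Re \<zeta> * p 1 + Im \<zeta> * p \<i>" by (simp only: add scaleR) simp
    moreover have "\<zeta> powi - 1 = cnj \<zeta>"
      using that complex_norm_square[of \<zeta>] by (auto simp: power_int_minus intro!: inverse_unique)
    ultimately show ?thesis by (simp add: a_def complex_eq_iff algebra_simps)
  qed
  have cb: "circle_bounded (\<lambda>\<zeta>. complex_of_real (p \<zeta>))"
    by (intro circle_bounded_continuous continuous_intros linear_continuous_on bounded_linear_axioms)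
  have c: "circle_bounded (\<lambda>_. c)" for c
    by (simp add: circle_bounded_continuous)
  have c1: "circle_bounded (\<lambda>\<zeta>. c * \<zeta> powi m)" for c m
    by (intro circle_bounded_mult circle_bounded_powi c)
  have cc: "circle_bounded (\<lambda>\<zeta>. a * \<zeta> powi 1 + cnj a * \<zeta> powi - 1)"
    using cb p by (auto simp: circle_bounded_def)
  have "fourier (rmult f (\<lambda>\<zeta>. complex_of_real (p \<zeta>))) m = 0" if "\<forall>m. fourier f m = 0" for f m
  proof -
    have "rmult f (\<lambda>\<zeta>. complex_of_real (p \<zeta>)) = rmult f (\<lambda>\<zeta>. a * \<zeta> powi 1 + cnj a * \<zeta> powi - 1)"
      by (rule rmult_cong[OF cb cc p])
    also have "\<dots> = rmult (rmult f (\<lambda>_. a)) (\<lambda>\<zeta>. \<zeta> powi 1) + rmult (rmult f (\<lambda>_. cnj a)) (\<lambda>\<zeta>. \<zeta> powi - 1)"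
      unfolding rmult_rmult[OF c circle_bounded_powi] by (rule rmult_plus[OF c1 c1 cc])
    finally show ?thesis
      using that by (simp only: fourier_add fourier_rmult_powi fourier_rmult_const) simp
  qed
  with cb show ?case by (simp add: null_preserving_def)
next
  case (const c)
  then show ?case by (simp add: null_preserving_def circle_bounded_continuous fourier_rmult_const)
next
  case (add p q)
  then have "circle_bounded (\<lambda>\<zeta>. complex_of_real (p \<zeta> + q \<zeta>))"
    by (intro circle_bounded_continuous continuous_intros continuous_at_imp_continuous_on ballI
        continuous_real_polymonial_function) auto
  with add show ?case by (auto simp: null_preserving_def rmult_plus fourier_add)
next
  case (mult p q)
  then show ?case by (auto simp: null_preserving_def circle_bounded_mult rmult_rmult[symmetric])
qed

text \<open>The integral is the zeroth coefficient of f p. Uniform approximation of p on the circle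
  by polynomials leaves an error controlled by the norm of f.\<close>

lemma fourier_zero_integral_continuous:
  fixes p :: "complex \<Rightarrow> real"
  assumes f: "\<And>m. fourier f m = 0" and p: "continuous_on UNIV p"
  shows "(\<integral>\<zeta>. p \<zeta> *\<^sub>R rep_L2H f \<zeta> \<partial>circle_measure) = 0"
proof -
  have cb: "circle_bounded (\<lambda>\<zeta>. of_real (p \<zeta>))" if "continuous_on UNIV p" for p :: "complex \<Rightarrow> real"
    by (intro circle_bounded_continuous continuous_intros that)
  have *: "(\<integral>\<zeta>. p \<zeta> *\<^sub>R rep_L2H f \<zeta> \<partial>circle_measure) = fourier (rmult f (\<lambda>\<zeta>. of_real (p \<zeta>))) 0"
    unfolding fourier_def
  proof (intro integral_cong_AE)
    have [measurable]: "p \<in> borel_measurable borel" using p by (rule borel_measurable_continuous_onI)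
    show "(\<lambda>\<zeta>. p \<zeta> *\<^sub>R rep_L2H f \<zeta>) \<in> borel_measurable circle_measure" by measurable
  qed (use rep_rmult[OF cb[OF p], of f] in \<open>auto simp: mult_of_cpx_of_real\<close>)
  have "norm (fourier (rmult f (\<lambda>\<zeta>. of_real (p \<zeta>))) 0) \<le> e" if "e > 0" for e
  proof -
    define d where "d = e / (norm f + 1)"
    have "d > 0" using that by (simp add: d_def add_nonneg_pos)
    obtain q where q: "real_polynomial_function q" "\<And>\<zeta>. \<zeta> \<in> sphere 0 1 \<Longrightarrow> \<bar>p \<zeta> - q \<zeta>\<bar> < d"
      using Stone_Weierstrass_real_polynomial_function[OF compact_sphere continuous_on_subset[OF p] \<open>d > 0\<close>]
      by (metis subset_UNIV)
    have q': "continuous_on UNIV q"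
      using q(1) by (intro continuous_at_imp_continuous_on ballI continuous_real_polymonial_function)
    have cpq: "circle_bounded (\<lambda>\<zeta>. of_real (p \<zeta> - q \<zeta>))"
      unfolding of_real_diff[symmetric] by (intro cb continuous_intros p q')
    have "rmult f (\<lambda>\<zeta>. of_real (p \<zeta>)) = rmult f (\<lambda>\<zeta>. of_real (p \<zeta> - q \<zeta>)) + rmult f (\<lambda>\<zeta>. of_real (q \<zeta>))"
      by (subst rmult_plus[OF cpq cb[OF q'], symmetric]) (simp_all add: cb p)
    then have "fourier (rmult f (\<lambda>\<zeta>. of_real (p \<zeta>))) 0 = fourier (rmult f (\<lambda>\<zeta>. of_real (p \<zeta> - q \<zeta>))) 0"
      using null_preserving_real_polynomial[OF q(1)] f by (simp add: null_preserving_def fourier_add)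
    also have "norm \<dots> \<le> norm (rmult f (\<lambda>\<zeta>. of_real (p \<zeta> - q \<zeta>)))" by (rule norm_fourier_le)
    also have "\<dots> \<le> d * norm f"
      using q(2) by (intro norm_rmult_le cpq) (auto simp: dist_norm less_imp_le simp flip: of_real_diff)
    also have "\<dots> \<le> e"
      using that by (simp add: d_def pos_divide_le_eq add_nonneg_pos distrib_left)
    finally show ?thesis .
  qed
  then have "norm (fourier (rmult f (\<lambda>\<zeta>. of_real (p \<zeta>))) 0) \<le> 0" by (rule field_le_epsilon) simp
  then show ?thesis by (simp add: *)
qed

lemma fourier_zero_integral_closed:
  assumes f: "\<And>m. fourier f m = 0" and A: "closed A"
  shows "(\<integral>\<zeta>. indicator A \<zeta> *\<^sub>R rep_L2H f \<zeta> \<partial>circle_measure) = 0"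
\<comment> \<open>\<open>infdist\<close> to the empty set is 0 by convention, so the cut-off
  functions below would not approximate its indicator.\<close>
proof (cases "A = {}")
  case False
  \<comment> \<open>Continuous cut-offs: equal to 1 on A and, for positive n, equal to 0 at distance
    at least 1/n from A.\<close>
  define p where "p n \<zeta> = max 0 (1 - real n * infdist \<zeta> A)" for n \<zeta>
  have pc: "continuous_on UNIV (p n)" for n
    unfolding p_def by (intro continuous_intros)
  have [measurable]: "p n \<in> borel_measurable borel" for n
    using pc by (rule borel_measurable_continuous_onI)
  have [measurable]: "A \<in> sets borel" using A by simp
  have "(\<lambda>n. \<integral>\<zeta>. p n \<zeta> *\<^sub>R rep_L2H f \<zeta> \<partial>circle_measure) \<longlonglongrightarrow>
      (\<integral>\<zeta>. indicator A \<zeta> *\<^sub>R rep_L2H f \<zeta> \<partial>circle_measure)"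
  proof (rule integral_dominated_convergence[where w = "\<lambda>\<zeta>. norm (rep_L2H f \<zeta>)"])
    show "integrable circle_measure (\<lambda>\<zeta>. norm (rep_L2H f \<zeta>))"
      by (intro integrable_norm sq_int_integrable sq_int_rep)
    have "(\<lambda>n. p n \<zeta>) \<longlonglongrightarrow> indicator A \<zeta>" for \<zeta>
    proof (cases "\<zeta> \<in> A")
      case True then show ?thesis by (simp add: p_def)
    next
      case False
      then have "infdist \<zeta> A > 0" using A \<open>A \<noteq> {}\<close> by (simp add: infdist_pos_not_in_closed)
      then have "\<forall>\<^sub>F n in sequentially. 1 / infdist \<zeta> A \<le> real n"
        using filterlim_real_sequentially by (simp add: filterlim_at_top)
      then have "\<forall>\<^sub>F n in sequentially. p n \<zeta> = indicator A \<zeta>"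
        by eventually_elim (use \<open>infdist \<zeta> A > 0\<close> False in \<open>simp add: p_def field_simps\<close>)
      then show ?thesis by (rule tendsto_eventually)
    qed
    then show "AE \<zeta> in circle_measure. (\<lambda>n. p n \<zeta> *\<^sub>R rep_L2H f \<zeta>) \<longlonglongrightarrow> indicator A \<zeta> *\<^sub>R rep_L2H f \<zeta>"
      by (intro AE_I2 tendsto_intros)
    have "\<bar>p n \<zeta>\<bar> \<le> 1" for n \<zeta>
      using infdist_nonneg[of \<zeta> A] by (simp add: p_def)
    then show "AE \<zeta> in circle_measure. norm (p n \<zeta> *\<^sub>R rep_L2H f \<zeta>) \<le> norm (rep_L2H f \<zeta>)" for n
      by (intro AE_I2) (simp add: mult_left_le_one_le)
  qed measurable
  then show ?thesis
    using fourier_zero_integral_continuous[OF f pc] by (simp add: LIMSEQ_const_iff)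
qed simp

text \<open>The closed sets are stable under intersection and generate the Borel sets, so Dynkin's
  argument applies. Complements are covered because the integral over the closed set
  \<open>UNIV\<close> vanishes.\<close>

lemma fourier_zero_integral_borel:
  assumes f: "\<And>m. fourier f m = 0" and A: "A \<in> sets borel"
  shows "(\<integral>\<zeta>. indicator A \<zeta> *\<^sub>R rep_L2H f \<zeta> \<partial>circle_measure) = 0"
proof -
  have int: "integrable circle_measure (\<lambda>\<zeta>. indicator A \<zeta> *\<^sub>R rep_L2H f \<zeta>)" if "A \<in> sets borel" for A
    by (intro integrable_mult_indicator sq_int_integrable sq_int_rep) (use that in auto)
  have UN: "(\<integral>\<zeta>. indicator (-A) \<zeta> *\<^sub>R rep_L2H f \<zeta> \<partial>circle_measure) = 0"
    if "(\<integral>\<zeta>. indicator A \<zeta> *\<^sub>R rep_L2H f \<zeta> \<partial>circle_measure) = 0" "A \<in> sets borel" for A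
  proof -
    have "(\<integral>\<zeta>. indicator UNIV \<zeta> *\<^sub>R rep_L2H f \<zeta> \<partial>circle_measure)
        = (\<integral>\<zeta>. indicator A \<zeta> *\<^sub>R rep_L2H f \<zeta> + indicator (-A) \<zeta> *\<^sub>R rep_L2H f \<zeta> \<partial>circle_measure)"
      by (intro Bochner_Integration.integral_cong) (auto simp: indicator_def)
    also have "\<dots> = (\<integral>\<zeta>. indicator A \<zeta> *\<^sub>R rep_L2H f \<zeta> \<partial>circle_measure)
        + (\<integral>\<zeta>. indicator (-A) \<zeta> *\<^sub>R rep_L2H f \<zeta> \<partial>circle_measure)"
      by (intro Bochner_Integration.integral_add int) (use that in auto)
    finally show ?thesis
      using fourier_zero_integral_closed[OF f closed_UNIV] that by simp
  qed
  have "Int_stable (Collect closed :: complex set set)" by (auto simp: Int_stable_def)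
  moreover have "(Collect closed :: complex set set) \<subseteq> Pow UNIV" by simp
  moreover have "A \<in> sigma_sets UNIV (Collect closed)"
    using A by (simp add: borel_eq_closed)
  ultimately show ?thesis
  proof (induction rule: sigma_sets_induct_disjoint)
    case (basic A)
    then show ?case by (simp add: fourier_zero_integral_closed f)
  next
    case (compl A)
    then have "A \<in> sets borel" by (simp add: borel_eq_closed)
    then show ?case using UN[of A] compl by (simp add: Compl_eq_Diff_UNIV)
  next
    case (union A)
    then have [measurable]: "A i \<in> sets borel" for i
      by (auto simp: borel_eq_closed)
    have "(\<integral>\<zeta>\<in>(\<Union>i. A i). rep_L2H f \<zeta> \<partial>circle_measure) = (\<Sum>i. \<integral>\<zeta>\<in>A i. rep_L2H f \<zeta> \<partial>circle_measure)"
      using union int[of "\<Union>i. A i"]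
      by (intro lebesgue_integral_countable_add) (auto simp: disjoint_family_on_def set_integrable_def)
    then show ?case using union by (simp add: set_lebesgue_integral_def)
  qed simp
qed

text \<open>Each real component integrates to 0 over every Borel set and hence vanishes almost
  everywhere; there are only four components.\<close>

lemma fourier_zero_imp_zero:
  assumes f: "\<And>m. fourier f m = 0"
  shows "f = 0"
proof -
  have "AE \<zeta> in circle_measure. inner (rep_L2H f \<zeta>) b = 0" for b
  proof (rule density_unique_real)
    show int: "integrable circle_measure (\<lambda>\<zeta>. inner (rep_L2H f \<zeta>) b)"
      by (intro integrable_inner_left sq_int_integrable sq_int_rep)
    fix A assume "A \<in> sets circle_measure"
    then have A: "A \<in> sets borel" by simp
    have "(\<integral>\<zeta>\<in>A. inner (rep_L2H f \<zeta>) b \<partial>circle_measure)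
        = (\<integral>\<zeta>. inner (indicator A \<zeta> *\<^sub>R rep_L2H f \<zeta>) b \<partial>circle_measure)"
      by (simp add: set_lebesgue_integral_def)
    also have "\<dots> = inner (\<integral>\<zeta>. indicator A \<zeta> *\<^sub>R rep_L2H f \<zeta> \<partial>circle_measure) b"
      by (intro integral_inner_left integrable_mult_indicator sq_int_integrable sq_int_rep) (use A in auto)
    also have "\<dots> = 0" by (simp only: fourier_zero_integral_borel[OF f A] inner_zero_left)
    finally show "(\<integral>\<zeta>\<in>A. inner (rep_L2H f \<zeta>) b \<partial>circle_measure) = (\<integral>\<zeta>\<in>A. 0 \<partial>circle_measure)"
      by (simp add: set_lebesgue_integral_def)
  qed simp
  then have "AE \<zeta> in circle_measure. \<forall>b\<in>Basis. inner (rep_L2H f \<zeta>) b = 0"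
    by (intro AE_finite_allI) auto
  then have "AE \<zeta> in circle_measure. rep_L2H f \<zeta> = 0"
    by eventually_elim (simp add: euclidean_all_zero_iff)
  moreover have "AE \<zeta> in circle_measure. rep_L2H 0 \<zeta> = 0"
    unfolding zero_L2H_def by (rule rep_abs_L2H[OF sq_int_0])
  ultimately show ?thesis unfolding L2H_eq_iff by eventually_elim simp
qed

lemma fourier_minus: "fourier (f - g) m = fourier f m - fourier g m"
  using linear_diff[OF bounded_linear.linear[OF bounded_linear_fourier]] .

lemma fourier_zero [simp]: "fourier 0 m = 0"
  using linear_0[OF bounded_linear.linear[OF bounded_linear_fourier]] .

lemma fourier_eqI: "(\<And>m. fourier f m = fourier g m) \<Longrightarrow> f = g"
  using fourier_zero_imp_zero[of "f - g"] by (simp add: fourier_minus)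

text \<open>Bessel and completeness give the series a sum, and this sum has the coefficients of
  f.\<close>

lemma fourier_series_sums:
  fixes \<sigma> :: "nat \<Rightarrow> int"
  assumes \<sigma>: "inj \<sigma>" and f: "\<And>m. m \<notin> range \<sigma> \<Longrightarrow> fourier f m = 0"
  shows "(\<lambda>k. qmonom (fourier f (\<sigma> k)) (\<sigma> k)) sums f"
proof -
  have g: "(\<lambda>k. qmonom (fourier f (\<sigma> k)) (\<sigma> k)) sums (\<Sum>k. qmonom (fourier f (\<sigma> k)) (\<sigma> k))"
    by (intro summable_sums summable_qmonom \<sigma> summable_fourier)
  have "(\<Sum>k. qmonom (fourier f (\<sigma> k)) (\<sigma> k)) = f"
  proof (rule fourier_eqI)
    show "fourier (\<Sum>k. qmonom (fourier f (\<sigma> k)) (\<sigma> k)) m = fourier f m" for m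
      using fourier_sums[OF \<sigma> g] f by (cases "m \<in> range \<sigma>") auto
  qed
  with g show ?thesis by simp
qed

section \<open>The projections\<close>

text \<open>Enumerations of the nonpositive exponents, for the Baker series, and of the strictly
  negative ones, for \<open>H_minus\<close>.\<close>

lemma inj_int_uminus: "inj (\<lambda>k. - int k)" "inj (\<lambda>k. - int (Suc k))"
  by (auto simp: inj_def)

text \<open>The existence half behind the definite descriptions \<open>pr_plus\<close> and
  \<open>pr_minus\<close>; uniqueness is \<open>fourier_eqI\<close>.\<close>

lemma fourier_truncate_ex:
  "\<exists>g. \<forall>m. fourier g m = (if m \<in> range (int :: nat \<Rightarrow> int) then fourier f m else 0)"
proof (intro exI allI)
  have "inj (int :: nat \<Rightarrow> int)" by (rule inj_of_nat)
  note g = fourier_sums[OF this summable_sums[OF summable_qmonom[OF this summable_fourier[OF this, of f]]]]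
  show "fourier (\<Sum>k. qmonom (fourier f (int k)) (int k)) m = (if m \<in> range int then fourier f m else 0)" for m
    using g(1) g(2)[of m] by (cases "m \<in> range int") (elim rangeE, simp, simp)
qed

text \<open>From here on the definite descriptions are replaced by truncation of
  coefficients.\<close>

lemma pr_plus_minus:
  "fourier (pr_plus f) m = (if m \<ge> 0 then fourier f m else 0)"
  "fourier (pr_minus f) m = (if m < 0 then fourier f m else 0)"
proof -
  have "m \<in> range int \<longleftrightarrow> m \<ge> 0" for m by (metis nonneg_int_cases of_nat_0_le_iff rangeE rangeI)
  then obtain g where g: "\<And>m. fourier g m = (if m \<ge> 0 then fourier f m else 0)"
    using fourier_truncate_ex[of f] by auto
  have "pr_plus f = g"
    unfolding pr_plus_def
  proof (rule the_equality)
    show "g \<in> H_plus \<and> f - g \<in> H_minus" by (simp add: g H_plus_def H_minus_def fourier_minus)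
    fix g' assume "g' \<in> H_plus \<and> f - g' \<in> H_minus"
    then show "g' = g"
      by (intro fourier_eqI) (auto simp: g H_plus_def H_minus_def fourier_minus not_le)
  qed
  moreover have "pr_minus f = f - g"
    unfolding pr_minus_def
  proof (rule the_equality)
    show "f - g \<in> H_minus \<and> f - (f - g) \<in> H_plus" by (simp add: g H_plus_def H_minus_def fourier_minus)
    fix g' assume "g' \<in> H_minus \<and> f - g' \<in> H_plus"
    then show "g' = f - g"
      by (intro fourier_eqI) (auto simp: g H_plus_def H_minus_def fourier_minus not_le)
  qed
  ultimately show "fourier (pr_plus f) m = (if m \<ge> 0 then fourier f m else 0)"
    "fourier (pr_minus f) m = (if m < 0 then fourier f m else 0)"
    by (auto simp: g fourier_minus)
qed

lemma pr_plus_add_pr_minus: "pr_plus f + pr_minus f = f"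
  by (rule fourier_eqI) (simp add: fourier_add pr_plus_minus)

text \<open>Expanding the second argument in negative powers makes every term of the pairing a
  coefficient that the first argument lacks.\<close>

lemma inner_pr_plus_pr_minus: "inner (pr_plus f) (pr_minus g) = 0"
proof -
  have "(\<lambda>k. qmonom (fourier (pr_minus g) (- int (Suc k))) (- int (Suc k))) sums pr_minus g"
  proof (rule fourier_series_sums[OF inj_int_uminus(2)])
    fix m :: int assume "m \<notin> range (\<lambda>k. - int (Suc k))"
    moreover have "m = - int (Suc (nat (- m - 1)))" if "m < 0" using that by simp
    ultimately have "m \<ge> 0" by (metis not_le rangeI)
    then show "fourier (pr_minus g) m = 0" by (simp add: pr_plus_minus)
  qed
  from bounded_linear.sums[OF bounded_linear_inner_right this, of "pr_plus f"]
  have "(\<lambda>k. 0) sums inner (pr_plus f) (pr_minus g)" by (simp add: inner_qmonom pr_plus_minus)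
  then show ?thesis by (rule sums_unique2[OF _ sums_zero])
qed

lemma norm_pr_le: "norm (pr_plus f) \<le> norm f" "norm (pr_minus f) \<le> norm f"
proof -
  have "(norm f)\<^sup>2 = (norm (pr_plus f))\<^sup>2 + (norm (pr_minus f))\<^sup>2"
    using norm_add_Pythagorean[of "pr_plus f" "pr_minus f"]
    by (simp add: orthogonal_def inner_pr_plus_pr_minus pr_plus_add_pr_minus)
  then have "(norm (pr_plus f))\<^sup>2 \<le> (norm f)\<^sup>2" "(norm (pr_minus f))\<^sup>2 \<le> (norm f)\<^sup>2" by simp_all
  then show "norm (pr_plus f) \<le> norm f" "norm (pr_minus f) \<le> norm f"
    by (simp_all add: power2_le_iff_abs_le)
qed

lemma bounded_linear_pr_plus: "bounded_linear pr_plus"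
proof (rule bounded_linear_intro[where K = 1])
  show "pr_plus (f + g) = pr_plus f + pr_plus g" for f g
    by (rule fourier_eqI) (simp add: fourier_add pr_plus_minus)
  show "pr_plus (r *\<^sub>R f) = r *\<^sub>R pr_plus f" for r f
    by (rule fourier_eqI) (simp add: fourier_scaleR pr_plus_minus)
qed (simp add: norm_pr_le)

lemma bounded_linear_pr_minus: "bounded_linear pr_minus"
proof (rule bounded_linear_intro[where K = 1])
  show "pr_minus (f + g) = pr_minus f + pr_minus g" for f g
    by (rule fourier_eqI) (simp add: fourier_add pr_plus_minus)
  show "pr_minus (r *\<^sub>R f) = r *\<^sub>R pr_minus f" for r f
    by (rule fourier_eqI) (simp add: fourier_scaleR pr_plus_minus)
qed (simp add: norm_pr_le)

lemma pr_plus_qscale: "pr_plus (q *\<^sub>Q f) = q *\<^sub>Q pr_plus f"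
  by (rule fourier_eqI) (simp add: fourier_qscale pr_plus_minus)

lemma pr_minus_qscale: "pr_minus (q *\<^sub>Q f) = q *\<^sub>Q pr_minus f"
  by (rule fourier_eqI) (simp add: fourier_qscale pr_plus_minus)

section \<open>Hilbert--Schmidt operators are compact\<close>

text \<open>Taken over the reals, so that the compactness argument can use the type class inner
  product; complex bases are converted in \<open>Gr_real_basis\<close>.\<close>

definition orthonormal :: "'a::real_inner set \<Rightarrow> bool"
  where "orthonormal E \<longleftrightarrow> (\<forall>e\<in>E. \<forall>e'\<in>E. inner e e' = (if e = e' then 1 else 0))"

definition expansion :: "'a::real_inner set \<Rightarrow> 'a \<Rightarrow> 'a"
  where "expansion F w = (\<Sum>e\<in>F. inner w e *\<^sub>R e)"

lemma orthonormal_norm_sum: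
  assumes "orthonormal E" "finite F" "F \<subseteq> E"
  shows "(norm (\<Sum>e\<in>F. c e *\<^sub>R e))\<^sup>2 = (\<Sum>e\<in>F. (c e)\<^sup>2)"
proof -
  have "norm e = 1" if "e \<in> F" for e
    using assms that by (auto simp: orthonormal_def norm_eq_1)
  moreover have "pairwise (\<lambda>d e. orthogonal (c d *\<^sub>R d) (c e *\<^sub>R e)) F"
    using assms by (auto simp: orthonormal_def pairwise_def orthogonal_def subset_iff)
  ultimately show ?thesis
    using norm_sum_Pythagorean[OF assms(2), of "\<lambda>e. c e *\<^sub>R e"] by simp
qed

lemma inner_expansion:
  assumes "orthonormal E" "finite F" "F \<subseteq> E" "e \<in> E"
  shows "inner (expansion F w) e = (if e \<in> F then inner w e else 0)"
proof -
  have "inner (expansion F w) e = (\<Sum>d\<in>F. if d = e then inner w d else 0)"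
    unfolding expansion_def inner_sum_left using assms
    by (intro sum.cong) (auto simp: orthonormal_def subset_iff)
  then show ?thesis using assms(2) by simp
qed

lemma Bessel_orthonormal:
  assumes "orthonormal E" "finite F" "F \<subseteq> E"
  shows "(\<Sum>e\<in>F. (inner w e)\<^sup>2) \<le> (norm w)\<^sup>2"
proof -
  have 1: "(norm (expansion F w))\<^sup>2 = (\<Sum>e\<in>F. (inner w e)\<^sup>2)"
    unfolding expansion_def by (rule orthonormal_norm_sum[OF assms])
  have 2: "inner w (expansion F w) = (\<Sum>e\<in>F. (inner w e)\<^sup>2)"
    by (simp add: expansion_def inner_sum_right power2_eq_square)
  have "(norm (expansion F w))\<^sup>2 \<le> norm w * norm (expansion F w)"
    using norm_cauchy_schwarz[of w "expansion F w"] 1 2 by simp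
  then have "norm (expansion F w) \<le> norm w"
    by (cases "norm (expansion F w) = 0") (auto simp: power2_eq_square mult_le_cancel_right)
  then show ?thesis unfolding 1[symmetric] by (rule power_mono) simp
qed

lemma expansion_diff:
  assumes "finite G" "F \<subseteq> G"
  shows "expansion G w - expansion F w = expansion (G - F) w"
  unfolding expansion_def using sum_diff[OF assms, of "\<lambda>e. inner w e *\<^sub>R e"] by simp

text \<open>E is given only as a maximal orthonormal set, without an enumeration. Finite sets whose
  Bessel sums approach the supremum give a Cauchy sequence of expansions, and the difference between
  w and the limit lies in W and is orthogonal to E.\<close>

lemma expansion_approx:
  fixes E :: "'a::{real_inner, complete_space} set"
  assumes E: "orthonormal E" "E \<subseteq> W"
    and W: "subspace W" "closed W"
    and max: "\<And>w. w \<in> W \<Longrightarrow> (\<forall>e\<in>E. inner w e = 0) \<Longrightarrow> w = 0"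
    and w: "w \<in> W" and F: "finite F" "F \<subseteq> E" and "\<delta> > 0"
  obtains G where "finite G" "F \<subseteq> G" "G \<subseteq> E" "norm (w - expansion G w) < \<delta>"
proof -
  define S where "S = {\<Sum>e\<in>G. (inner w e)\<^sup>2 | G. finite G \<and> G \<subseteq> E}"
  have S: "bdd_above S" "S \<noteq> {}"
    using Bessel_orthonormal[OF E(1), of _ w] by (auto simp: S_def intro!: bdd_aboveI[of _ "(norm w)\<^sup>2"])
  have "\<exists>G. finite G \<and> G \<subseteq> E \<and> Sup S - (1/4) ^ n < (\<Sum>e\<in>G. (inner w e)\<^sup>2)" for n :: nat
    using less_cSup_iff[OF S(2,1), of "Sup S - (1/4) ^ n"] by (auto simp: S_def)
  then obtain G where G: "\<And>n::nat. finite (G n)" "\<And>n. G n \<subseteq> E"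
    "\<And>n. Sup S - (1/4) ^ n < (\<Sum>e\<in>G n. (inner w e)\<^sup>2)" by metis
  \<comment> \<open>Accumulating the near-optimal sets makes them increasing and forces them to
    contain F.\<close>
  define H where "H n = F \<union> (\<Union>k\<le>n. G k)" for n
  have H: "finite (H n)" "H n \<subseteq> E" "F \<subseteq> H n" for n
    using G F by (auto simp: H_def)
  have Hmono: "H m \<subseteq> H n" if "m \<le> n" for m n using that by (force simp: H_def)
  have S_le: "(\<Sum>e\<in>K. (inner w e)\<^sup>2) \<le> Sup S" if "finite K" "K \<subseteq> E" for K
    by (rule cSup_upper[OF _ S(1)]) (use that in \<open>auto simp: S_def\<close>)
  \<comment> \<open>A finite set disjoint from \<open>H n\<close> with a larger contribution would
    push the Bessel sum above its supremum. The rate 1/4 becomes 1/2 for norms.\<close>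
  have tail: "(\<Sum>e\<in>K. (inner w e)\<^sup>2) \<le> (1/4) ^ n" if "finite K" "K \<subseteq> E" "K \<inter> H n = {}" for K n
  proof -
    have "(\<Sum>e\<in>G n. (inner w e)\<^sup>2) \<le> (\<Sum>e\<in>H n. (inner w e)\<^sup>2)"
      by (rule sum_mono2) (use H(1) in \<open>auto simp: H_def\<close>)
    moreover have "(\<Sum>e\<in>K \<union> H n. (inner w e)\<^sup>2) = (\<Sum>e\<in>K. (inner w e)\<^sup>2) + (\<Sum>e\<in>H n. (inner w e)\<^sup>2)"
      by (rule sum.union_disjoint) (use that H in auto)
    moreover have "(\<Sum>e\<in>K \<union> H n. (inner w e)\<^sup>2) \<le> Sup S"
      by (rule S_le) (use that H in auto)
    ultimately show ?thesis using G(3)[of n] by linarith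
  qed
  have norm_diff: "norm (expansion (H n) w - expansion (H m) w) \<le> (1/2) ^ m" if "m \<le> n" for m n
  proof -
    have "(norm (expansion (H n - H m) w))\<^sup>2 = (\<Sum>e\<in>H n - H m. (inner w e)\<^sup>2)"
      unfolding expansion_def by (rule orthonormal_norm_sum[OF E(1)]) (use H in auto)
    also have "\<dots> \<le> (1/4) ^ m" by (rule tail) (use H in auto)
    also have "\<dots> = ((1/2) ^ m)\<^sup>2" by (simp add: power2_eq_square power_mult_distrib[symmetric])
    finally have "norm (expansion (H n - H m) w) \<le> (1/2) ^ m" by (rule power2_le_imp_le) simp
    then show ?thesis by (simp add: expansion_diff[OF H(1) Hmono[OF that]])
  qed
  have "Cauchy (\<lambda>n. expansion (H n) w)"
  proof (rule CauchyI')
    fix e :: real assume "e > 0"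
    then obtain M where M: "(1/2) ^ M < e" using real_arch_pow_inv[of e "1/2"] by auto
    have "norm (expansion (H m) w - expansion (H n) w) < e" if "M \<le> m" "m < n" for m n
    proof -
      have "norm (expansion (H m) w - expansion (H n) w) \<le> (1/2) ^ m"
        using norm_diff[of m n] that by (simp add: norm_minus_commute)
      also have "\<dots> \<le> (1/2) ^ M" using that by (intro power_decreasing) auto
      finally show ?thesis using M by simp
    qed
    then show "\<exists>M. \<forall>m\<ge>M. \<forall>n>m. dist (expansion (H m) w) (expansion (H n) w) < e"
      by (auto simp: dist_norm)
  qed
  then obtain w' where w': "(\<lambda>n. expansion (H n) w) \<longlonglongrightarrow> w'"
    by (auto simp: Cauchy_convergent_iff convergent_def)
  have "expansion (H n) w \<in> W" for n
    unfolding expansion_def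
    by (intro subspace_sum W subspace_mul subsetD[OF E(2)] subsetD[OF H(2)])
  then have "w' \<in> W" using closed_sequentially[OF W(2) _ w'] by blast
  have "inner (w - w') e = 0" if "e \<in> E" for e
  proof -
    have lim: "(\<lambda>n. inner (expansion (H n) w) e) \<longlonglongrightarrow> inner w' e"
      by (intro tendsto_inner w' tendsto_const)
    have "(\<lambda>n. inner (expansion (H n) w) e) \<longlonglongrightarrow> inner w e"
    proof (cases "\<exists>n. e \<in> H n")
      case True
      then obtain n where "e \<in> H n" ..
      then have "\<forall>\<^sub>F m in sequentially. inner (expansion (H m) w) e = inner w e"
        using Hmono by (intro eventually_sequentiallyI[of n])
          (auto simp: inner_expansion[OF E(1) H(1,2) that])
      then show ?thesis by (rule tendsto_eventually)
    next
      \<comment> \<open>An element of E that is never selected is disjoint from all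
        \<open>H n\<close>, so the tail bound forces its coefficient to be 0.\<close>
      case False
      have "(inner w e)\<^sup>2 \<le> (1/4) ^ n" for n
        using tail[of "{e}" n] False that by simp
      moreover have "(\<lambda>n. (1/4::real) ^ n) \<longlonglongrightarrow> 0" by (rule LIMSEQ_power_zero) simp
      ultimately have "(inner w e)\<^sup>2 \<le> 0" by (metis LIMSEQ_le_const)
      then show ?thesis using False by (simp add: inner_expansion[OF E(1) H(1,2) that])
    qed
    with lim have "inner w e = inner w' e" by (metis LIMSEQ_unique)
    then show ?thesis by (simp add: inner_diff_left)
  qed
  then have "w - w' = 0" by (intro max subspace_diff W w \<open>w' \<in> W\<close>) auto
  then have "(\<lambda>n. expansion (H n) w) \<longlonglongrightarrow> w" using w' by simp
  then obtain n where "norm (expansion (H n) w - w) < \<delta>"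
    using LIMSEQ_D[OF _ \<open>\<delta> > 0\<close>] by (metis order_refl)
  then show ?thesis using that[OF H(1)[of n] H(3) H(2)] by (simp add: norm_minus_commute)
qed

text \<open>Beyond a finite F the squared norms of the \<open>T e\<close> sum to at most
  \<epsilon>^2, so Cauchy-Schwarz together with Bessel bounds T on every finite expansion outside
  F.\<close>

lemma Hilbert_Schmidt_tail:
  fixes E :: "'a::{real_inner, complete_space} set" and T :: "'a \<Rightarrow> 'b::real_normed_vector"
  assumes E: "orthonormal E" "E \<subseteq> W"
    and W: "subspace W" "closed W"
    and max: "\<And>w. w \<in> W \<Longrightarrow> (\<forall>e\<in>E. inner w e = 0) \<Longrightarrow> w = 0"
    and T: "bounded_linear T" and HS: "(\<lambda>e. (norm (T e))\<^sup>2) summable_on E" and "\<epsilon> > 0"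
  obtains F where "finite F" "F \<subseteq> E" "\<And>w. w \<in> W \<Longrightarrow> norm (T (w - expansion F w)) \<le> \<epsilon> * norm w"
proof -
  interpret T: bounded_linear T by fact
  obtain s where "((\<lambda>e. (norm (T e))\<^sup>2) has_sum s) E" using HS by (auto simp: summable_on_def)
  \<comment> \<open>With \<epsilon>^2 / 2, any two finite sums beyond F differ by at most
    \<epsilon>^2.\<close>
  then have "\<forall>\<^sub>F F in finite_subsets_at_top E. dist (\<Sum>e\<in>F. (norm (T e))\<^sup>2) s < \<epsilon>\<^sup>2 / 2"
    unfolding has_sum_def using \<open>\<epsilon> > 0\<close> by (intro tendstoD) auto
  then have "\<exists>F. finite F \<and> F \<subseteq> E \<and>
      (\<forall>G. finite G \<and> F \<subseteq> G \<and> G \<subseteq> E \<longrightarrow> dist (\<Sum>e\<in>G. (norm (T e))\<^sup>2) s < \<epsilon>\<^sup>2 / 2)"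
    unfolding eventually_finite_subsets_at_top .
  then obtain F where F: "finite F" "F \<subseteq> E"
    and FG: "\<And>G. finite G \<Longrightarrow> F \<subseteq> G \<Longrightarrow> G \<subseteq> E \<Longrightarrow> dist (\<Sum>e\<in>G. (norm (T e))\<^sup>2) s < \<epsilon>\<^sup>2 / 2"
    by metis
  have "norm (T (w - expansion F w)) \<le> \<epsilon> * norm w" if w: "w \<in> W" for w
  proof (rule field_le_epsilon)
    fix \<eta> :: real assume "\<eta> > 0"
    obtain K where K: "K > 0" "\<And>x. norm (T x) \<le> norm x * K" using T.pos_bounded by blast
    \<comment> \<open>G depends on w and on the slack \<eta>, whereas F was fixed before w; dividing
      by the bound K makes the error after applying T at most \<eta>.\<close>
    obtain G where G: "finite G" "F \<subseteq> G" "G \<subseteq> E" "norm (w - expansion G w) < \<eta> / K"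
      by (rule expansion_approx[OF E W max w F, of "\<eta> / K"]) (use \<open>\<eta> > 0\<close> K in auto)
    have "(\<Sum>e\<in>G - F. (norm (T e))\<^sup>2) \<le> \<epsilon>\<^sup>2"
      using FG[OF G(1-3)] FG[OF F(1) order_refl F(2)] sum_diff[OF G(1,2), of "\<lambda>e. (norm (T e))\<^sup>2"]
      by (simp add: dist_real_def abs_if split: if_splits)
    then have L1: "L2_set (\<lambda>e. norm (T e)) (G - F) \<le> \<epsilon>"
      unfolding L2_set_def using \<open>\<epsilon> > 0\<close> by (intro real_le_lsqrt) (auto intro: sum_nonneg)
    have L2: "L2_set (\<lambda>e. inner w e) (G - F) \<le> norm w"
      unfolding L2_set_def using G
      by (intro real_le_lsqrt Bessel_orthonormal[OF E(1)]) (auto intro: sum_nonneg)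
    have "norm (T (expansion (G - F) w)) \<le> (\<Sum>e\<in>G - F. \<bar>inner w e\<bar> * \<bar>norm (T e)\<bar>)"
      unfolding expansion_def T.sum by (rule sum_norm_le) (simp add: T.scaleR)
    also have "\<dots> \<le> L2_set (\<lambda>e. inner w e) (G - F) * L2_set (\<lambda>e. norm (T e)) (G - F)"
      by (rule L2_set_mult_ineq)
    also have "\<dots> \<le> norm w * \<epsilon>"
      using L1 L2 \<open>\<epsilon> > 0\<close> by (intro mult_mono) auto
    finally have 1: "norm (T (expansion (G - F) w)) \<le> \<epsilon> * norm w" by (simp add: mult.commute)
    have 2: "norm (T (w - expansion G w)) \<le> \<eta>"
      using K(2)[of "w - expansion G w"] G(4) K(1) by (simp add: pos_less_divide_eq)
    have "w - expansion F w = (w - expansion G w) + expansion (G - F) w"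
      unfolding expansion_diff[OF G(1,2), symmetric] by simp
    then have "norm (T (w - expansion F w)) \<le> norm (T (w - expansion G w)) + norm (T (expansion (G - F) w))"
      by (simp only: T.add norm_triangle_ineq)
    with 1 2 show "norm (T (w - expansion F w)) \<le> \<epsilon> * norm w + \<eta>" by simp
  qed
  with F show ?thesis by (rule that)
qed

text \<open>Adding one index adds a segment to the set, and the Minkowski sum of two compact sets is
  compact.\<close>

lemma compact_sum_segments:
  fixes v :: "'i \<Rightarrow> 'a::real_normed_vector"
  assumes "finite F"
  shows "compact {\<Sum>e\<in>F. c e *\<^sub>R v e | c. \<forall>e\<in>F. \<bar>c e\<bar> \<le> 1}"
  using assms
proof (induction F rule: finite_induct)
  case empty
  then show ?case by simp
next
  case (insert d F)
  have "compact ((\<lambda>t. t *\<^sub>R v d) ` {-1..1::real})"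
    by (intro compact_continuous_image continuous_intros) simp
  from compact_sums[OF this insert.IH]
  show ?case
  proof (rule back_subst[of compact], intro set_eqI iffI)
    fix x assume "x \<in> {x + y | x y. x \<in> (\<lambda>t. t *\<^sub>R v d) ` {-1..1} \<and> y \<in> {\<Sum>e\<in>F. c e *\<^sub>R v e | c. \<forall>e\<in>F. \<bar>c e\<bar> \<le> 1}}"
    then obtain t c where tc: "x = t *\<^sub>R v d + (\<Sum>e\<in>F. c e *\<^sub>R v e)" "\<bar>t\<bar> \<le> 1" "\<forall>e\<in>F. \<bar>c e\<bar> \<le> 1"
      by auto
    have "(\<Sum>e\<in>F. (c(d := t)) e *\<^sub>R v e) = (\<Sum>e\<in>F. c e *\<^sub>R v e)"
      using insert by (intro sum.cong) auto
    then have "x = (\<Sum>e\<in>insert d F. (c(d := t)) e *\<^sub>R v e)" using insert tc by simp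
    then show "x \<in> {\<Sum>e\<in>insert d F. c e *\<^sub>R v e | c. \<forall>e\<in>insert d F. \<bar>c e\<bar> \<le> 1}"
      using tc by (auto intro!: exI[of _ "c(d := t)"])
  next
    fix x assume "x \<in> {\<Sum>e\<in>insert d F. c e *\<^sub>R v e | c. \<forall>e\<in>insert d F. \<bar>c e\<bar> \<le> 1}"
    then obtain c where c: "x = c d *\<^sub>R v d + (\<Sum>e\<in>F. c e *\<^sub>R v e)" "\<bar>c d\<bar> \<le> 1" "\<forall>e\<in>F. \<bar>c e\<bar> \<le> 1"
      using insert by auto
    then have "c d \<in> {-1..1}" by (auto simp: abs_le_iff)
    with c show "x \<in> {x + y | x y. x \<in> (\<lambda>t. t *\<^sub>R v d) ` {-1..1} \<and> y \<in> {\<Sum>e\<in>F. c e *\<^sub>R v e | c. \<forall>e\<in>F. \<bar>c e\<bar> \<le> 1}}"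
      by blast
  qed
qed

text \<open>T is uniformly close on the unit ball of W to an operator of finite rank, so the image
  of this ball is totally bounded and its closure compact.\<close>

lemma Hilbert_Schmidt_convergent_subseq:
  fixes E :: "'a::{real_inner, complete_space} set" and T :: "'a \<Rightarrow> 'b::{real_normed_vector, complete_space}"
  assumes E: "orthonormal E" "E \<subseteq> W"
    and W: "subspace W" "closed W"
    and max: "\<And>w. w \<in> W \<Longrightarrow> (\<forall>e\<in>E. inner w e = 0) \<Longrightarrow> w = 0"
    and T: "bounded_linear T" and HS: "(\<lambda>e. (norm (T e))\<^sup>2) summable_on E"
    and w: "\<And>n. w n \<in> W" "\<And>n. norm (w n) \<le> 1"
  obtains r :: "nat \<Rightarrow> nat" where "strict_mono r" "convergent (\<lambda>n. T (w (r n)))"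
proof -
  interpret T: bounded_linear T by fact
  define S where "S = closure (T ` {w \<in> W. norm w \<le> 1})"
  have "\<exists>k. finite k \<and> S \<subseteq> (\<Union>x\<in>k. ball x \<epsilon>)" if "\<epsilon> > 0" for \<epsilon>
  proof -
    obtain F where F: "finite F" "F \<subseteq> E" "\<And>w. w \<in> W \<Longrightarrow> norm (T (w - expansion F w)) \<le> \<epsilon> / 3 * norm w"
      by (rule Hilbert_Schmidt_tail[OF E W max T HS, of "\<epsilon> / 3"]) (use \<open>\<epsilon> > 0\<close> in auto)
    have C: "compact {\<Sum>e\<in>F. c e *\<^sub>R T e | c. \<forall>e\<in>F. \<bar>c e\<bar> \<le> 1}" (is "compact ?C")
      using F(1) by (rule compact_sum_segments)
    then have "\<forall>\<epsilon>>0. \<exists>k. finite k \<and> ?C \<subseteq> (\<Union>x\<in>k. ball x \<epsilon>)"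
      unfolding compact_eq_totally_bounded by (rule conjunct2)
    then have "\<exists>k. finite k \<and> ?C \<subseteq> (\<Union>x\<in>k. ball x (\<epsilon> / 3))"
      by (rule allE[of _ "\<epsilon> / 3"]) (use \<open>\<epsilon> > 0\<close> in simp)
    then obtain k where k: "finite k" "?C \<subseteq> (\<Union>x\<in>k. ball x (\<epsilon> / 3))"
      by (elim exE conjE)
    have "T ` {w \<in> W. norm w \<le> 1} \<subseteq> (\<Union>x\<in>k. cball x (2 * \<epsilon> / 3))"
    proof clarify
      fix w assume w: "w \<in> W" "norm w \<le> 1"
      \<comment> \<open>Unit vectors e have coefficients of modulus at most 1, which places the
        expansion in the compact set C.\<close>
      have "\<bar>inner w e\<bar> \<le> 1" if "e \<in> F" for e
      proof -
        have "norm e = 1" using E(1) F(2) that unfolding orthonormal_def norm_eq_1 by (metis subsetD)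
        then show ?thesis using order_trans[OF Cauchy_Schwarz_ineq2[of w e]] w by simp
      qed
      then have "T (expansion F w) \<in> ?C"
        by (auto simp: expansion_def T.sum T.scaleR)
      then obtain x where x: "x \<in> k" "dist x (T (expansion F w)) < \<epsilon> / 3" using k by auto
      have "dist (T (expansion F w)) (T w) \<le> \<epsilon> / 3"
      proof -
        have "norm (T (w - expansion F w)) \<le> \<epsilon> / 3 * norm w" by (rule F(3)[OF w(1)])
        also have "\<dots> \<le> \<epsilon> / 3" using w \<open>\<epsilon> > 0\<close> by (simp add: mult_left_le)
        finally show ?thesis by (simp add: dist_norm T.diff norm_minus_commute)
      qed
      with x(2) have "dist x (T w) \<le> 2 * \<epsilon> / 3"
        using dist_triangle[of x "T w" "T (expansion F w)"] by simp
      with x(1) show "T w \<in> (\<Union>x\<in>k. cball x (2 * \<epsilon> / 3))" by auto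
    qed
    \<comment> \<open>The closed balls of radius 2 \<epsilon> / 3 have a closed finite union, which
      therefore contains the closure as well; the remaining third makes the balls open.\<close>
    then have "S \<subseteq> (\<Union>x\<in>k. cball x (2 * \<epsilon> / 3))"
      unfolding S_def by (rule closure_minimal) (use k in auto)
    also have "\<dots> \<subseteq> (\<Union>x\<in>k. ball x \<epsilon>)" using \<open>\<epsilon> > 0\<close> by fastforce
    finally show ?thesis using k(1) by blast
  qed
  then have "compact S"
    unfolding compact_eq_totally_bounded using complete_eq_closed[of S] by (auto simp: S_def)
  then have "seq_compact S" by (rule compact_imp_seq_compact)
  moreover have "T (w n) \<in> S" for n
    unfolding S_def using w by (intro subsetD[OF closure_subset] imageI) auto
  ultimately obtain l r where "strict_mono r" "((\<lambda>n. T (w n)) \<circ> r) \<longlonglongrightarrow> l"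
    unfolding seq_compact_def by metis
  then show ?thesis by (intro that[of r]) (auto simp: convergent_def o_def)
qed

section \<open>Functions of class \<open>C\<^sup>k\<close>\<close>

text \<open>On an open set f and g have the same derivatives, so the predicates behind
  \<open>frechet_derivative\<close> coincide and the choices agree even at points without a
  derivative.\<close>

lemma Ck_on_cong:
  assumes "open U" "\<And>z. z \<in> U \<Longrightarrow> f z = g z"
  shows "Ck_on k U f \<longleftrightarrow> Ck_on k U g"
  using assms(2)
proof (induction k arbitrary: f g)
  case 0
  then show ?case by (simp cong: continuous_on_cong)
next
  case (Suc k)
  have *: "(f has_derivative D) (at z) \<longleftrightarrow> (g has_derivative D) (at z)" if "z \<in> U" for z D
    using has_derivative_transform_within_open[OF _ assms(1) that, of f D UNIV g]
      has_derivative_transform_within_open[OF _ assms(1) that, of g D UNIV f] Suc.prems by auto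
  have "frechet_derivative f (at z) = frechet_derivative g (at z)" if "z \<in> U" for z
    unfolding frechet_derivative_def using *[OF that] by simp
  then have "Ck_on k U (\<lambda>z. frechet_derivative f (at z) c) \<longleftrightarrow> Ck_on k U (\<lambda>z. frechet_derivative g (at z) c)" for c
    by (intro Suc.IH) simp
  moreover have "(\<forall>z\<in>U. f differentiable at z) \<longleftrightarrow> (\<forall>z\<in>U. g differentiable at z)"
    using * by (simp add: differentiable_def)
  ultimately show ?case by simp
qed

lemma Ck_on_SucI:
  assumes "open U" "\<And>z. z \<in> U \<Longrightarrow> (g has_derivative g' z) (at z)"
    and "Ck_on k U (\<lambda>z. g' z 1)" "Ck_on k U (\<lambda>z. g' z \<i>)"
  shows "Ck_on (Suc k) U g"
proof -
  have "Ck_on k U (\<lambda>z. frechet_derivative g (at z) c) \<longleftrightarrow> Ck_on k U (\<lambda>z. g' z c)" for c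
    using assms(2) by (intro Ck_on_cong assms(1)) (metis frechet_derivative_at)
  with assms show ?thesis by (auto simp: differentiable_def)
qed

lemma Ck_on_SucE:
  assumes "Ck_on (Suc k) U g"
  obtains g' where "\<And>z. z \<in> U \<Longrightarrow> (g has_derivative g' z) (at z)"
    "Ck_on k U (\<lambda>z. g' z 1)" "Ck_on k U (\<lambda>z. g' z \<i>)"
  using assms by (intro that[of "\<lambda>z. frechet_derivative g (at z)"])
    (auto simp: frechet_derivative_works)

lemma Ck_on_Suc_imp: "Ck_on (Suc k) U g \<Longrightarrow> Ck_on k U g"
proof (induction k arbitrary: g)
  case 0
  then show ?case
    by (auto intro!: continuous_at_imp_continuous_on differentiable_imp_continuous_within)
next
  case (Suc k)
  then show ?case by (metis Ck_on.simps(2))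
qed

lemma Ck_on_const: "Ck_on k U (\<lambda>_. c)"
  by (induction k arbitrary: c) auto

lemma Ck_on_add:
  assumes U: "open U" and "Ck_on k U f" "Ck_on k U g"
  shows "Ck_on k U (\<lambda>z. f z + g z)"
  using assms(2,3)
proof (induction k arbitrary: f g)
  case 0
  then show ?case by (auto intro: continuous_intros)
next
  case (Suc k)
  from Suc.prems(1) obtain f' where f: "\<And>z. z \<in> U \<Longrightarrow> (f has_derivative f' z) (at z)"
    "Ck_on k U (\<lambda>z. f' z 1)" "Ck_on k U (\<lambda>z. f' z \<i>)" by (rule Ck_on_SucE) blast
  from Suc.prems(2) obtain g' where g: "\<And>z. z \<in> U \<Longrightarrow> (g has_derivative g' z) (at z)"
    "Ck_on k U (\<lambda>z. g' z 1)" "Ck_on k U (\<lambda>z. g' z \<i>)" by (rule Ck_on_SucE) blast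
  show ?case
    by (rule Ck_on_SucI[OF U, where g' = "\<lambda>z h. f' z h + g' z h"])
      (use f g in \<open>auto intro: has_derivative_add Suc.IH\<close>)
qed

lemma Ck_on_sum:
  assumes "open U" "\<And>i. i \<in> I \<Longrightarrow> Ck_on k U (f i)"
  shows "Ck_on k U (\<lambda>z. \<Sum>i\<in>I. f i z)"
  using assms(2) by (induction I rule: infinite_finite_induct)
    (simp_all add: Ck_on_const Ck_on_add[OF assms(1)])

lemma Ck_on_bilinear:
  assumes B: "bounded_bilinear B" and U: "open U" and "Ck_on k U f" "Ck_on k U g"
  shows "Ck_on k U (\<lambda>z. B (f z) (g z))"
  using assms(3,4)
proof (induction k arbitrary: f g)
  case 0
  then show ?case using bounded_bilinear.continuous_on[OF B] by auto
next
  case (Suc k)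
  from Suc.prems(1) obtain f' where f: "\<And>z. z \<in> U \<Longrightarrow> (f has_derivative f' z) (at z)"
    "Ck_on k U (\<lambda>z. f' z 1)" "Ck_on k U (\<lambda>z. f' z \<i>)" by (rule Ck_on_SucE) blast
  from Suc.prems(2) obtain g' where g: "\<And>z. z \<in> U \<Longrightarrow> (g has_derivative g' z) (at z)"
    "Ck_on k U (\<lambda>z. g' z 1)" "Ck_on k U (\<lambda>z. g' z \<i>)" by (rule Ck_on_SucE) blast
  show ?case
    by (rule Ck_on_SucI[OF U, where g' = "\<lambda>z h. B (f z) (g' z h) + B (f' z h) (g z)"])
      (intro bounded_bilinear.FDERIV[OF B] Ck_on_add[OF U] Suc.IH f g
        Ck_on_Suc_imp[OF Suc.prems(1)] Ck_on_Suc_imp[OF Suc.prems(2)]; assumption)+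
qed

lemma Ck_on_inverse:
  fixes f :: "complex \<Rightarrow> real"
  assumes U: "open U" and "Ck_on k U f" and nz: "\<And>z. z \<in> U \<Longrightarrow> f z \<noteq> 0"
  shows "Ck_on k U (\<lambda>z. inverse (f z))"
  using assms(2)
proof (induction k)
  case 0
  then show ?case using nz by (auto intro: continuous_on_inverse)
next
  case (Suc k)
  from Suc.prems obtain f' where f: "\<And>z. z \<in> U \<Longrightarrow> (f has_derivative f' z) (at z)"
    "Ck_on k U (\<lambda>z. f' z 1)" "Ck_on k U (\<lambda>z. f' z \<i>)" by (rule Ck_on_SucE) blast
  note IH = Suc.IH[OF Ck_on_Suc_imp[OF Suc.prems]]
  note mult = Ck_on_bilinear[OF bounded_bilinear_mult U]
  have *: "Ck_on k U (\<lambda>z. (- 1) * (inverse (f z) * f' z c * inverse (f z)))" if "Ck_on k U (\<lambda>z. f' z c)" for c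
    by (intro mult IH that Ck_on_const)
  show ?case
  proof (rule Ck_on_SucI[OF U, where g' = "\<lambda>z h. (- 1) * (inverse (f z) * f' z h * inverse (f z))"])
    show "((\<lambda>z. inverse (f z)) has_derivative (\<lambda>h. (- 1) * (inverse (f z) * f' z h * inverse (f z)))) (at z)"
      if "z \<in> U" for z
      using Deriv.has_derivative_inverse[OF nz[OF that] f(1)[OF that]] by simp
  qed (intro * f)+
qed

section \<open>Derivatives of maps into closed subspaces\<close>

lemma has_derivative_imp_quotient_LIMSEQ:
  fixes u :: "'c::real_normed_vector \<Rightarrow> 'a::real_normed_vector"
  assumes u: "(u has_derivative D) (at z)" and c: "c \<longlonglongrightarrow> 0" "\<And>n. c n \<noteq> (0::real)"
  shows "(\<lambda>n. (u (z + c n *\<^sub>R X) - u z) /\<^sub>R c n) \<longlonglongrightarrow> D X"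
proof -
  have "((\<lambda>t::real. u (z + t *\<^sub>R X)) has_derivative (\<lambda>t. D (t *\<^sub>R X))) (at 0)"
    by (rule has_derivative_compose[of "\<lambda>t. z + t *\<^sub>R X" "\<lambda>t. t *\<^sub>R X" 0 UNIV u D, simplified])
      (auto intro!: derivative_eq_intros u)
  then have "((\<lambda>t. norm (u (z + t *\<^sub>R X) - u z - t *\<^sub>R D X) / norm t) \<longlongrightarrow> 0) (at 0)"
    using linear_scale[OF has_derivative_linear[OF u]] by (simp add: has_derivative_iff_norm)
  then have "(\<lambda>n. norm (u (z + c n *\<^sub>R X) - u z - c n *\<^sub>R D X) / norm (c n)) \<longlonglongrightarrow> 0"
    by (rule filterlim_compose) (use c in \<open>auto simp: filterlim_at\<close>)
  also have "(\<lambda>n. norm (u (z + c n *\<^sub>R X) - u z - c n *\<^sub>R D X) / norm (c n))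
      = (\<lambda>n. norm ((u (z + c n *\<^sub>R X) - u z) /\<^sub>R c n - D X))"
  proof
    fix n
    have "(u (z + c n *\<^sub>R X) - u z) /\<^sub>R c n - D X = (u (z + c n *\<^sub>R X) - u z - c n *\<^sub>R D X) /\<^sub>R c n"
      using c(2)[of n] by (simp add: scaleR_diff_right)
    then show "norm (u (z + c n *\<^sub>R X) - u z - c n *\<^sub>R D X) / norm (c n)
        = norm ((u (z + c n *\<^sub>R X) - u z) /\<^sub>R c n - D X)" by (simp add: divide_inverse mult.commute)
  qed
  finally show ?thesis by (rule LIM_zero_cancel[OF tendsto_norm_zero_cancel])
qed

text \<open>The difference quotients eventually lie in W, and closedness captures their
  limit.\<close>

lemma has_derivative_in_closed_subspace:
  fixes u :: "'c::real_normed_vector \<Rightarrow> 'a::real_normed_vector"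
  assumes W: "subspace W" "closed W" and u: "(u has_derivative D) (at z)"
    and U: "open U" "z \<in> U" "\<And>w. w \<in> U \<Longrightarrow> u w \<in> W"
  shows "D X \<in> W"
proof -
  define c where "c n = inverse (real (Suc n))" for n
  have c0: "c \<longlonglongrightarrow> 0" unfolding c_def by (rule LIMSEQ_inverse_real_of_nat)
  have lim: "(\<lambda>n. (u (z + c n *\<^sub>R X) - u z) /\<^sub>R c n) \<longlonglongrightarrow> D X"
    by (rule has_derivative_imp_quotient_LIMSEQ[OF u c0]) (simp add: c_def)
  have "(\<lambda>n. z + c n *\<^sub>R X) \<longlonglongrightarrow> z + 0 *\<^sub>R X" by (intro tendsto_intros c0)
  then have "\<forall>\<^sub>F n in sequentially. z + c n *\<^sub>R X \<in> U"
    using U by (intro topological_tendstoD) auto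
  then have "\<forall>\<^sub>F n in sequentially. (u (z + c n *\<^sub>R X) - u z) /\<^sub>R c n \<in> W"
    by eventually_elim (intro subspace_mul subspace_diff W U)
  then show ?thesis by (rule Lim_in_closed_set[OF W(2) _ _ lim]) simp
qed

text \<open>A chain rule for maps that are linear and bounded on W alone. It is meant for the
  coordinates of W modulo V, about which nothing is known off W.\<close>

lemma has_derivative_bounded_linear_on:
  fixes u :: "'c::real_normed_vector \<Rightarrow> 'a::real_normed_vector" and A :: "'a \<Rightarrow> 'b::real_normed_vector"
  assumes W: "subspace W" "closed W"
    and A: "\<And>v w. v \<in> W \<Longrightarrow> w \<in> W \<Longrightarrow> A (v + w) = A v + A w"
      "\<And>r w. w \<in> W \<Longrightarrow> A (r *\<^sub>R w) = r *\<^sub>R A w" "\<And>w. w \<in> W \<Longrightarrow> norm (A w) \<le> K * norm w"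
    and u: "(u has_derivative D) (at z)" and U: "open U" "z \<in> U" "\<And>w. w \<in> U \<Longrightarrow> u w \<in> W"
  shows "((\<lambda>w. A (u w)) has_derivative (\<lambda>X. A (D X))) (at z)"
proof -
  have DW: "D X \<in> W" for X by (rule has_derivative_in_closed_subspace[OF W u U])
  have diff: "A (v - w) = A v - A w" if "v \<in> W" "w \<in> W" for v w
    using A(1)[of v "- w"] A(2)[of w "- 1"] that subspace_neg[OF W(1)] by simp
  interpret D: bounded_linear D using u by (rule has_derivative_bounded_linear)
  obtain L where L: "\<And>X. norm (D X) \<le> norm X * L" "L > 0" using D.pos_bounded by blast
  have K: "norm (A w) \<le> \<bar>K\<bar> * norm w" if "w \<in> W" for w
    using A(3)[OF that] by (meson abs_ge_self mult_right_mono norm_ge_zero order_trans)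
  have lin: "bounded_linear (\<lambda>X. A (D X))"
  proof (rule bounded_linear_intro[where K = "\<bar>K\<bar> * L"])
    show "norm (A (D X)) \<le> norm X * (\<bar>K\<bar> * L)" for X
      using K[OF DW, of X] mult_left_mono[OF L(1)[of X], of "\<bar>K\<bar>"] by (simp add: mult_ac)
  qed (simp_all add: D.add D.scaleR A DW)
  have lim: "((\<lambda>w. norm (u w - u z - D (w - z)) / norm (w - z)) \<longlongrightarrow> 0) (at z)"
    using u by (simp add: has_derivative_iff_norm)
  have "((\<lambda>w. norm (A (u w) - A (u z) - A (D (w - z))) / norm (w - z)) \<longlongrightarrow> 0) (at z)"
  proof (rule Lim_null_comparison)
    show "((\<lambda>w. \<bar>K\<bar> * (norm (u w - u z - D (w - z)) / norm (w - z))) \<longlongrightarrow> 0) (at z)"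
      using tendsto_mult_left[OF lim, of "\<bar>K\<bar>"] by simp
    have "\<forall>\<^sub>F w in at z. w \<in> U" using U by (simp add: eventually_at_topological) blast
    then show "\<forall>\<^sub>F w in at z. norm (norm (A (u w) - A (u z) - A (D (w - z))) / norm (w - z))
        \<le> \<bar>K\<bar> * (norm (u w - u z - D (w - z)) / norm (w - z))"
    proof eventually_elim
      case (elim w)
      then have "A (u w) - A (u z) - A (D (w - z)) = A (u w - u z - D (w - z))"
        by (simp add: diff DW U subspace_diff W)
      moreover have "norm (A (u w - u z - D (w - z))) \<le> \<bar>K\<bar> * norm (u w - u z - D (w - z))"
        by (intro K subspace_diff W U DW elim)
      ultimately show ?case by (simp add: divide_right_mono)
    qed
  qed
  with lin show ?thesis by (simp add: has_derivative_iff_norm)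
qed

lemma Ck_on_bounded_linear_on:
  fixes A :: "'a::real_normed_vector \<Rightarrow> 'b::real_normed_vector"
  assumes W: "subspace W" "closed W"
    and A: "\<And>v w. v \<in> W \<Longrightarrow> w \<in> W \<Longrightarrow> A (v + w) = A v + A w"
      "\<And>r w. w \<in> W \<Longrightarrow> A (r *\<^sub>R w) = r *\<^sub>R A w" "\<And>w. w \<in> W \<Longrightarrow> norm (A w) \<le> K * norm w"
    and U: "open U" and "Ck_on k U u" "\<And>z. z \<in> U \<Longrightarrow> u z \<in> W"
  shows "Ck_on k U (\<lambda>z. A (u z))"
  using assms(7,8)
proof (induction k arbitrary: u)
  case 0
  have diff: "A (v - w) = A v - A w" if "v \<in> W" "w \<in> W" for v w
    using A(1)[of v "- w"] A(2)[of w "- 1"] that subspace_neg[OF W(1)] by simp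
  have "continuous_on W A"
  proof (rule continuous_on_iff[THEN iffD2], intro ballI allI impI)
    fix v and e :: real assume v: "v \<in> W" "e > 0"
    have "dist (A w) (A v) < e" if w: "w \<in> W" "dist w v < e / (\<bar>K\<bar> + 1)" for w
    proof -
      have "norm (A (w - v)) \<le> K * norm (w - v)" by (intro A(3) subspace_diff W v w)
      also have "\<dots> \<le> (\<bar>K\<bar> + 1) * norm (w - v)" by (intro mult_right_mono) auto
      also have "\<dots> < e" using w(2) by (simp add: pos_less_divide_eq dist_norm mult.commute add_nonneg_pos)
      finally show ?thesis by (simp add: dist_norm diff v w)
    qed
    then show "\<exists>d>0. \<forall>w\<in>W. dist w v < d \<longrightarrow> dist (A w) (A v) < e"
      using v by (intro exI[of _ "e / (\<bar>K\<bar> + 1)"]) (auto simp: add_nonneg_pos)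
  qed
  then show ?case using 0 by (auto intro: continuous_on_compose2)
next
  case (Suc k)
  from Suc.prems(1) obtain u' where u: "\<And>z. z \<in> U \<Longrightarrow> (u has_derivative u' z) (at z)"
    "Ck_on k U (\<lambda>z. u' z 1)" "Ck_on k U (\<lambda>z. u' z \<i>)" by (rule Ck_on_SucE) blast
  have u'W: "u' z X \<in> W" if "z \<in> U" for z X
    by (rule has_derivative_in_closed_subspace[OF W u(1)[OF that] U that Suc.prems(2)])
  show ?case
  proof (rule Ck_on_SucI[OF U, where g' = "\<lambda>z X. A (u' z X)"])
    show "((\<lambda>z. A (u z)) has_derivative (\<lambda>X. A (u' z X))) (at z)" if "z \<in> U" for z
      by (rule has_derivative_bounded_linear_on[OF W A u(1)[OF that] U that Suc.prems(2)])
  qed (intro Suc.IH u u'W; assumption)+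
qed

lemma Ck_on_bounded_linear:
  assumes "bounded_linear A" "open U" "Ck_on k U u"
  shows "Ck_on k U (\<lambda>z. A (u z))"
proof -
  interpret bounded_linear A by fact
  obtain K where K: "\<And>x. norm (A x) \<le> norm x * K" using bounded by blast
  show ?thesis
    by (rule Ck_on_bounded_linear_on[where W = UNIV and K = K, OF _ _ _ _ _ assms(2,3)])
      (simp_all add: add scaleR K mult.commute[of K])
qed

section \<open>Linear equations with smooth coefficients\<close>

text \<open>A product rule in which the second factor is merely continuous: as the first factor
  vanishes at z, replacing \<open>g w\<close> by \<open>g z\<close> costs only o(|w - z|). This
  permits differentiating an equation before its solution is known to be differentiable.\<close>

lemma has_derivative_bilinear_zero:
  fixes f :: "'c::real_normed_vector \<Rightarrow> 'a::real_normed_vector"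
  assumes B: "bounded_bilinear B" and f: "(f has_derivative f') (at z)" "f z = 0" and g: "isCont g z"
  shows "((\<lambda>w. B (f w) (g w)) has_derivative (\<lambda>X. B (f' X) (g z))) (at z)"
proof -
  interpret B: bounded_bilinear B by fact
  have 1: "((\<lambda>w. B (f w) (g z)) has_derivative (\<lambda>X. B (f' X) (g z))) (at z)"
    by (rule bounded_linear.has_derivative[OF B.bounded_linear_left f(1)])
  obtain K where K: "\<And>a b. norm (B a b) \<le> norm a * norm b * K" "K > 0" using B.pos_bounded by blast
  obtain F where F: "\<And>X. norm (f' X) \<le> norm X * F" "F > 0"
    using bounded_linear.pos_bounded[OF has_derivative_bounded_linear[OF f(1)]] by blast
  have flim: "((\<lambda>w. norm (f w - f' (w - z)) / norm (w - z)) \<longlongrightarrow> 0) (at z)"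
    using f by (simp add: has_derivative_iff_norm)
  have glim: "((\<lambda>w. norm (g w - g z)) \<longlongrightarrow> 0) (at z)"
    using g by (simp add: isCont_def tendsto_norm_zero LIM_zero)
  have "((\<lambda>w. B (f w) (g w - g z)) has_derivative (\<lambda>X. 0)) (at z)"
    unfolding has_derivative_iff_norm
  proof (rule conjI[OF bounded_linear_zero], rule Lim_null_comparison)
    show "((\<lambda>w. (norm (f w - f' (w - z)) / norm (w - z) + F) * norm (g w - g z) * K) \<longlongrightarrow> 0) (at z)"
    proof -
      have "((\<lambda>w. (norm (f w - f' (w - z)) / norm (w - z) + F) * norm (g w - g z) * K) \<longlongrightarrow> (0 + F) * 0 * K) (at z)"
        by (rule tendsto_mult[OF tendsto_mult[OF tendsto_add[OF flim tendsto_const] glim] tendsto_const])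
      then show ?thesis by simp
    qed
    show "\<forall>\<^sub>F w in at z. norm (norm (B (f w) (g w - g z) - B (f z) (g z - g z) - 0) / norm (w - z))
        \<le> (norm (f w - f' (w - z)) / norm (w - z) + F) * norm (g w - g z) * K"
      unfolding eventually_at_filter
    proof (rule always_eventually, intro allI impI)
      fix w assume "w \<noteq> z"
      have "norm (f w) \<le> norm (f w - f' (w - z)) + norm (w - z) * F"
        using norm_triangle_sub[of "f w" "f' (w - z)"] F(1)[of "w - z"] by linarith
      then have *: "norm (f w) / norm (w - z) \<le> norm (f w - f' (w - z)) / norm (w - z) + F"
        using \<open>w \<noteq> z\<close> by (simp add: field_simps)
      have "norm (B (f w) (g w - g z)) / norm (w - z) \<le> norm (f w) * norm (g w - g z) * K / norm (w - z)"
        by (intro divide_right_mono K) simp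
      also have "\<dots> = norm (f w) / norm (w - z) * (norm (g w - g z) * K)" by simp
      also have "\<dots> \<le> (norm (f w - f' (w - z)) / norm (w - z) + F) * (norm (g w - g z) * K)"
        using * K(2) by (intro mult_right_mono) auto
      finally show "norm (norm (B (f w) (g w - g z) - B (f z) (g z - g z) - 0) / norm (w - z))
          \<le> (norm (f w - f' (w - z)) / norm (w - z) + F) * norm (g w - g z) * K"
        by (simp add: f(2) B.zero_left mult.assoc)
    qed
  qed
  from has_derivative_add[OF 1 this] show ?thesis
    by (simp add: B.add_right[symmetric])
qed

text \<open>The lower bound transfers convergence from \<open>T (u w)\<close> back to
  \<open>u w\<close>, first for difference quotients and then for the first order remainder.\<close>

lemma has_derivative_bounded_below:
  fixes u :: "'c::real_normed_vector \<Rightarrow> 'a::banach" and T :: "'a \<Rightarrow> 'b::real_normed_vector"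
  assumes T: "bounded_linear T" and W: "subspace W" "closed W"
    and c: "c > 0" "\<And>w. w \<in> W \<Longrightarrow> c * norm w \<le> norm (T w)"
    and u: "\<And>z. u z \<in> W" and Tu: "((\<lambda>z. T (u z)) has_derivative \<rho>) (at z)"
  obtains D where "(u has_derivative D) (at z)" "\<And>X. D X \<in> W" "\<And>X. T (D X) = \<rho> X"
proof -
  interpret T: bounded_linear T by fact
  interpret \<rho>: bounded_linear \<rho> using Tu by (rule has_derivative_bounded_linear)
  have inj: "v = w" if "v \<in> W" "w \<in> W" "T v = T w" for v w
    using c(2)[of "v - w"] that c(1) by (simp add: subspace_diff W T.diff mult_le_0_iff)
  \<comment> \<open>The candidate derivative is the limit of the difference quotients of u, which
    are Cauchy because their images under T converge to \<rho> X.\<close>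
  have "\<exists>d\<in>W. T d = \<rho> X" for X
  proof -
    define e where "e n = inverse (real (Suc n))" for n
    have e0: "e \<longlonglongrightarrow> 0" unfolding e_def by (rule LIMSEQ_inverse_real_of_nat)
    define q where "q n = (u (z + e n *\<^sub>R X) - u z) /\<^sub>R e n" for n
    have qW: "q n \<in> W" for n unfolding q_def by (intro subspace_mul subspace_diff W u)
    have lim: "(\<lambda>n. T (q n)) \<longlonglongrightarrow> \<rho> X"
      using has_derivative_imp_quotient_LIMSEQ[OF Tu e0, of X]
      by (simp add: q_def e_def T.scaleR T.diff)
    have "Cauchy q"
    proof (rule metric_CauchyI)
      fix \<epsilon> :: real assume "\<epsilon> > 0"
      then obtain M where M: "\<And>m n. m \<ge> M \<Longrightarrow> n \<ge> M \<Longrightarrow> dist (T (q m)) (T (q n)) < c * \<epsilon>"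
        using metric_CauchyD[OF LIMSEQ_imp_Cauchy[OF lim] mult_pos_pos[OF c(1) \<open>\<epsilon> > 0\<close>]] by blast
      have "dist (q m) (q n) < \<epsilon>" if "m \<ge> M" "n \<ge> M" for m n
      proof -
        have "c * norm (q m - q n) < c * \<epsilon>"
          using M[OF that] c(2)[OF subspace_diff[OF W(1) qW[of m] qW[of n]]] by (simp add: dist_norm T.diff)
        then show ?thesis using c(1) by (simp add: dist_norm)
      qed
      then show "\<exists>M. \<forall>m\<ge>M. \<forall>n\<ge>M. dist (q m) (q n) < \<epsilon>" by blast
    qed
    then obtain d where d: "q \<longlonglongrightarrow> d" by (auto simp: Cauchy_convergent_iff convergent_def)
    have "d \<in> W" using closed_sequentially[OF W(2) _ d] qW by blast
    moreover have "T d = \<rho> X" using LIMSEQ_unique[OF T.tendsto[OF d] lim] .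
    ultimately show ?thesis by blast
  qed
  then obtain D where D: "\<And>X. D X \<in> W" "\<And>X. T (D X) = \<rho> X" by metis
  obtain K where K: "\<And>X. norm (\<rho> X) \<le> norm X * K" "K > 0" using \<rho>.pos_bounded by blast
  \<comment> \<open>Linearity is inherited from \<rho> through the injectivity of T on W, and
    boundedness through the lower bound.\<close>
  have "bounded_linear D"
  proof (rule bounded_linear_intro[where K = "K / c"])
    show "D (X + Y) = D X + D Y" for X Y
      by (rule inj) (simp_all add: D T.add \<rho>.add subspace_add W)
    show "D (r *\<^sub>R X) = r *\<^sub>R D X" for r X
      by (rule inj) (simp_all add: D T.scaleR \<rho>.scaleR subspace_mul W)
    show "norm (D X) \<le> norm X * (K / c)" for X
      using order_trans[OF c(2)[OF D(1)[of X]]] K(1)[of X] c(1) by (simp add: D field_simps)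
  qed
  moreover have "((\<lambda>w. norm (u w - u z - D (w - z)) / norm (w - z)) \<longlongrightarrow> 0) (at z)"
  proof (rule Lim_null_comparison)
    have "((\<lambda>w. norm (T (u w) - T (u z) - \<rho> (w - z)) / norm (w - z)) \<longlongrightarrow> 0) (at z)"
      using Tu by (simp add: has_derivative_iff_norm)
    from tendsto_mult_left[OF this, of "inverse c"]
    show "((\<lambda>w. inverse c * (norm (T (u w) - T (u z) - \<rho> (w - z)) / norm (w - z))) \<longlongrightarrow> 0) (at z)"
      by simp
    have "norm (u w - u z - D (w - z)) \<le> inverse c * norm (T (u w) - T (u z) - \<rho> (w - z))" for w
      using c(2)[of "u w - u z - D (w - z)"] c(1)
      by (simp add: subspace_diff W u D T.diff inverse_eq_divide pos_le_divide_eq mult.commute)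
    then show "\<forall>\<^sub>F w in at z. norm (norm (u w - u z - D (w - z)) / norm (w - z))
        \<le> inverse c * (norm (T (u w) - T (u z) - \<rho> (w - z)) / norm (w - z))"
      by (intro always_eventually allI) (simp add: divide_right_mono)
  qed
  ultimately have "(u has_derivative D) (at z)" by (simp add: has_derivative_iff_norm)
  then show ?thesis using D by (rule that)
qed

lemma solution_continuous:
  fixes T :: "'c::real_normed_vector \<Rightarrow> 'a::real_normed_vector \<Rightarrow>\<^sub>L 'b::real_normed_vector"
  assumes T: "isCont T z" and W: "subspace W"
    and c: "c > 0" "\<And>w. w \<in> W \<Longrightarrow> c * norm w \<le> norm (T z w)"
    and u: "\<And>z. u z \<in> W" and eq: "\<And>z. T z (u z) = r z" and r: "isCont r z"
  shows "isCont u z"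
proof -
  have T0: "((\<lambda>w. norm (T z - T w)) \<longlongrightarrow> 0) (at z)"
    using tendsto_norm[OF tendsto_diff[OF tendsto_const[of "T z"] T[unfolded isCont_def]]] by simp
  have r0: "((\<lambda>w. norm (r w - r z)) \<longlongrightarrow> 0) (at z)"
    using r by (simp add: isCont_def tendsto_norm_zero LIM_zero)
  have "((\<lambda>w. u w - u z) \<longlongrightarrow> 0) (at z)"
  proof (rule Lim_null_comparison)
    show "((\<lambda>w. 2 / c * (norm (T z - T w) * norm (u z) + norm (r w - r z))) \<longlongrightarrow> 0) (at z)"
      using tendsto_mult[OF tendsto_const[of "2 / c"] tendsto_add[OF tendsto_mult[OF T0 tendsto_const[of "norm (u z)"]] r0]]
      by simp
    \<comment> \<open>With half of the lower bound, the perturbation of the operator applied to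
      \<open>u w - u z\<close> can be absorbed on the left; this is the origin of the factor 2 /
      c.\<close>
    have "\<forall>\<^sub>F w in at z. norm (T z - T w) < c / 2"
      by (rule order_tendstoD(2)[OF T0]) (use c in simp)
    then show "\<forall>\<^sub>F w in at z. norm (u w - u z) \<le> 2 / c * (norm (T z - T w) * norm (u z) + norm (r w - r z))"
    proof eventually_elim
      case (elim w)
      have "c * norm (u w - u z) \<le> norm (T z (u w - u z))"
        by (intro c subspace_diff W u)
      also have "T z (u w - u z) = (T z - T w) (u w - u z) + (T z - T w) (u z) + (r w - r z)"
        by (simp add: blinfun.diff_left blinfun.diff_right eq[symmetric])
      also have "norm \<dots> \<le> norm (T z - T w) * norm (u w - u z) + norm (T z - T w) * norm (u z) + norm (r w - r z)"
        by (intro norm_triangle_mono norm_blinfun order_refl)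
      also have "norm (T z - T w) * norm (u w - u z) \<le> c / 2 * norm (u w - u z)"
        using elim by (intro mult_right_mono) auto
      finally show ?case using c(1) by (simp add: field_simps)
    qed
  qed
  then show ?thesis by (simp add: isCont_def LIM_zero_cancel)
qed

text \<open>A bootstrap: the derivative of u in direction X solves an equation with the same
  operator and the right-hand side r' X - T' X u, whose class is one lower. Hence both u and r are
  generalised in the induction.\<close>

lemma solution_Ck:
  fixes T :: "complex \<Rightarrow> 'a::banach \<Rightarrow>\<^sub>L 'b::real_normed_vector"
  assumes T: "\<And>k. Ck_on k UNIV T" and W: "subspace W" "closed W"
    and bb: "\<And>z. \<exists>c>0. \<forall>w\<in>W. c * norm w \<le> norm (T z w)"
    and u: "\<And>z. u z \<in> W" and eq: "\<And>z. T z (u z) = r z" and r: "Ck_on k UNIV r"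
  shows "Ck_on k UNIV u"
  using u eq r
proof (induction k arbitrary: u r)
  case 0
  have "isCont u z" for z
  proof -
    obtain c where c: "c > 0" "\<And>w. w \<in> W \<Longrightarrow> c * norm w \<le> norm (T z w)" using bb[of z] by blast
    show ?thesis
      by (rule solution_continuous[where T = T and r = r, OF _ W(1) c 0(1,2)])
        (use T[of 0] 0(3) in \<open>auto simp: continuous_on_eq_continuous_at\<close>)
  qed
  then show ?case by (simp add: continuous_at_imp_continuous_on)
next
  case (Suc k)
  have uk: "Ck_on k UNIV u"
    by (rule Suc.IH[OF Suc.prems(1,2) Ck_on_Suc_imp[OF Suc.prems(3)]])
  from T[of "Suc k"] obtain T' where T': "\<And>z. (T has_derivative T' z) (at z)"
    "Ck_on k UNIV (\<lambda>z. T' z 1)" "Ck_on k UNIV (\<lambda>z. T' z \<i>)" by (rule Ck_on_SucE) blast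
  from Suc.prems(3) obtain r' where r': "\<And>z. (r has_derivative r' z) (at z)"
    "Ck_on k UNIV (\<lambda>z. r' z 1)" "Ck_on k UNIV (\<lambda>z. r' z \<i>)" by (rule Ck_on_SucE) blast
  have uc: "isCont u z" for z
  proof -
    have "Ck_on 0 UNIV u" using uk by (induction k) (metis Ck_on_Suc_imp)+
    then have "continuous_on UNIV u" by simp
    then show ?thesis by (simp add: continuous_on_eq_continuous_at)
  qed
  have "\<exists>D. (u has_derivative D) (at z) \<and> (\<forall>X. D X \<in> W) \<and> (\<forall>X. T z (D X) = r' z X - T' z X (u z))" for z
  proof -
    obtain c where c: "c > 0" "\<And>w. w \<in> W \<Longrightarrow> c * norm w \<le> norm (T z w)" using bb[of z] by blast
    \<comment> \<open>The operator is frozen at z: \<open>T z (u w)\<close> equals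
      \<open>r w\<close> minus this product, whose first factor vanishes at w = z, so continuity of
      u is enough to differentiate it.\<close>
    have "((\<lambda>w. (T w - T z) (u w)) has_derivative (\<lambda>X. T' z X (u z))) (at z)"
      by (rule has_derivative_bilinear_zero[OF bounded_bilinear_blinfun_apply _ _ uc])
        (auto intro!: derivative_eq_intros T')
    from has_derivative_diff[OF r'(1) this]
    have "((\<lambda>w. T z (u w)) has_derivative (\<lambda>X. r' z X - T' z X (u z))) (at z)"
      by (simp add: Suc.prems(2)[symmetric] blinfun.diff_left)
    from has_derivative_bounded_below[OF blinfun.bounded_linear_right W c Suc.prems(1) this]
    show ?thesis by metis
  qed
  then obtain D where D: "\<And>z. (u has_derivative D z) (at z)" "\<And>z X. D z X \<in> W"
    "\<And>z X. T z (D z X) = r' z X - T' z X (u z)" by metis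
  have "Ck_on k UNIV (\<lambda>z. D z X)" if "Ck_on k UNIV (\<lambda>z. T' z X)" "Ck_on k UNIV (\<lambda>z. r' z X)" for X
  proof (rule Suc.IH)
    show "D z X \<in> W" "T z (D z X) = r' z X + (- 1) *\<^sub>R T' z X (u z)" for z
      by (simp_all add: D)
    show "Ck_on k UNIV (\<lambda>z. r' z X + (- 1) *\<^sub>R T' z X (u z))"
      by (intro Ck_on_add that Ck_on_bilinear[OF bounded_bilinear_scaleR] Ck_on_const
          Ck_on_bilinear[OF bounded_bilinear_blinfun_apply] uk open_UNIV)
  qed
  then show ?case
    using D(1) T' r' by (intro Ck_on_SucI[where g' = D]) auto
qed

section \<open>The multiplication operators as functions of \<open>z\<close>\<close>

text \<open>\<open>Blinfun\<close> is total, so the value is controlled only where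
  \<open>circle_bounded\<close> makes the multiplication a bounded operator.\<close>

definition rmult_op :: "(complex \<Rightarrow> complex) \<Rightarrow> L2H \<Rightarrow>\<^sub>L L2H"
  where "rmult_op \<gamma> = Blinfun (\<lambda>f. rmult f \<gamma>)"

lemma rmult_op_apply: "circle_bounded \<gamma> \<Longrightarrow> rmult_op \<gamma> f = rmult f \<gamma>"
  by (simp add: rmult_op_def bounded_linear_Blinfun_apply bounded_linear_rmult)

lemma norm_rmult_op_le:
  assumes "circle_bounded \<gamma>" "\<And>\<zeta>. norm \<zeta> = 1 \<Longrightarrow> cmod (\<gamma> \<zeta>) \<le> B"
  shows "norm (rmult_op \<gamma>) \<le> B"
proof (rule norm_blinfun_bound)
  show "0 \<le> B" using order_trans[OF norm_ge_zero assms(2)[of 1]] by simp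
  show "norm (rmult_op \<gamma> f) \<le> B * norm f" for f
    unfolding rmult_op_apply[OF assms(1)] by (rule norm_rmult_le[OF assms])
qed

lemma circle_bounded_gamma1: "circle_bounded (gamma1 z)"
  unfolding gamma1_def by (intro circle_bounded_continuous continuous_intros)

lemma circle_bounded_scale: "circle_bounded (\<lambda>\<zeta>. h * \<zeta>)"
  by (intro circle_bounded_continuous continuous_intros)

lemma rmult_gamma1_cancel: "rmult (rmult f (gamma1 z)) (gamma1 (- z)) = f"
  "rmult (rmult f (gamma1 (- z))) (gamma1 z) = f"
  unfolding rmult_rmult[OF circle_bounded_gamma1 circle_bounded_gamma1]
  by (simp_all add: gamma1_def exp_add[symmetric])

text \<open>The operator norm of a multiplication is at most the supremum of the multiplier on the
  circle, so the quadratic Taylor remainder of the exponential gives differentiability in operator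
  norm.\<close>

lemma has_derivative_rmult_op_gamma1:
  "((\<lambda>z. rmult_op (gamma1 (- z))) has_derivative (\<lambda>h. rmult_op (gamma1 (- z)) o\<^sub>L rmult_op (\<lambda>\<zeta>. - h * \<zeta>))) (at z)"
proof -
  have lin: "bounded_linear (\<lambda>h. rmult_op (\<lambda>\<zeta>. - h * \<zeta>))"
  proof (rule bounded_linear_intro[where K = 1])
    show "rmult_op (\<lambda>\<zeta>. - (h + k) * \<zeta>) = rmult_op (\<lambda>\<zeta>. - h * \<zeta>) + rmult_op (\<lambda>\<zeta>. - k * \<zeta>)" for h k
    proof (rule blinfun_eqI)
      fix f
      have "rmult f (\<lambda>\<zeta>. - (h + k) * \<zeta>) = rmult f (\<lambda>\<zeta>. - h * \<zeta> + - k * \<zeta>)"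
        by (simp add: algebra_simps)
      also have "\<dots> = rmult f (\<lambda>\<zeta>. - h * \<zeta>) + rmult f (\<lambda>\<zeta>. - k * \<zeta>)"
        by (intro rmult_plus circle_bounded_continuous continuous_intros)
      finally show "rmult_op (\<lambda>\<zeta>. - (h + k) * \<zeta>) f = (rmult_op (\<lambda>\<zeta>. - h * \<zeta>) + rmult_op (\<lambda>\<zeta>. - k * \<zeta>)) f"
        by (simp only: rmult_op_apply[OF circle_bounded_scale] blinfun.add_left)
    qed
    show "rmult_op (\<lambda>\<zeta>. - (r *\<^sub>R h) * \<zeta>) = r *\<^sub>R rmult_op (\<lambda>\<zeta>. - h * \<zeta>)" for r h
    proof (rule blinfun_eqI)
      fix f
      have "rmult (r *\<^sub>R f) (\<lambda>\<zeta>. - h * \<zeta>) = rmult (rmult f (\<lambda>_. of_real r)) (\<lambda>\<zeta>. - h * \<zeta>)"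
      proof -
        have "r *\<^sub>R f = rmult f (\<lambda>_. of_real r)"
          unfolding L2H_eq_iff using rep_scaleR[of r f] rep_rmult[of "\<lambda>_. of_real r" f]
          by (auto simp: circle_bounded_continuous mult_of_cpx_of_real)
        then show ?thesis by simp
      qed
      also have "\<dots> = rmult f (\<lambda>\<zeta>. of_real r * (- h * \<zeta>))"
        by (intro rmult_rmult circle_bounded_scale circle_bounded_continuous continuous_intros)
      also have "(\<lambda>\<zeta>. of_real r * (- h * \<zeta>)) = (\<lambda>\<zeta>. - (r *\<^sub>R h) * \<zeta>)"
        by (rule ext) (simp add: scaleR_conv_of_real)
      finally show "rmult_op (\<lambda>\<zeta>. - (r *\<^sub>R h) * \<zeta>) f = (r *\<^sub>R rmult_op (\<lambda>\<zeta>. - h * \<zeta>)) f"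
        by (simp only: rmult_op_apply[OF circle_bounded_scale] blinfun.scaleR_left rmult_scaleR[OF circle_bounded_scale])
    qed
    show "norm (rmult_op (\<lambda>\<zeta>. - h * \<zeta>)) \<le> norm h * 1" for h
      by (rule norm_rmult_op_le[OF circle_bounded_scale]) (simp add: norm_mult)
  qed
  have "((\<lambda>w. norm (rmult_op (gamma1 (- w)) - rmult_op (gamma1 (- z))
      - (rmult_op (gamma1 (- z)) o\<^sub>L rmult_op (\<lambda>\<zeta>. - (w - z) * \<zeta>))) / norm (w - z)) \<longlongrightarrow> 0) (at z)"
  proof (rule Lim_null_comparison)
    have "((\<lambda>w. exp (norm z) * exp (norm (w - z)) * norm (w - z)) \<longlongrightarrow> exp (norm z) * exp (norm (z - z)) * norm (z - z)) (at z)"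
      by (intro tendsto_intros)
    then show "((\<lambda>w. exp (norm z) * exp (norm (w - z)) * norm (w - z)) \<longlongrightarrow> 0) (at z)" by simp
    have "norm (rmult_op (gamma1 (- w)) - rmult_op (gamma1 (- z))
      - (rmult_op (gamma1 (- z)) o\<^sub>L rmult_op (\<lambda>\<zeta>. - (w - z) * \<zeta>))) \<le> exp (norm z) * exp (norm (w - z)) * norm (w - z) * norm (w - z)" for w
    proof -
      \<comment> \<open>The whole first order remainder is a single multiplication operator, with
        this Taylor remainder as its multiplier.\<close>
      define \<delta> where "\<delta> \<zeta> = exp (- z * \<zeta>) * (exp (- (w - z) * \<zeta>) - 1 - (- (w - z) * \<zeta>))" for \<zeta>
      have \<delta>: "circle_bounded \<delta>"
        unfolding \<delta>_def by (intro circle_bounded_continuous continuous_intros)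
      have "rmult_op (gamma1 (- w)) - rmult_op (gamma1 (- z))
        - (rmult_op (gamma1 (- z)) o\<^sub>L rmult_op (\<lambda>\<zeta>. - (w - z) * \<zeta>)) = rmult_op \<delta>"
      proof (rule blinfun_eqI)
        fix f
        define \<eta> where "\<eta> \<zeta> = - (w - z) * \<zeta> * gamma1 (- z) \<zeta>" for \<zeta>
        have \<eta>: "circle_bounded \<eta>"
          unfolding \<eta>_def by (intro circle_bounded_mult circle_bounded_scale circle_bounded_gamma1)
        have b: "circle_bounded (\<lambda>\<zeta>. \<delta> \<zeta> + \<eta> \<zeta>)"
          unfolding \<delta>_def \<eta>_def gamma1_def by (intro circle_bounded_continuous continuous_intros)
        have "exp (- w * \<zeta>) = exp (- z * \<zeta>) * exp (- (w - z) * \<zeta>)" for \<zeta>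
          unfolding exp_add[symmetric] by (simp add: algebra_simps)
        then have "gamma1 (- w) = (\<lambda>\<zeta>. (\<delta> \<zeta> + \<eta> \<zeta>) + gamma1 (- z) \<zeta>)"
          unfolding \<delta>_def \<eta>_def gamma1_def by (intro ext) (simp only:, simp only: ring_distribs, simp)
        then have "rmult f (gamma1 (- w)) = rmult f (\<lambda>\<zeta>. (\<delta> \<zeta> + \<eta> \<zeta>) + gamma1 (- z) \<zeta>)" by simp
        also have "\<dots> = rmult f \<delta> + rmult f \<eta> + rmult f (gamma1 (- z))"
          using circle_bounded_gamma1[of "- w"] \<open>gamma1 (- w) = _\<close>
          by (simp only: rmult_plus[OF b circle_bounded_gamma1] rmult_plus[OF \<delta> \<eta> b])
        finally have "rmult f (gamma1 (- w)) = rmult f \<delta> + rmult f \<eta> + rmult f (gamma1 (- z))" .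
        moreover have "rmult (rmult f (\<lambda>\<zeta>. - (w - z) * \<zeta>)) (gamma1 (- z)) = rmult f \<eta>"
          unfolding \<eta>_def by (rule rmult_rmult[OF circle_bounded_scale circle_bounded_gamma1])
        ultimately show "(rmult_op (gamma1 (- w)) - rmult_op (gamma1 (- z))
          - (rmult_op (gamma1 (- z)) o\<^sub>L rmult_op (\<lambda>\<zeta>. - (w - z) * \<zeta>))) f = rmult_op \<delta> f"
          by (simp only: blinfun.diff_left blinfun_apply_blinfun_compose rmult_op_apply circle_bounded_scale circle_bounded_gamma1 \<delta>) simp
      qed
      moreover have "norm (rmult_op \<delta>) \<le> exp (norm z) * exp (norm (w - z)) * norm (w - z) * norm (w - z)"
      proof (rule norm_rmult_op_le[OF \<delta>])
        fix \<zeta> :: complex assume \<zeta>: "norm \<zeta> = 1"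
        have "norm (exp (- (w - z) * \<zeta>) - (\<Sum>i\<le>1. (- (w - z) * \<zeta>) ^ i / fact i))
            \<le> exp \<bar>Re (- (w - z) * \<zeta>)\<bar> * norm (- (w - z) * \<zeta>) ^ Suc 1 / fact 1"
          by (rule Taylor_exp)
        also have "\<dots> = exp \<bar>Re (- (w - z) * \<zeta>)\<bar> * (norm (w - z) * norm (w - z))"
          by (simp add: norm_mult \<zeta> power2_eq_square norm_minus_commute)
        also have "\<dots> \<le> exp (norm (w - z)) * (norm (w - z) * norm (w - z))"
          using abs_Re_le_cmod[of "- (w - z) * \<zeta>"]
          by (intro mult_right_mono) (auto simp: norm_mult \<zeta> norm_minus_commute)
        finally have 1: "norm (exp (- (w - z) * \<zeta>) - 1 - (- (w - z) * \<zeta>)) \<le> exp (norm (w - z)) * (norm (w - z) * norm (w - z))"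
          by (simp add: algebra_simps)
        have "norm (exp (- z * \<zeta>)) \<le> exp (norm (- z * \<zeta>))" by (rule norm_exp)
        then have 2: "norm (exp (- z * \<zeta>)) \<le> exp (norm z)" by (simp add: norm_mult \<zeta>)
        show "norm (\<delta> \<zeta>) \<le> exp (norm z) * exp (norm (w - z)) * norm (w - z) * norm (w - z)"
          unfolding \<delta>_def norm_mult using mult_mono[OF 2 1] by (simp add: mult.assoc)
      qed
      ultimately show ?thesis by simp
    qed
    then show "\<forall>\<^sub>F w in at z. norm (norm (rmult_op (gamma1 (- w)) - rmult_op (gamma1 (- z))
      - (rmult_op (gamma1 (- z)) o\<^sub>L rmult_op (\<lambda>\<zeta>. - (w - z) * \<zeta>))) / norm (w - z)) \<le> exp (norm z) * exp (norm (w - z)) * norm (w - z)"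
      by (simp add: eventually_at_filter pos_divide_le_eq)
  qed
  moreover have "bounded_linear (\<lambda>h. rmult_op (gamma1 (- z)) o\<^sub>L rmult_op (\<lambda>\<zeta>. - h * \<zeta>))"
    by (rule bounded_linear_compose[OF bounded_bilinear.bounded_linear_right[OF bounded_bilinear_blinfun_compose] lin])
  ultimately show ?thesis unfolding has_derivative_iff_norm by blast
qed

lemma blinfun_compose_assoc: "(A o\<^sub>L B) o\<^sub>L C = A o\<^sub>L (B o\<^sub>L C)"
  by (rule blinfun_eqI) simp

text \<open>The right factor B closes the induction: differentiating merely composes it with
  multiplication by -h \<zeta>.\<close>

lemma Ck_on_rmult_op_gamma1: "Ck_on k UNIV (\<lambda>z. rmult_op (gamma1 (- z)) o\<^sub>L B)"
proof (induction k arbitrary: B)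
  case 0
  have "isCont (\<lambda>z. rmult_op (gamma1 (- z)) o\<^sub>L B) z" for z
    by (rule has_derivative_continuous[OF bounded_linear.has_derivative[OF
          bounded_bilinear.bounded_linear_left[OF bounded_bilinear_blinfun_compose] has_derivative_rmult_op_gamma1]])
  then show ?case by (simp add: continuous_at_imp_continuous_on)
next
  case (Suc k)
  show ?case
  proof (rule Ck_on_SucI[OF open_UNIV])
    show "((\<lambda>z. rmult_op (gamma1 (- z)) o\<^sub>L B) has_derivative
      (\<lambda>h. rmult_op (gamma1 (- z)) o\<^sub>L (rmult_op (\<lambda>\<zeta>. - h * \<zeta>) o\<^sub>L B))) (at z)" for z
      using bounded_linear.has_derivative[OF
          bounded_bilinear.bounded_linear_left[OF bounded_bilinear_blinfun_compose, of B] has_derivative_rmult_op_gamma1]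
      by (simp only: blinfun_compose_assoc)
  qed (rule Suc.IH)+
qed

definition baker_op :: "complex \<Rightarrow> L2H \<Rightarrow>\<^sub>L L2H"
  where "baker_op z = Blinfun pr_plus o\<^sub>L rmult_op (gamma1 (- z))"

lemma baker_op_apply: "baker_op z w = pr_plus (rmult w (gamma1 (- z)))"
  by (simp add: baker_op_def rmult_op_apply circle_bounded_gamma1 bounded_linear_Blinfun_apply bounded_linear_pr_plus)

lemma Ck_on_baker_op: "Ck_on k UNIV baker_op"
proof -
  have "Ck_on k UNIV (\<lambda>z. Blinfun pr_plus o\<^sub>L (rmult_op (gamma1 (- z)) o\<^sub>L id_blinfun))"
    by (intro Ck_on_bilinear[OF bounded_bilinear_blinfun_compose] Ck_on_const Ck_on_rmult_op_gamma1 open_UNIV)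
  moreover have "baker_op = (\<lambda>z. Blinfun pr_plus o\<^sub>L (rmult_op (gamma1 (- z)) o\<^sub>L id_blinfun))"
    by (intro ext blinfun_eqI) (simp add: baker_op_def)
  ultimately show ?thesis by simp
qed

lemma has_derivative_baker_op:
  "(baker_op has_derivative (\<lambda>h. Blinfun pr_plus o\<^sub>L (rmult_op (gamma1 (- z)) o\<^sub>L rmult_op (\<lambda>\<zeta>. - h * \<zeta>)))) (at z)"
  unfolding baker_op_def
  by (rule bounded_linear.has_derivative[OF
        bounded_bilinear.bounded_linear_right[OF bounded_bilinear_blinfun_compose] has_derivative_rmult_op_gamma1])

section \<open>Elements of the Grassmannian\<close>

lemma subspace_left_subspace: "left_subspace W \<Longrightarrow> subspace W"
  unfolding left_subspace_def subspace_def by (metis qscale_of_real)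

text \<open>The imaginary part of the complex inner product is the real inner product with i g, so
  complex orthonormality is expressible through the type class inner product.\<close>

lemma cinner_inner: "cinner f g = Complex (inner f g) (inner f (of_cpx \<i> *\<^sub>Q g))"
proof -
  let ?f = "rep_L2H f" and ?g = "rep_L2H g"
  have pt: "qfst (p * qcnj q) = of_real (inner p q) + \<i> * of_real (inner p (of_cpx \<i> * q))" for p q
    by (simp add: qcnj_def times_quat_def of_cpx_def inner_quat_def inner_complex_def complex_eq_iff algebra_simps)
  have i1: "integrable circle_measure (\<lambda>\<zeta>. inner (?f \<zeta>) (?g \<zeta>))"
    by (intro sq_int_inner sq_int_rep)
  have i2: "integrable circle_measure (\<lambda>\<zeta>. inner (?f \<zeta>) (of_cpx \<i> * ?g \<zeta>))"
    by (intro sq_int_inner sq_int_mult_left sq_int_rep)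
  have eq2: "(\<integral>\<zeta>. inner (?f \<zeta>) (of_cpx \<i> * ?g \<zeta>) \<partial>circle_measure) = inner f (of_cpx \<i> *\<^sub>Q g)"
    unfolding inner_L2H_rep
    by (intro integral_cong_AE) (use rep_qscale[of "of_cpx \<i>" g] in auto)
  have "cinner f g = (\<integral>\<zeta>. complex_of_real (inner (?f \<zeta>) (?g \<zeta>))
      + \<i> * complex_of_real (inner (?f \<zeta>) (of_cpx \<i> * ?g \<zeta>)) \<partial>circle_measure)"
    unfolding cinner_def pt ..
  also have "\<dots> = (\<integral>\<zeta>. complex_of_real (inner (?f \<zeta>) (?g \<zeta>)) \<partial>circle_measure)
      + (\<integral>\<zeta>. \<i> * complex_of_real (inner (?f \<zeta>) (of_cpx \<i> * ?g \<zeta>)) \<partial>circle_measure)"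
    by (intro Bochner_Integration.integral_add integrable_mult_right integrable_of_real i1 i2)
  also have "\<dots> = of_real (inner f g) + \<i> * of_real (inner f (of_cpx \<i> *\<^sub>Q g))"
    unfolding eq2[symmetric] inner_L2H_rep[of f g] by simp
  finally show ?thesis by (simp add: complex_eq_iff)
qed

lemma inner_qscale_i: "inner (of_cpx \<i> *\<^sub>Q f) (of_cpx \<i> *\<^sub>Q g) = inner f g"
proof -
  have pt: "inner (of_cpx \<i> * p) (of_cpx \<i> * q) = inner p q" for p q
    by (simp add: times_quat_def of_cpx_def inner_quat_def inner_complex_def)
  show ?thesis unfolding inner_L2H_rep
    by (intro integral_cong_AE) (use rep_qscale[of "of_cpx \<i>" f] rep_qscale[of "of_cpx \<i>" g] in \<open>auto simp: pt\<close>)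
qed

text \<open>A complex orthonormal basis B yields the real one consisting of B and i B.
  Multiplication by i is isometric and commutes with \<open>pr_minus\<close>, so the Hilbert-Schmidt
  sum over i B equals that over B.\<close>

lemma Gr_real_basis:
  assumes W: "W \<in> Gr"
  obtains E where "orthonormal E" "E \<subseteq> W" "\<And>w. w \<in> W \<Longrightarrow> (\<forall>e\<in>E. inner w e = 0) \<Longrightarrow> w = 0"
    "(\<lambda>e. (norm (pr_minus e))\<^sup>2) summable_on E"
proof -
  define I where "I f = of_cpx \<i> *\<^sub>Q f" for f
  obtain B where B: "hilbert_basis W B" "(\<lambda>e. (norm (pr_minus e))\<^sup>2) summable_on B"
    using W by (auto simp: Gr_def hilbert_schmidt_def)
  have WI: "I w \<in> W" if "w \<in> W" for w
    using W that by (auto simp: Gr_def left_subspace_def I_def)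
  have BW: "B \<subseteq> W" using B(1) by (simp add: hilbert_basis_def)
  have on: "inner e e' = (if e = e' then 1 else 0)" "inner e (I e') = 0" if "e \<in> B" "e' \<in> B" for e e'
  proof -
    have "cinner e e' = (if e = e' then 1 else 0)" using B(1) that by (simp add: hilbert_basis_def)
    then show "inner e e' = (if e = e' then 1 else 0)" "inner e (I e') = 0"
      by (auto simp: cinner_inner complex_eq_iff I_def split: if_splits)
  qed
  have II: "inner (I f) (I g) = inner f g" for f g unfolding I_def by (rule inner_qscale_i)
  have inj: "inj_on I B"
  proof (rule inj_onI)
    fix e e' assume "e \<in> B" "e' \<in> B" "I e = I e'"
    then have "inner e e' = 1" using II[of e e'] II[of e e] on(1)[of e e] by simp
    then show "e = e'" using on(1)[OF \<open>e \<in> B\<close> \<open>e' \<in> B\<close>] by (auto split: if_splits)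
  qed
  \<comment> \<open>B and i B are disjoint because e has inner product 1 with itself and 0 with
    every i e'.\<close>
  have neq: "e \<noteq> I e'" if "e \<in> B" "e' \<in> B" for e e'
    using on(1)[of e e] on(2)[of e e'] that by auto
  define E where "E = B \<union> I ` B"
  have "orthonormal E"
    unfolding orthonormal_def E_def
  proof (intro ballI)
    fix e e' assume "e \<in> B \<union> I ` B" "e' \<in> B \<union> I ` B"
    then consider "e \<in> B" "e' \<in> B" | a where "a \<in> B" "e = I a" "e' \<in> B"
      | b where "e \<in> B" "b \<in> B" "e' = I b" | a b where "a \<in> B" "b \<in> B" "e = I a" "e' = I b" by blast
    then show "inner e e' = (if e = e' then 1 else 0)"
    proof cases
      case (2 a)
      then show ?thesis using on(2)[of e' a] neq[of e' a] by (auto simp: inner_commute)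
    next
      case (4 a b)
      then show ?thesis using on(1)[of a b] inj_onD[OF inj, of a b] by (auto simp: II)
    qed (use on neq in auto)
  qed
  moreover have "E \<subseteq> W" using BW WI by (auto simp: E_def)
  moreover have "w = 0" if "w \<in> W" "\<forall>e\<in>E. inner w e = 0" for w
  proof -
    have "\<forall>e\<in>B. cinner w e = 0"
      using that(2) by (auto simp: E_def cinner_inner complex_eq_iff I_def)
    then show ?thesis using B(1) that(1) by (simp add: hilbert_basis_def)
  qed
  moreover have "(\<lambda>e. (norm (pr_minus e))\<^sup>2) summable_on E"
  proof -
    have "(\<lambda>e. (norm (pr_minus e))\<^sup>2) \<circ> I = (\<lambda>e. (norm (pr_minus e))\<^sup>2)"
      by (rule ext) (simp add: I_def pr_minus_qscale norm_qscale)
    then have "(\<lambda>e. (norm (pr_minus e))\<^sup>2) summable_on I ` B"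
      using B(2) by (simp add: summable_on_reindex[OF inj])
    then show ?thesis unfolding E_def
      using B(2) neq by (intro summable_on_Un_disjoint) auto
  qed
  ultimately show ?thesis by (rule that)
qed

text \<open>Multiplying an element of \<open>H_plus\<close> by a polynomial in \<zeta> creates no
  negative coefficients, and the Taylor polynomials of exp(z \<zeta>) converge uniformly on the
  circle.\<close>

lemma pr_minus_rmult_gamma1:
  "pr_minus (rmult w (gamma1 z)) = pr_minus (rmult (pr_minus w) (gamma1 z))"
proof -
  have "fourier (rmult (pr_plus w) (gamma1 z)) m = 0" if m: "m < 0" for m
  proof -
    have partial: "fourier (rmult (pr_plus w) (\<lambda>\<zeta>. \<Sum>k<n. (z * \<zeta>) ^ k / fact k)) m = 0" for n
    proof (induction n)
      case 0
      then show ?case by (simp add: fourier_rmult_const circle_bounded_continuous)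
    next
      case (Suc n)
      have cb: "circle_bounded (\<lambda>\<zeta>. \<Sum>k<n. (z * \<zeta>) ^ k / fact k)" for n
        by (intro circle_bounded_continuous continuous_intros) auto
      have c: "circle_bounded (\<lambda>\<zeta>. (z * \<zeta>) ^ n / fact n)"
        by (intro circle_bounded_continuous continuous_intros) auto
      have "(\<lambda>\<zeta>. (z * \<zeta>) ^ n / fact n) = (\<lambda>\<zeta>. (z ^ n / fact n) * \<zeta> powi (int n))"
        by (simp add: power_mult_distrib)
      then have "rmult (pr_plus w) (\<lambda>\<zeta>. (z * \<zeta>) ^ n / fact n)
          = rmult (rmult (pr_plus w) (\<lambda>_. z ^ n / fact n)) (\<lambda>\<zeta>. \<zeta> powi (int n))"
        by (subst rmult_rmult) (simp_all add: circle_bounded_powi circle_bounded_continuous del: power_int_of_nat)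
      then have "fourier (rmult (pr_plus w) (\<lambda>\<zeta>. (z * \<zeta>) ^ n / fact n)) m = 0"
        using m by (simp only: fourier_rmult_powi fourier_rmult_const) (simp add: pr_plus_minus)
      moreover have "rmult (pr_plus w) (\<lambda>\<zeta>. \<Sum>k<Suc n. (z * \<zeta>) ^ k / fact k)
          = rmult (pr_plus w) (\<lambda>\<zeta>. \<Sum>k<n. (z * \<zeta>) ^ k / fact k) + rmult (pr_plus w) (\<lambda>\<zeta>. (z * \<zeta>) ^ n / fact n)"
        unfolding sum.lessThan_Suc using cb[of "Suc n"] by (intro rmult_plus cb c) simp
      ultimately show ?case using Suc.IH by (simp only: fourier_add) simp
    qed
    have "norm (fourier (rmult (pr_plus w) (gamma1 z)) m) \<le> \<epsilon>" if "\<epsilon> > 0" for \<epsilon>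
    proof -
      define d where "d = \<epsilon> / (norm (pr_plus w) + 1)"
      have "d > 0" using that by (simp add: d_def add_nonneg_pos)
      \<comment> \<open>This is the bound exp|z| |z|^(n+1) / n! for the Taylor remainder, factored
        so that the general term of the exponential series appears.\<close>
      have "(\<lambda>n. exp (norm z) * norm z * (inverse (fact n) * norm z ^ n)) \<longlonglongrightarrow> exp (norm z) * norm z * 0"
        by (intro tendsto_mult tendsto_const summable_LIMSEQ_zero[OF summable_exp])
      then have "\<forall>\<^sub>F n in sequentially. exp (norm z) * norm z * (inverse (fact n) * norm z ^ n) < d"
        using \<open>d > 0\<close> by (intro order_tendstoD(2)) simp_all
      then have "\<exists>n. exp (norm z) * norm z * (inverse (fact n) * norm z ^ n) < d"
        by (rule eventually_happens'[OF sequentially_bot])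
      then obtain n where n: "exp (norm z) * norm z * (inverse (fact n) * norm z ^ n) < d" ..
      define p where "p \<zeta> = (\<Sum>k<Suc n. (z * \<zeta>) ^ k / fact k)" for \<zeta>
      have p: "circle_bounded p" and q: "circle_bounded (\<lambda>\<zeta>. gamma1 z \<zeta> - p \<zeta>)"
        unfolding p_def gamma1_def by (intro circle_bounded_continuous continuous_intros; simp)+
      have "rmult (pr_plus w) (gamma1 z) = rmult (pr_plus w) (\<lambda>\<zeta>. gamma1 z \<zeta> - p \<zeta>) + rmult (pr_plus w) p"
        by (subst rmult_plus[OF q p, symmetric]) (simp_all add: circle_bounded_gamma1)
      then have "fourier (rmult (pr_plus w) (gamma1 z)) m = fourier (rmult (pr_plus w) (\<lambda>\<zeta>. gamma1 z \<zeta> - p \<zeta>)) m"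
        using partial[of "Suc n"] by (simp only: fourier_add p_def[abs_def]) simp
      also have "norm \<dots> \<le> norm (rmult (pr_plus w) (\<lambda>\<zeta>. gamma1 z \<zeta> - p \<zeta>))" by (rule norm_fourier_le)
      also have "\<dots> \<le> d * norm (pr_plus w)"
      proof (rule norm_rmult_le[OF q])
        show "cmod (gamma1 z \<zeta> - p \<zeta>) \<le> d" if "norm \<zeta> = 1" for \<zeta>
          using Taylor_exp_field[of "z * \<zeta>" n] that n
          by (simp add: norm_mult gamma1_def p_def lessThan_Suc_atMost divide_inverse mult_ac del: sum.lessThan_Suc)
      qed
      also have "\<dots> \<le> \<epsilon>"
        using that by (simp add: d_def pos_divide_le_eq add_nonneg_pos distrib_left)
      finally show ?thesis .
    qed
    then have "norm (fourier (rmult (pr_plus w) (gamma1 z)) m) \<le> 0" by (rule field_le_epsilon) simp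
    then show ?thesis by simp
  qed
  moreover have "rmult w (gamma1 z) = rmult (pr_plus w) (gamma1 z) + rmult (pr_minus w) (gamma1 z)"
    by (subst rmult_add[OF circle_bounded_gamma1, symmetric]) (simp add: pr_plus_add_pr_minus)
  ultimately show ?thesis
    by (intro fourier_eqI) (simp add: pr_plus_minus fourier_add)
qed

text \<open>Otherwise there are unit vectors with images tending to 0. Compactness of
  \<open>pr_minus\<close> on W makes a subsequence converge, and its limit would be a unit vector in
  the kernel.\<close>

lemma baker_op_bounded_below:
  assumes W: "W \<in> Gr" and inj: "\<And>w. w \<in> W \<Longrightarrow> baker_op z w = 0 \<Longrightarrow> w = 0"
  shows "\<exists>c>0. \<forall>w\<in>W. c * norm w \<le> norm (baker_op z w)"
proof (rule ccontr)
  assume contra: "\<not> ?thesis"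
  have sW: "subspace W" and cW: "closed W"
    using W by (auto simp: Gr_def subspace_left_subspace)
  have "\<exists>w\<in>W. norm w = 1 \<and> norm (baker_op z w) < inverse (real (Suc n))" for n
  proof -
    obtain w where w: "w \<in> W" "norm (baker_op z w) < inverse (real (Suc n)) * norm w"
      using contra by (metis inverse_positive_iff_positive not_le of_nat_0_less_iff zero_less_Suc)
    then have "w \<noteq> 0" by auto
    have "norm (baker_op z (w /\<^sub>R norm w)) = norm (baker_op z w) / norm w"
      by (simp add: blinfun.scaleR_right divide_inverse mult.commute)
    also have "\<dots> < inverse (real (Suc n))" using w \<open>w \<noteq> 0\<close> by (simp add: pos_divide_less_eq)
    finally show ?thesis using w \<open>w \<noteq> 0\<close> by (intro bexI[of _ "w /\<^sub>R norm w"] subspace_mul sW) auto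
  qed
  then obtain w where w: "\<And>n. w n \<in> W" "\<And>n. norm (w n) = 1" "\<And>n. norm (baker_op z (w n)) < inverse (real (Suc n))"
    by metis
  obtain E where E: "orthonormal E" "E \<subseteq> W" "\<And>w. w \<in> W \<Longrightarrow> (\<forall>e\<in>E. inner w e = 0) \<Longrightarrow> w = 0"
    "(\<lambda>e. (norm (pr_minus e))\<^sup>2) summable_on E" using Gr_real_basis[OF W] by metis
  obtain r where r: "strict_mono r" "convergent (\<lambda>n. pr_minus (w (r n)))"
    by (rule Hilbert_Schmidt_convergent_subseq[OF E(1,2) sW cW E(3) bounded_linear_pr_minus E(4), of w])
      (auto simp: w)
  then obtain v where v: "(\<lambda>n. pr_minus (w (r n))) \<longlonglongrightarrow> v" by (auto simp: convergent_def)
  have "(\<lambda>n. norm (baker_op z (w n))) \<longlonglongrightarrow> 0"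
    by (rule tendsto_sandwich[OF _ _ tendsto_const LIMSEQ_inverse_real_of_nat])
      (use w(3) in \<open>auto intro!: always_eventually less_imp_le\<close>)
  then have "(\<lambda>n. baker_op z (w n)) \<longlonglongrightarrow> 0" by (rule tendsto_norm_zero_cancel)
  then have T0: "(\<lambda>n. baker_op z (w (r n))) \<longlonglongrightarrow> 0"
    using LIMSEQ_subseq_LIMSEQ[OF _ r(1)] by (simp add: o_def)
  \<comment> \<open>The vector is recovered from its image under \<open>baker_op z\<close> and from
    its negative part, so convergence of these two gives convergence of the subsequence.\<close>
  have "w (r n) = rmult (baker_op z (w (r n)) + pr_minus (rmult (pr_minus (w (r n))) (gamma1 (- z)))) (gamma1 z)" for n
    unfolding baker_op_apply pr_minus_rmult_gamma1[symmetric] pr_plus_add_pr_minus rmult_gamma1_cancel ..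
  moreover have "(\<lambda>n. rmult (baker_op z (w (r n)) + pr_minus (rmult (pr_minus (w (r n))) (gamma1 (- z)))) (gamma1 z))
    \<longlonglongrightarrow> rmult (0 + pr_minus (rmult v (gamma1 (- z)))) (gamma1 z)"
    by (intro bounded_linear.tendsto[OF bounded_linear_rmult[OF circle_bounded_gamma1]] tendsto_add T0
        bounded_linear.tendsto[OF bounded_linear_pr_minus] v)
  ultimately obtain l where l: "(\<lambda>n. w (r n)) \<longlonglongrightarrow> l" by simp
  have "l \<in> W" using closed_sequentially[OF cW _ l] w(1) by blast
  moreover have "baker_op z l = 0"
    using LIMSEQ_unique[OF blinfun.tendsto[OF tendsto_const l] T0] .
  ultimately have "l = 0" by (rule inj)
  with tendsto_norm[OF l] w(2) show False by (simp add: LIMSEQ_const_iff)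
qed

section \<open>The Baker function\<close>

text \<open>Together with \<open>baker_formI\<close> this trades the series for conditions on the
  Fourier coefficients of g: support in the nonpositive exponents and leading coefficient 1.\<close>

lemma baker_formD:
  assumes "baker_form z a \<psi>"
  obtains g where "\<psi> = rmult g (gamma1 z)" "fourier g 0 = 1" "\<And>m. m > 0 \<Longrightarrow> fourier g m = 0"
proof -
  obtain g where g: "a 0 = 1" "(\<lambda>k. qmonom (a k) (- int k)) sums g" "\<psi> = rmult g (gamma1 z)"
    using assms by (auto simp: baker_form_def gamma1_def)
  have "fourier g 0 = 1" using fourier_sums(1)[OF inj_int_uminus(1) g(2), of 0] g(1) by simp
  moreover have "fourier g m = 0" if "m > 0" for m
    by (rule fourier_sums(2)[OF inj_int_uminus(1) g(2)]) (use that in auto)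
  ultimately show ?thesis using g(3) that by blast
qed

lemma baker_formI:
  assumes "\<psi> = rmult g (gamma1 z)" "fourier g 0 = 1" "\<And>m. m > 0 \<Longrightarrow> fourier g m = 0"
  shows "baker_form z (\<lambda>k. fourier g (- int k)) \<psi>"
proof -
  have "fourier g m = 0" if "m \<notin> range (\<lambda>k. - int k)" for m
  proof (rule assms(3), rule ccontr)
    assume "\<not> m > 0"
    then have "m = - int (nat (- m))" by simp
    with that show False by blast
  qed
  then have "(\<lambda>k. qmonom (fourier g (- int k)) (- int k)) sums g"
    by (rule fourier_series_sums[OF inj_int_uminus(1)])
  with assms show ?thesis by (auto simp: baker_form_def gamma1_def)
qed

lemma baker_form_baker:
  assumes "baker_exists W z"
  shows "baker W z \<in> W" "\<exists>a. baker_form z a (baker W z)"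
  using theI'[OF assms[unfolded baker_exists_def]] by (auto simp: baker_def)

lemma baker_expansion:
  assumes "baker_exists W z"
  obtains g where "baker W z = rmult g (gamma1 z)" "fourier g 0 = 1" "\<And>m. m > 0 \<Longrightarrow> fourier g m = 0"
  using baker_form_baker(2)[OF assms] by (meson baker_formD)

lemma baker_op_baker:
  assumes "baker_exists W z"
  shows "baker_op z (baker W z) = qmonom 1 0"
proof -
  obtain g where g: "baker W z = rmult g (gamma1 z)" "fourier g 0 = 1" "\<And>m. m > 0 \<Longrightarrow> fourier g m = 0"
    by (rule baker_expansion[OF assms]) blast
  show ?thesis
    unfolding baker_op_apply g(1) rmult_gamma1_cancel
    by (rule fourier_eqI) (use g(2,3) in \<open>auto simp: pr_plus_minus fourier_qmonom\<close>)
qed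

text \<open>A kernel element times exp(- z \<zeta>) has only negative powers, so adding the element
  to the Baker function gives another element of W of the same form; uniqueness makes it 0.\<close>

lemma baker_op_inj:
  assumes W: "left_subspace W" and bk: "baker_exists W z" and w: "w \<in> W" "baker_op z w = 0"
  shows "w = 0"
proof -
  obtain g where g: "baker W z = rmult g (gamma1 z)" "fourier g 0 = 1" "\<And>m. m > 0 \<Longrightarrow> fourier g m = 0"
    by (rule baker_expansion[OF bk]) blast
  have "fourier (rmult w (gamma1 (- z))) m = 0" if "m \<ge> 0" for m
    using w(2) that pr_plus_minus(1)[of "rmult w (gamma1 (- z))" m] by (simp add: baker_op_apply)
  then have "baker_form z (\<lambda>k. fourier (g + rmult w (gamma1 (- z))) (- int k)) (baker W z + w)"
    using g by (intro baker_formI)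
      (simp_all add: rmult_add circle_bounded_gamma1 rmult_gamma1_cancel fourier_add)
  moreover have "baker W z + w \<in> W"
    using W w(1) baker_form_baker(1)[OF bk] by (simp add: left_subspace_def)
  ultimately have "baker W z + w = baker W z"
    using bk baker_form_baker[OF bk] unfolding baker_exists_def by blast
  then show ?thesis by simp
qed

lemma Ck_on_baker:
  assumes W: "W \<in> Gr" and bk: "\<And>z. baker_exists W z"
  shows "Ck_on k UNIV (baker W)"
proof (rule solution_Ck[where T = baker_op and r = "\<lambda>_. qmonom 1 0"])
  show "subspace W" "closed W" using W by (auto simp: Gr_def subspace_left_subspace)
  show "\<exists>c>0. \<forall>w\<in>W. c * norm w \<le> norm (baker_op z w)" for z
    by (rule baker_op_bounded_below[OF W baker_op_inj[OF _ bk]]) (use W in \<open>auto simp: Gr_def\<close>)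
qed (auto simp: Ck_on_baker_op Ck_on_const baker_form_baker bk baker_op_baker)

lemma baker_dbar:
  assumes W: "W \<in> Gr" and bk: "\<And>z. baker_exists W z" and D: "(baker W has_derivative D) (at z)"
  shows "\<exists>q. D 1 + of_cpx \<i> *\<^sub>Q D \<i> = q *\<^sub>Q baker W z"
proof -
  have lW: "left_subspace W" and cW: "closed W" using W by (auto simp: Gr_def)
  obtain g where g: "baker W z = rmult g (gamma1 z)" "fourier g 0 = 1" "\<And>m. m > 0 \<Longrightarrow> fourier g m = 0"
    by (rule baker_expansion[OF bk]) blast
  have DW: "D X \<in> W" for X
    by (rule has_derivative_in_closed_subspace[OF subspace_left_subspace[OF lW] cW D open_UNIV])
      (simp_all add: baker_form_baker(1) bk)
  have TD: "baker_op z (D X) = pr_plus (rmult g (\<lambda>\<zeta>. X * \<zeta>))" for X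
  proof -
    have "((\<lambda>w. baker_op w (baker W w)) has_derivative (\<lambda>X. baker_op z (D X)
        + (Blinfun pr_plus o\<^sub>L (rmult_op (gamma1 (- z)) o\<^sub>L rmult_op (\<lambda>\<zeta>. - X * \<zeta>))) (baker W z))) (at z)"
      by (rule bounded_bilinear.FDERIV[OF bounded_bilinear_blinfun_apply has_derivative_baker_op D])
    moreover have "((\<lambda>w. baker_op w (baker W w)) has_derivative (\<lambda>X. 0)) (at z)"
      by (simp add: baker_op_baker bk)
    ultimately have "(\<lambda>X. baker_op z (D X)
        + (Blinfun pr_plus o\<^sub>L (rmult_op (gamma1 (- z)) o\<^sub>L rmult_op (\<lambda>\<zeta>. - X * \<zeta>))) (baker W z)) = (\<lambda>X. 0)"
      by (rule has_derivative_unique)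
    then have "baker_op z (D X) = - (Blinfun pr_plus o\<^sub>L (rmult_op (gamma1 (- z)) o\<^sub>L rmult_op (\<lambda>\<zeta>. - X * \<zeta>))) (baker W z)"
      by (metis eq_neg_iff_add_eq_0)
    also have "\<dots> = - pr_plus (rmult (rmult (baker W z) (\<lambda>\<zeta>. - X * \<zeta>)) (gamma1 (- z)))"
      by (simp only: blinfun_apply_blinfun_compose rmult_op_apply circle_bounded_gamma1 circle_bounded_scale
          bounded_linear_Blinfun_apply bounded_linear_pr_plus)
    also have "rmult (rmult (baker W z) (\<lambda>\<zeta>. - X * \<zeta>)) (gamma1 (- z))
        = rmult (rmult (baker W z) (gamma1 (- z))) (\<lambda>\<zeta>. - X * \<zeta>)"
      unfolding rmult_rmult[OF circle_bounded_gamma1 circle_bounded_scale]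
        rmult_rmult[OF circle_bounded_scale circle_bounded_gamma1] by (simp only: mult.commute)
    also have "\<dots> = rmult g (\<lambda>\<zeta>. - X * \<zeta>)"
      by (simp add: g(1) rmult_gamma1_cancel)
    also have "- pr_plus \<dots> = pr_plus (rmult g (\<lambda>\<zeta>. X * \<zeta>))"
    proof -
      have "rmult g (\<lambda>\<zeta>. - X * \<zeta>) + rmult g (\<lambda>\<zeta>. X * \<zeta>) = rmult g (\<lambda>_. 0)"
        by (subst rmult_plus[symmetric]) (simp_all add: circle_bounded_continuous continuous_intros)
      also have "\<dots> = 0" by (rule fourier_zero_imp_zero) (simp add: fourier_rmult_const)
      finally have "pr_plus (rmult g (\<lambda>\<zeta>. - X * \<zeta>)) + pr_plus (rmult g (\<lambda>\<zeta>. X * \<zeta>)) = 0"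
        using linear_add[OF bounded_linear.linear[OF bounded_linear_pr_plus]]
          linear_0[OF bounded_linear.linear[OF bounded_linear_pr_plus]] by metis
      then show ?thesis by (simp add: neg_eq_iff_add_eq_0)
    qed
    finally show ?thesis .
  qed
  have fX: "fourier (rmult g (\<lambda>\<zeta>. X * \<zeta>)) m = fourier g (m - 1) * of_cpx X" for X m
  proof -
    have "rmult g (\<lambda>\<zeta>. X * \<zeta>) = rmult (rmult g (\<lambda>_. X)) (\<lambda>\<zeta>. \<zeta> powi 1)"
      by (subst rmult_rmult) (simp_all add: circle_bounded_continuous)
    then show ?thesis by (simp only: fourier_rmult_powi fourier_rmult_const)
  qed
  define q where "q = fourier g (- 1) + of_cpx \<i> * fourier g (- 1) * of_cpx \<i>"
  have ii: "of_cpx \<i> * of_cpx \<i> = - 1" by (simp add: of_cpx_mult[symmetric] of_cpx_minus)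
  have scale: "baker_op z (p *\<^sub>Q f) = p *\<^sub>Q baker_op z f" for p f
    by (simp add: baker_op_apply rmult_qscale circle_bounded_gamma1 pr_plus_qscale)
  have "baker_op z (D 1 + of_cpx \<i> *\<^sub>Q D \<i>) = baker_op z (q *\<^sub>Q baker W z)"
    unfolding blinfun.add_right scale baker_op_baker[OF bk] TD
  proof (rule fourier_eqI)
    fix m :: int
    consider "m < 0" | "m = 0" | "m = 1" | "m > 1" by linarith
    then show "fourier (pr_plus (rmult g (\<lambda>\<zeta>. 1 * \<zeta>)) + of_cpx \<i> *\<^sub>Q pr_plus (rmult g (\<lambda>\<zeta>. \<i> * \<zeta>))) m
      = fourier (q *\<^sub>Q qmonom 1 0) m"
      unfolding fourier_add fourier_qscale pr_plus_minus fX
      by cases (simp_all add: fourier_qmonom q_def g mult.assoc ii)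
  qed
  then have "baker_op z (D 1 + of_cpx \<i> *\<^sub>Q D \<i> - q *\<^sub>Q baker W z) = 0"
    by (simp add: blinfun.diff_right)
  moreover have "D 1 + of_cpx \<i> *\<^sub>Q D \<i> - q *\<^sub>Q baker W z \<in> W"
    using lW baker_form_baker(1)[OF bk, of z]
    by (intro subspace_diff subspace_add subspace_left_subspace) (auto simp: left_subspace_def DW)
  ultimately have "D 1 + of_cpx \<i> *\<^sub>Q D \<i> - q *\<^sub>Q baker W z = 0"
    using baker_op_inj[OF lW bk] by blast
  then show ?thesis by auto
qed

section \<open>Quaternionic vectors\<close>

lemma scaleR_smult: "r *\<^sub>R (x :: quat ^ 'n) = of_real r *s x"
  by (simp add: vec_eq_iff of_real_def)

lemma norm_smult: "norm (q *s x) = norm q * norm (x :: quat ^ 'n)"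
proof -
  have "(norm (q *s x))\<^sup>2 = (norm q * norm x)\<^sup>2"
    by (simp add: norm_vec_def L2_set_def sum_nonneg norm_mult power_mult_distrib sum_distrib_left[symmetric])
  then show ?thesis by (rule power2_eq_imp_eq) auto
qed

lemma bounded_bilinear_smult: "bounded_bilinear ((*s) :: quat \<Rightarrow> quat ^ 'n \<Rightarrow> quat ^ 'n)"
proof
  show "\<exists>K. \<forall>a b. norm (a *s (b :: quat ^ 'n)) \<le> norm a * norm b * K"
    by (rule exI[of _ 1]) (simp add: norm_smult)
qed (simp_all add: vec_eq_iff algebra_simps)

lemma bounded_linear_qcnj: "bounded_linear qcnj"
  by (rule bounded_linear_intro[where K = 1])
    (simp_all add: qcnj_def quat_eq_iff quat_defs norm_quat_def)

lemma mult_qcnj: "q * qcnj q = of_real ((norm q)\<^sup>2)"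
  using quat_mult_conj(1)[of q] by (simp add: qcnj_def of_real_def)

definition left_coord :: "quat ^ 'n \<Rightarrow> quat ^ 'n \<Rightarrow> quat"
  where "left_coord v x = inverse (inner v v) *\<^sub>R (\<Sum>k\<in>UNIV. x $ k * qcnj (v $ k))"

lemma left_coord_smult:
  assumes "v \<noteq> 0"
  shows "left_coord v (q *s v) = q"
proof -
  have "(\<Sum>k\<in>UNIV. (q *s v) $ k * qcnj (v $ k)) = q * of_real (\<Sum>k\<in>UNIV. (norm (v $ k))\<^sup>2)"
    by (simp add: mult.assoc mult_qcnj sum_distrib_left)
  also have "(\<Sum>k\<in>UNIV. (norm (v $ k))\<^sup>2) = inner v v"
    by (simp add: inner_vec_def power2_norm_eq_inner)
  finally show ?thesis using assms by (simp add: left_coord_def of_real_def)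
qed

lemma Ck_on_subset: "open U \<Longrightarrow> U \<subseteq> S \<Longrightarrow> Ck_on k S g \<Longrightarrow> Ck_on k U g"
  by (induction k arbitrary: g) (auto intro: continuous_on_subset)

lemma Ck_on_left_coord:
  fixes v x :: "complex \<Rightarrow> quat ^ 'n"
  assumes U: "open U" and v: "Ck_on k U v" "\<And>z. z \<in> U \<Longrightarrow> v z \<noteq> 0" and x: "Ck_on k U x"
  shows "Ck_on k U (\<lambda>z. left_coord (v z) (x z))"
  unfolding left_coord_def
  by (intro Ck_on_bilinear[OF bounded_bilinear_scaleR] Ck_on_inverse Ck_on_sum
      Ck_on_bilinear[OF bounded_bilinear_inner] Ck_on_bilinear[OF bounded_bilinear_mult]
      Ck_on_bounded_linear[OF bounded_linear_qcnj] Ck_on_bounded_linear[OF bounded_linear_vec_nth] U v x)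
    (simp add: v)

section \<open>Curves with values in quaternionic lines\<close>

lemma coset_self: "(0::'a::monoid_add) \<in> V \<Longrightarrow> w \<in> coset V w"
  unfolding coset_def by (rule image_eqI[of _ _ 0]) auto

lemma coset_eqI:
  fixes V :: "'a::ab_group_add set"
  assumes "\<And>v w. v \<in> V \<Longrightarrow> w \<in> V \<Longrightarrow> v + w \<in> V" "\<And>v. v \<in> V \<Longrightarrow> - v \<in> V" "a - b \<in> V"
  shows "coset V a = coset V b"
proof -
  have "coset V a \<subseteq> coset V b" if "a - b \<in> V" for a b
  proof
    fix x assume "x \<in> coset V a"
    then obtain v where "v \<in> V" "x = a + v" by (auto simp: coset_def)
    then show "x \<in> coset V b"
      unfolding coset_def using assms(1)[OF that \<open>v \<in> V\<close>] by (intro image_eqI[of _ _ "a - b + v"]) auto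
  qed
  from this[OF assms(3)] this[of b a] assms(2)[OF assms(3)] show ?thesis by auto
qed

lemma quat_holomorphic_curve_lines:
  fixes v :: "complex \<Rightarrow> quat ^ 'n" and f :: "complex set \<Rightarrow> (quat ^ 'n) set"
  assumes v: "\<And>k. Ck_on k UNIV v" "\<And>z. v z \<noteq> 0"
    and \<Lambda>: "0 \<in> \<Lambda>"
    and per: "\<And>l z. l \<in> \<Lambda> \<Longrightarrow> \<exists>c. c \<noteq> 0 \<and> v (z + l) = of_cpx c *s v z"
    and dbar: "\<And>z D. (v has_derivative D) (at z) \<Longrightarrow> \<exists>q. D 1 + of_cpx \<i> *s D \<i> = q *s v z"
    and f: "\<And>z. f (coset \<Lambda> z) = range (\<lambda>q. q *s v z)"
  shows "quat_holomorphic_curve \<Lambda> f"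
proof -
  have sect: "s z = left_coord (v z) (s z) *s v z" if "smooth_section \<Lambda> f U s" "z \<in> U" for U s z
  proof -
    have "s z \<in> f (coset \<Lambda> z)" using that by (simp add: smooth_section_def)
    then obtain q where "s z = q *s v z" by (auto simp: f)
    then show ?thesis using v(2) by (simp add: left_coord_smult)
  qed
  have vU: "Ck_on k U v" if "open U" for k U
    using Ck_on_subset[OF that subset_UNIV v(1)] .
  define J where "J p x = (let z = SOME z. p = coset \<Lambda> z in (left_coord (v z) x * of_cpx \<i>) *s v z)" for p x
  have J: "J (coset \<Lambda> z) (q *s v z) = (q * of_cpx \<i>) *s v z" for z q
  proof -
    define z' where "z' = (SOME z'. coset \<Lambda> z = coset \<Lambda> z')"
    have "coset \<Lambda> z = coset \<Lambda> z'" unfolding z'_def by (rule someI[of _ z]) simp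
    then have "z' \<in> coset \<Lambda> z" using coset_self[OF \<Lambda>] by simp
    then obtain l where "l \<in> \<Lambda>" "z' = z + l" by (auto simp: coset_def)
    then obtain c where c: "c \<noteq> 0" "v z' = of_cpx c *s v z" using per by metis
    have cc: "of_cpx (inverse c) * of_cpx c = 1" using c(1) by (simp add: of_cpx_mult[symmetric])
    have "q *s v z = (q * of_cpx (inverse c)) *s v z'"
      by (simp add: c(2) vector_smult_assoc mult.assoc cc)
    then have "left_coord (v z') (q *s v z) = q * of_cpx (inverse c)"
      by (simp only: left_coord_smult[OF v(2)])
    then have "J (coset \<Lambda> z) (q *s v z) = (q * of_cpx (inverse c) * of_cpx \<i> * of_cpx c) *s v z"
      by (simp add: J_def z'_def[symmetric] c(2) vector_smult_assoc)
    also have "q * of_cpx (inverse c) * of_cpx \<i> * of_cpx c = q * of_cpx \<i>"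
    proof -
      have "inverse c * (\<i> * c) = \<i>" using c(1) by (simp add: field_simps)
      then show ?thesis by (simp only: mult.assoc of_cpx_mult[symmetric])
    qed
    finally show ?thesis .
  qed
  have Js: "J (coset \<Lambda> z) (s z) = (left_coord (v z) (s z) * of_cpx \<i>) *s v z"
    if "smooth_section \<Lambda> f U s" "z \<in> U" for U s z
    using J[of z "left_coord (v z) (s z)"] sect[OF that, symmetric] by simp
  have lines: "smooth_line_bundle \<Lambda> f"
    unfolding smooth_line_bundle_def
  proof (intro conjI allI)
    show "f \<in> torus \<Lambda> \<rightarrow> HP" using v(2) by (auto simp: torus_def f HP_def)
    show "\<exists>U s. z \<in> U \<and> smooth_section \<Lambda> f U s \<and> (\<forall>w\<in>U. s w \<noteq> 0)" for z
    proof (intro exI conjI)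
      show "smooth_section \<Lambda> f UNIV v"
        using v by (auto simp: smooth_section_def f intro: image_eqI[of _ _ 1])
    qed (use v in auto)
  qed
  have endo: "bundle_endomorphism \<Lambda> f J"
    unfolding bundle_endomorphism_def
  proof (intro conjI ballI allI impI)
    fix p assume "p \<in> torus \<Lambda>"
    then obtain z where p: "p = coset \<Lambda> z" by (auto simp: torus_def)
    show "J p \<in> f p \<rightarrow> f p" by (auto simp: p f J)
    fix x assume "x \<in> f p"
    then obtain a where x: "x = a *s v z" by (auto simp: p f)
    show "J p (q *s x) = q *s J p x" for q
      by (simp add: p x J vector_smult_assoc mult.assoc)
    fix y assume "y \<in> f p"
    then obtain b where y: "y = b *s v z" by (auto simp: p f)
    have "J p (x + y) = J (coset \<Lambda> z) ((a + b) *s v z)"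
      by (simp add: p x y vector_sadd_rdistrib)
    also have "\<dots> = ((a + b) * of_cpx \<i>) *s v z" by (rule J)
    finally show "J p (x + y) = J p x + J p y"
      by (simp add: J p x y vector_sadd_rdistrib distrib_right)
  next
    fix U s assume s: "smooth_section \<Lambda> f U s"
    then have U: "open U" by (simp add: smooth_section_def)
    have "Ck_on k U (\<lambda>z. (left_coord (v z) (s z) * of_cpx \<i>) *s v z)" for k
      using s v(2)
      by (intro Ck_on_bilinear[OF bounded_bilinear_smult] Ck_on_bilinear[OF bounded_bilinear_mult]
          Ck_on_left_coord Ck_on_const vU U) (auto simp: smooth_section_def)
    then have "Ck_on k U (\<lambda>z. J (coset \<Lambda> z) (s z))" for k
      using Ck_on_cong[OF U Js[OF s], where k = k] by simp
    then show "smooth_section \<Lambda> f U (\<lambda>z. J (coset \<Lambda> z) (s z))"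
      using U by (auto simp: smooth_section_def Js[OF s] f)
  qed
  have "J p (J p x) = - x" if px: "p \<in> torus \<Lambda>" "x \<in> f p" for p x
  proof -
    obtain z where p: "p = coset \<Lambda> z" using px(1) by (auto simp: torus_def)
    obtain a where x: "x = a *s v z" using px(2) by (auto simp: p f)
    have "J p (J p x) = (a * (of_cpx \<i> * of_cpx \<i>)) *s v z" by (simp add: p x J mult.assoc)
    also have "of_cpx \<i> * of_cpx \<i> = - 1" by (simp add: of_cpx_mult[symmetric] of_cpx_minus)
    finally show ?thesis by (simp add: x vec_eq_iff)
  qed
  moreover have "delta \<Lambda> f s z (\<i> * X) = delta \<Lambda> f (\<lambda>w. J (coset \<Lambda> w) (s w)) z X"
    if s: "smooth_section \<Lambda> f U s" and z: "z \<in> U" for U s z X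
  proof -
    have U: "open U" and sk: "\<And>k. Ck_on k U s" using s by (auto simp: smooth_section_def)
    define q where "q w = left_coord (v w) (s w)" for w
    have "Ck_on (Suc 0) U q"
      unfolding q_def by (intro Ck_on_left_coord U vU v(2) sk)
    then obtain q' where q': "(q has_derivative q') (at z)" using z by (auto simp: differentiable_def)
    have "Ck_on (Suc 0) UNIV v" by (rule v(1))
    then obtain D where D: "(v has_derivative D) (at z)" by (auto simp: differentiable_def)
    have "((\<lambda>w. q w *s v w) has_derivative (\<lambda>X. q z *s D X + q' X *s v z)) (at z)"
      by (rule bounded_bilinear.FDERIV[OF bounded_bilinear_smult q' D])
    then have "(s has_derivative (\<lambda>X. q z *s D X + q' X *s v z)) (at z)"
      by (rule has_derivative_transform_within_open[OF _ U z]) (simp add: q_def sect[OF s, symmetric])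
    then have 1: "frechet_derivative s (at z) = (\<lambda>X. q z *s D X + q' X *s v z)"
      by (rule frechet_derivative_at[symmetric])
    have "((\<lambda>w. (q w * of_cpx \<i>) *s v w) has_derivative
        (\<lambda>X. (q z * of_cpx \<i>) *s D X + (q' X * of_cpx \<i>) *s v z)) (at z)"
      by (rule bounded_bilinear.FDERIV[OF bounded_bilinear_smult
            bounded_linear.has_derivative[OF bounded_linear_mult_left q'] D])
    then have "((\<lambda>w. J (coset \<Lambda> w) (s w)) has_derivative
        (\<lambda>X. (q z * of_cpx \<i>) *s D X + (q' X * of_cpx \<i>) *s v z)) (at z)"
      by (rule has_derivative_transform_within_open[OF _ U z]) (simp add: q_def Js[OF s])
    then have 2: "frechet_derivative (\<lambda>w. J (coset \<Lambda> w) (s w)) (at z)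
        = (\<lambda>X. (q z * of_cpx \<i>) *s D X + (q' X * of_cpx \<i>) *s v z)"
      by (rule frechet_derivative_at[symmetric])
    obtain c where c: "D 1 + of_cpx \<i> *s D \<i> = c *s v z" using dbar[OF D] by blast
    then have D1: "D 1 = c *s v z - of_cpx \<i> *s D \<i>" by (simp add: algebra_simps)
    have ii: "of_cpx \<i> * of_cpx \<i> = - 1" by (simp add: of_cpx_mult[symmetric] of_cpx_minus)
    have ii': "of_cpx \<i> * (of_cpx \<i> * x) = - x" for x by (simp add: mult.assoc[symmetric] ii)
    interpret D: bounded_linear D using D by (rule has_derivative_bounded_linear)
    have DX: "D Y = of_real (Re Y) *s D 1 + of_real (Im Y) *s D \<i>" for Y
    proof -
      have "D Y = D (Re Y *\<^sub>R 1 + Im Y *\<^sub>R \<i>)" by (rule arg_cong[of _ _ D]) (simp add: complex_eq_iff)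
      then show ?thesis by (simp only: D.add D.scaleR scaleR_smult)
    qed
    have "D (\<i> * X) - of_cpx \<i> *s D X = - (of_cpx (\<i> * cnj X) * c) *s v z"
    proof -
      have r: "of_cpx \<i> * (of_real r * x) = of_real r * (of_cpx \<i> * x)" for r x
        by (simp add: of_real_def)
      have e: "of_cpx (\<i> * cnj X) = of_real (Re X) * of_cpx \<i> + of_real (Im X)"
      proof -
        have "\<i> * cnj X = of_real (Re X) * \<i> + of_real (Im X)" by (simp add: complex_eq_iff)
        then show ?thesis by (simp only: of_cpx_add of_cpx_mult of_cpx_of_real)
      qed
      show ?thesis
        unfolding DX[of X] DX[of "\<i> * X"] D1 e
        by (simp add: vec_eq_iff algebra_simps r ii ii')
    qed
    then have *: "D (\<i> * X) = of_cpx \<i> *s D X + (- (of_cpx (\<i> * cnj X) * c)) *s v z"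
      by (simp add: algebra_simps)
    have "frechet_derivative s (at z) (\<i> * X) - frechet_derivative (\<lambda>w. J (coset \<Lambda> w) (s w)) (at z) X
        = (q z * - (of_cpx (\<i> * cnj X) * c) + q' (\<i> * X) - q' X * of_cpx \<i>) *s v z"
      unfolding 1 2 * by (simp add: vec_eq_iff algebra_simps)
    then have mem: "frechet_derivative s (at z) (\<i> * X) - frechet_derivative (\<lambda>w. J (coset \<Lambda> w) (s w)) (at z) X
        \<in> f (coset \<Lambda> z)" unfolding f by (rule range_eqI)
    show ?thesis
      unfolding delta_def
    proof (rule coset_eqI[OF _ _ mem])
      show "x + y \<in> f (coset \<Lambda> z)" if xy: "x \<in> f (coset \<Lambda> z)" "y \<in> f (coset \<Lambda> z)" for x y
      proof -
        obtain a b where "x = a *s v z" "y = b *s v z" using xy by (auto simp: f)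
        then have "x + y = (a + b) *s v z" by simp
        then show ?thesis unfolding f by (rule range_eqI)
      qed
      show "- x \<in> f (coset \<Lambda> z)" if x: "x \<in> f (coset \<Lambda> z)" for x
      proof -
        obtain a where "x = a *s v z" using x by (auto simp: f)
        then have "- x = (- a) *s v z" by (simp add: vec_eq_iff)
        then show ?thesis unfolding f by (rule range_eqI)
      qed
    qed
  qed
  ultimately show ?thesis
    unfolding quat_holomorphic_curve_def using lines endo by blast
qed

section \<open>Finite dimensional quotients\<close>

lemma left_subspace_uminus: "left_subspace V \<Longrightarrow> v \<in> V \<Longrightarrow> - v \<in> V"
  unfolding left_subspace_def by (metis qscale_minus_one)

lemma left_subspace_diff: "left_subspace V \<Longrightarrow> v \<in> V \<Longrightarrow> w \<in> V \<Longrightarrow> v - w \<in> V"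
  using left_subspace_uminus[of V w] unfolding left_subspace_def by (metis diff_conv_add_uminus)

lemma coset_eq_iff:
  assumes "left_subspace V"
  shows "coset V a = coset V b \<longleftrightarrow> a - b \<in> V"
proof
  assume "coset V a = coset V b"
  then have "a \<in> coset V b" using coset_self[of V a] assms by (simp add: left_subspace_def)
  then show "a - b \<in> V" by (auto simp: coset_def)
next
  assume "a - b \<in> V"
  with assms show "coset V a = coset V b"
    by (intro coset_eqI) (auto simp: left_subspace_uminus left_subspace_def)
qed

text \<open>The distance to \<open>V\<close> is bounded below on the unit sphere of a complement of \<open>V\<close>.\<close>

lemma quot_iso_bounded:
  fixes \<phi> :: "L2H set \<Rightarrow> quat ^ 'n"
  assumes \<phi>: "quot_iso W V \<phi>" and W: "left_subspace W" and V: "left_subspace V" "closed V" "V \<subseteq> W"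
  shows "\<exists>K. \<forall>w\<in>W. norm (\<phi> (coset V w)) \<le> K * norm w"
proof -
  define A where "A w = \<phi> (coset V w)" for w
  have A: "A (w + w') = A w + A w'" "A (q *\<^sub>Q w) = q *s A w" if "w \<in> W" "w' \<in> W" for w w' q
    using \<phi> that by (auto simp: quot_iso_def A_def)
  have A0: "A w = 0 \<longleftrightarrow> w \<in> V" if "w \<in> W" for w
  proof -
    have 0: "0 \<in> W" using W by (simp add: left_subspace_def)
    have "A 0 = 0" using A(1)[OF 0 0] by simp
    then have "A w = 0 \<longleftrightarrow> \<phi> (coset V w) = \<phi> (coset V 0)" by (simp add: A_def)
    also have "\<dots> \<longleftrightarrow> coset V w = coset V 0"
    proof (rule inj_on_eq_iff)
      show "inj_on \<phi> (quot W V)" using \<phi> by (auto simp: quot_iso_def bij_betw_def)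
    qed (use that 0 in \<open>auto simp: quot_def\<close>)
    finally show ?thesis by (simp add: coset_eq_iff[OF V(1)])
  qed
  have "\<exists>b\<in>W. A b = y" for y
  proof -
    have "y \<in> \<phi> ` quot W V" using \<phi> by (simp add: quot_iso_def bij_betw_def)
    then show ?thesis by (auto simp: quot_def A_def)
  qed
  then have "\<exists>b. \<forall>i :: 'n. b i \<in> W \<and> A (b i) = axis i 1" by (intro choice allI) blast
  then obtain b where b: "\<And>i :: 'n. b i \<in> W" "\<And>i. A (b i) = axis i 1" by blast
  define B where "B y = (\<Sum>i\<in>UNIV. (y $ i) *\<^sub>Q b i)" for y :: "quat ^ 'n"
  have sums: "(\<Sum>i\<in>I. (y $ i) *\<^sub>Q b i) \<in> W \<and> A (\<Sum>i\<in>I. (y $ i) *\<^sub>Q b i) = (\<Sum>i\<in>I. (y $ i) *s axis i 1)"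
    if "finite I" for y I
    using that
  proof (induction I rule: finite_induct)
    case empty
    then show ?case using W V(1) A0[of 0] by (simp add: left_subspace_def)
  next
    case (insert i I)
    have "(y $ i) *\<^sub>Q b i \<in> W" using W b by (simp add: left_subspace_def)
    then show ?case using insert W by (simp add: A b) (simp add: left_subspace_def)
  qed
  have BW: "B y \<in> W" and AB: "A (B y) = y" for y
    using sums[of UNIV y] basis_expansion[of y] by (auto simp: B_def)
  have Bc: "continuous_on UNIV B"
    unfolding B_def
    by (intro continuous_on_sum bounded_bilinear.continuous_on[OF bounded_bilinear_qscale] continuous_intros)
  have B_scaleR: "B (r *\<^sub>R y) = r *\<^sub>R B y" for r y
    by (simp add: B_def scaleR_sum_right bounded_bilinear.scaleR_left[OF bounded_bilinear_qscale])
  have ne: "sphere (0 :: quat ^ 'n) 1 \<noteq> {}" by simp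
  have "continuous_on (sphere 0 1) (\<lambda>y. infdist (B y) V)"
    by (intro continuous_on_infdist continuous_on_subset[OF Bc]) auto
  from continuous_attains_inf[OF compact_sphere ne this] obtain y0
    where y0: "norm y0 = 1" "\<And>y. norm y = 1 \<Longrightarrow> infdist (B y0) V \<le> infdist (B y) V" by auto
  define c where "c = infdist (B y0) V"
  have "y0 \<noteq> 0" using y0 by auto
  then have "B y0 \<notin> V" using A0[OF BW, of y0] AB by simp
  moreover have "V \<noteq> {}" using V(1) by (auto simp: left_subspace_def)
  ultimately have "c > 0" unfolding c_def using V(2) by (simp add: infdist_pos_not_in_closed)
  have "norm (A w) \<le> 1 / c * norm w" if w: "w \<in> W" for w
  proof (cases "A w = 0")
    case False
    define u where "u = A w /\<^sub>R norm (A w)"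
    have u: "norm u = 1" using False by (simp add: u_def)
    have w': "w /\<^sub>R norm (A w) \<in> W" using subspace_mul[OF subspace_left_subspace[OF W] w] .
    have "A (w /\<^sub>R norm (A w)) = u"
      using A(2)[OF w w, of "of_real (inverse (norm (A w)))"]
      by (simp only: qscale_of_real u_def scaleR_smult)
    have "A (B u - w /\<^sub>R norm (A w)) = 0"
    proof -
      have "A (B u) = A (B u - w /\<^sub>R norm (A w)) + A (w /\<^sub>R norm (A w))"
        using A(1)[OF left_subspace_diff[OF W BW w'] w', of u] by simp
      then show ?thesis using AB[of u] \<open>A (w /\<^sub>R norm (A w)) = u\<close> by simp
    qed
    then have "B u - w /\<^sub>R norm (A w) \<in> V"
      using A0[OF left_subspace_diff[OF W BW w']] by simp
    then have "infdist (B u) V \<le> dist (B u) (B u - w /\<^sub>R norm (A w))" by (rule infdist_le)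
    then have "c \<le> norm w / norm (A w)"
      using y0(2)[OF u] by (simp add: c_def dist_norm divide_inverse mult.commute)
    then show ?thesis using \<open>c > 0\<close> False by (simp add: field_simps)
  qed (use \<open>c > 0\<close> in simp)
  then show ?thesis unfolding A_def by blast
qed

lemma quot_line_smult_mod:
  assumes V: "left_subspace V" and c: "c \<noteq> 0" and w: "w' - c *\<^sub>Q w \<in> V"
  shows "quot_line V w' = quot_line V w"
proof -
  have eq: "coset V (q *\<^sub>Q w') = coset V ((q * c) *\<^sub>Q w)" for q
  proof -
    have "q *\<^sub>Q (w' - c *\<^sub>Q w) \<in> V" using V w by (simp add: left_subspace_def)
    then show ?thesis
      by (simp add: coset_eq_iff[OF V] bounded_bilinear.diff_right[OF bounded_bilinear_qscale] qscale_qscale)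
  qed
  have "coset V (q *\<^sub>Q w) = coset V ((q * inverse c) *\<^sub>Q w')" for q
    using c by (simp add: eq mult.assoc)
  then show ?thesis unfolding quot_line_def using eq by (auto simp: image_iff)
qed

theorem theorem4p1:
  fixes W V :: "L2H set" and \<Lambda> :: "complex set" and \<mu> :: "complex \<Rightarrow> complex" and n :: nat
  assumes W: "W \<in> Gr"
    and baker: "\<forall>z. baker_exists W z"
    and torus: "torus_orbit W \<Lambda>"
    and mu_circle: "\<forall>l\<in>\<Lambda>. \<mu> l \<in> sphere 0 1"
    and mu_hom: "\<forall>l\<in>\<Lambda>. \<forall>l'\<in>\<Lambda>. \<mu> (l + l') = \<mu> l * \<mu> l'"
    and monodromy: "\<forall>l\<in>\<Lambda>. \<forall>z m. L_op W m (z + l) =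
      of_cpx (inverse (\<mu> l)) * L_op W m z * of_cpx (\<mu> l)"
    and V: "left_subspace V" "closed V" "V \<subseteq> W"
    and codim: "quot_dim UNIV W V (n + 1)"
    and card: "CARD('n::finite) = n + 1"
    and not_in_V: "\<forall>z. baker W z \<notin> V"
    and periods: "\<forall>l\<in>\<Lambda>. \<forall>z. baker W (z + l) - of_cpx (inverse (\<mu> l)) *\<^sub>Q baker W z \<in> V"
  shows "\<exists>f. (\<forall>z. f (coset \<Lambda> z) = quot_line V (baker W z)) \<and>
    f \<in> torus \<Lambda> \<rightarrow> proj_quot W V \<and>
    (\<forall>\<phi> :: L2H set \<Rightarrow> quat ^ 'n. quot_iso W V \<phi> \<longrightarrow>
      quat_holomorphic_curve \<Lambda> (\<lambda>p. \<phi> ` f p))"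
proof -
  have lW: "left_subspace W" and cW: "closed W" using W by (auto simp: Gr_def)
  have bk: "\<And>z. baker_exists W z" using baker by blast
  have bW: "baker W z \<in> W" for z by (rule baker_form_baker(1)[OF bk])
  have \<Lambda>0: "0 \<in> \<Lambda>"
  proof -
    obtain \<omega>1 \<omega>2 where "\<Lambda> = {of_int k * \<omega>1 + of_int l * \<omega>2 | k l. True}"
      using torus by (auto simp: torus_orbit_def is_lattice_def)
    then show ?thesis by (auto intro!: exI[of _ 0])
  qed
  have mu0: "inverse (\<mu> l) \<noteq> 0" if "l \<in> \<Lambda>" for l
    using mu_circle that by fastforce
  define f where "f p = quot_line V (baker W (SOME z. p = coset \<Lambda> z))" for p
  have f: "f (coset \<Lambda> z) = quot_line V (baker W z)" for z
  proof -
    define z' where "z' = (SOME z'. coset \<Lambda> z = coset \<Lambda> z')"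
    have "coset \<Lambda> z = coset \<Lambda> z'" unfolding z'_def by (rule someI[of _ z]) simp
    then have "z' \<in> coset \<Lambda> z" using coset_self[OF \<Lambda>0] by simp
    then obtain l where l: "l \<in> \<Lambda>" "z' = z + l" by (auto simp: coset_def)
    have "quot_line V (baker W z') = quot_line V (baker W z)"
    proof (rule quot_line_smult_mod[OF V(1)])
      show "of_cpx (inverse (\<mu> l)) \<noteq> 0" using mu0[OF l(1)] by (simp add: of_cpx_def zero_quat_def)
      show "baker W z' - of_cpx (inverse (\<mu> l)) *\<^sub>Q baker W z \<in> V" using periods l by simp
    qed
    then show ?thesis by (simp add: f_def z'_def)
  qed
  have "quat_holomorphic_curve \<Lambda> (\<lambda>p. \<phi> ` f p)"
    if \<phi>: "quot_iso W V \<phi>" for \<phi> :: "L2H set \<Rightarrow> quat ^ 'n"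
  proof -
    define A where "A w = \<phi> (coset V w)" for w
    have Aadd: "A (w + w') = A w + A w'" if "w \<in> W" "w' \<in> W" for w w'
      using \<phi> that by (auto simp: quot_iso_def A_def)
    have Aq: "A (q *\<^sub>Q w) = q *s A w" if "w \<in> W" for w q
      using \<phi> that by (auto simp: quot_iso_def A_def)
    have Ar: "A (r *\<^sub>R w) = r *\<^sub>R A w" if "w \<in> W" for w r
      using Aq[OF that, of "of_real r"] by (simp add: qscale_of_real scaleR_smult)
    obtain K where K: "\<And>w. w \<in> W \<Longrightarrow> norm (A w) \<le> K * norm w"
      using quot_iso_bounded[OF \<phi> lW V] unfolding A_def by blast
    note sub = subspace_left_subspace[OF lW] cW Aadd Ar K
    define v where "v z = A (baker W z)" for z
    have A_eq: "A w = A w' \<longleftrightarrow> w - w' \<in> V" if "w \<in> W" "w' \<in> W" for w w'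
    proof -
      have "inj_on \<phi> (quot W V)" using \<phi> by (auto simp: quot_iso_def bij_betw_def)
      then have "A w = A w' \<longleftrightarrow> coset V w = coset V w'"
        unfolding A_def by (rule inj_on_eq_iff) (use that in \<open>auto simp: quot_def\<close>)
      then show ?thesis by (simp add: coset_eq_iff[OF V(1)])
    qed
    show ?thesis
    proof (rule quat_holomorphic_curve_lines[where v = v])
      show "Ck_on k UNIV v" for k
        unfolding v_def
        by (rule Ck_on_bounded_linear_on[OF sub open_UNIV Ck_on_baker[OF W bk] bW])
      show "v z \<noteq> 0" for z
      proof -
        have 0: "0 \<in> W" using lW by (simp add: left_subspace_def)
        have "A 0 = 0" using Aadd[OF 0 0] by simp
        then show ?thesis using A_eq[OF bW 0, of z] not_in_V by (simp add: v_def)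
      qed
      show "0 \<in> \<Lambda>" by (rule \<Lambda>0)
      show "\<exists>c. c \<noteq> 0 \<and> v (z + l) = of_cpx c *s v z" if "l \<in> \<Lambda>" for l z
      proof (intro exI conjI)
        show "inverse (\<mu> l) \<noteq> 0" by (rule mu0[OF that])
        have "of_cpx (inverse (\<mu> l)) *\<^sub>Q baker W z \<in> W" using lW bW by (simp add: left_subspace_def)
        then have "A (baker W (z + l)) = A (of_cpx (inverse (\<mu> l)) *\<^sub>Q baker W z)"
          using periods that by (simp add: A_eq bW)
        then show "v (z + l) = of_cpx (inverse (\<mu> l)) *s v z" by (simp add: v_def Aq bW)
      qed
      show "\<exists>q. D 1 + of_cpx \<i> *s D \<i> = q *s v z" if D: "(v has_derivative D) (at z)" for z D
      proof -
        have "Ck_on (Suc 0) UNIV (baker W)" by (rule Ck_on_baker[OF W bk])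
        then obtain B where B: "(baker W has_derivative B) (at z)" by (auto simp: differentiable_def)
        have BW: "B X \<in> W" for X
          by (rule has_derivative_in_closed_subspace[OF sub(1,2) B open_UNIV]) (simp_all add: bW)
        have "(v has_derivative (\<lambda>X. A (B X))) (at z)"
          unfolding v_def by (rule has_derivative_bounded_linear_on[OF sub B open_UNIV]) (simp_all add: bW)
        with D have "D = (\<lambda>X. A (B X))" by (rule has_derivative_unique)
        moreover obtain q where "B 1 + of_cpx \<i> *\<^sub>Q B \<i> = q *\<^sub>Q baker W z"
          using baker_dbar[OF W bk B] by blast
        then have "A (B 1 + of_cpx \<i> *\<^sub>Q B \<i>) = A (q *\<^sub>Q baker W z)" by simp
        moreover have "of_cpx \<i> *\<^sub>Q B \<i> \<in> W" using lW BW by (simp add: left_subspace_def)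
        ultimately show ?thesis by (auto simp: Aadd Aq BW bW v_def)
      qed
      show "\<phi> ` f (coset \<Lambda> z) = range (\<lambda>q. q *s v z)" for z
        unfolding f quot_line_def image_image v_def using Aq[OF bW] by (simp add: A_def)
    qed
  qed
  moreover have "f \<in> torus \<Lambda> \<rightarrow> proj_quot W V"
    using bW not_in_V by (auto simp: torus_def f proj_quot_def)
  ultimately show ?thesis using f by blast
qed

end
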